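(* Let $\boldsymbol\Lambda$ and $\mathbf c$ be given by either choice (i) or choice (ii) of the context. There exists a constant $\kappa_0>0$ such that $$\inf_{\mathbf U\in\mathbb K_{\mathbb B}}\ \sup_{\mathbf V\in\mathbb K_{\mathbb B}}\frac{\mathbb A(\mathbf U,\mathbf V)}{|||\mathbf U|||_{\mathbb V}\,|||\mathbf V|||_{\mathbb V}}\ge\kappa_0$$ (infimum and supremum over nonzero elements), where $\mathbb V$, $\mathbb A$ and $\mathbb K_{\mathbb B}$ are defined in the context.
   Context: $d\in\{2,3\}$; $\Omega,\mathcal B\subset\mathbb R^d$ are bounded Lipschitz domains; $\overline{\mathbf X}\in W^{1,\infty}(\mathcal B)^d$ is invertible onto its image with Lipschitz inverse, and the closure of $\overline{\mathbf X}(\mathcal B)$ is contained in $\Omega$. $\mathbf v(\overline{\mathbf X})=\mathbf v\circ\overline{\mathbf X}$. $(\cdot,\cdot)$, $(\cdot,\cdot)_{\mathcal B}$ are the $L^2(\Omega)$, $L^2(\mathcal B)$ scalar products; $\|\cdot\|_1$, $\|\cdot\|_{1,\mathcal B}$ the $H^1(\Omega)$, $H^1(\mathcal B)$ norms; $L^2_0(\Omega)$ the zero-mean functions in $L^2(\Omega)$. $\mathbf a_f(\mathbf u,\mathbf v)=\alpha(\mathbf u,\mathbf v)+\nu(\nabla_{\rm sym}\mathbf u,\nabla_{\rm sym}\mathbf v)$ and $\mathbf a_s(\mathbf X,\mathbf Y)=\beta(\mathbf X,\mathbf Y)_{\mathcal B}+\gamma(\nabla_s\mathbf X,\nabla_s\mathbf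 Y)_{\mathcal B}$, with constants $\alpha,\nu,\gamma>0$, $\beta\ge0$, $\nabla_{\rm sym}\mathbf u=\frac12(\nabla\mathbf u+\nabla\mathbf u^\top)$. Choice (i): $\boldsymbol\Lambda=(H^1(\mathcal B)^d)'$ with the dual norm and $\mathbf c(\boldsymbol\mu,\mathbf Y)=\langle\boldsymbol\mu,\mathbf Y\rangle$ the duality pairing. Choice (ii): $\boldsymbol\Lambda=H^1(\mathcal B)^d$ with its norm and $\mathbf c(\boldsymbol\mu,\mathbf Y)=(\nabla_s\boldsymbol\mu,\nabla_s\mathbf Y)_{\mathcal B}+(\boldsymbol\mu,\mathbf Y)_{\mathcal B}$. $\mathbb V=H^1_0(\Omega)^d\times H^1(\mathcal B)^d\times\boldsymbol\Lambda$ with norm $|||(\mathbf v,\mathbf Y,\boldsymbol\mu)|||_{\mathbb V}=(\|\mathbf v\|_1^2+\|\mathbf Y\|_{1,\mathcal B}^2+\|\boldsymbol\mu\|_{\boldsymbol\Lambda}^2)^{1/2}$. For $\mathbf U=(\mathbf u,\mathbf X,\boldsymbol\lambda)$ and $\mathbf V=(\mathbf v,\mathbf Y,\boldsymbol\mu)$ in $\mathbb V$, $\mathbb A(\mathbf U,\mathbf V)=\mathbf a_f(\mathbf u,\mathbf v)+\mathbf a_s(\mathbf X,\mathbf Y)+\mathbf c(\boldsymbol\lambda,\mathbf v(\overline{\mathbf X})-\mathbf Y)-\mathbf c(\boldsymbol\mu,\mathbf u(\overline{\mathbf X})-\mathbf X)$, and $\mathbb K_{\mathbb B}=\{(\mathbf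 v,\mathbf Y,\boldsymbol\mu)\in\mathbb V:({\rm div}\,\mathbf v,q)=0\ \forall q\in L^2_0(\Omega)\}$. *)

theory Defs
  imports "HOL-Analysis.Analysis"
begin

section \<open>Lebesgue spaces\<close>

text \<open>
  Elements of function spaces are represented by functions rather than by classes of functions
  modulo almost everywhere equality; all integrals below are insensitive to the representative.
  Consequently the norms are seminorms on the function level, and an element is zero
  iff its norm vanishes.
\<close>

definition L2 :: "'a::euclidean_space set \<Rightarrow> ('a \<Rightarrow> 'b::euclidean_space) set" where
  "L2 S = {f \<in> borel_measurable (lebesgue_on S). integrable (lebesgue_on S) (\<lambda>x. (norm (f x))\<^sup>2)}"

text \<open>For matrix-valued functions \<open>\<bullet>\<close> is the Frobenius product.\<close>

definition l2_inner :: "'a::euclidean_space set \<Rightarrow> ('a \<Rightarrow> 'b::euclidean_space) \<Rightarrow> ('a \<Rightarrow> 'b) \<Rightarrow> real" where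
  "l2_inner S f g = (LINT x|lebesgue_on S. f x \<bullet> g x)"

definition L2_zero_mean :: "'a::euclidean_space set \<Rightarrow> ('a \<Rightarrow> real) set" where
  "L2_zero_mean S = {q \<in> L2 S. (LINT x|lebesgue_on S. q x) = 0}"

definition Linf :: "'a::euclidean_space set \<Rightarrow> ('a \<Rightarrow> 'b::euclidean_space) set" where
  "Linf S = {f \<in> borel_measurable (lebesgue_on S). \<exists>M. AE x in lebesgue_on S. norm (f x) \<le> M}"

section \<open>Lipschitz domains\<close>

text \<open>
  Near each boundary point the set is the strict epigraph, in some direction \<open>e\<close>,
  of a Lipschitz function on the hyperplane orthogonal to \<open>e\<close>.
\<close>

definition bounded_lipschitz_domain :: "'a::euclidean_space set \<Rightarrow> bool" where
  "bounded_lipschitz_domain S \<longleftrightarrow>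
     open S \<and> connected S \<and> S \<noteq> {} \<and> bounded S \<and>
     (\<forall>x \<in> frontier S. \<exists>U e g L. open U \<and> x \<in> U \<and> norm e = 1 \<and>
        L-lipschitz_on {y. y \<bullet> e = 0} g \<and>
        S \<inter> U = {y \<in> U. g (y - (y \<bullet> e) *\<^sub>R e) < y \<bullet> e})"

section \<open>Test functions and Sobolev spaces\<close>

primrec continuously_differentiable ::
    "nat \<Rightarrow> ('a::euclidean_space \<Rightarrow> 'b::real_normed_vector) \<Rightarrow> bool" where
  "continuously_differentiable 0 f \<longleftrightarrow> continuous_on UNIV f"
| "continuously_differentiable (Suc k) f \<longleftrightarrow>
     (\<forall>x. f differentiable (at x)) \<and>
     (\<forall>i \<in> Basis. continuously_differentiable k (\<lambda>x. frechet_derivative f (at x) i))"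

definition test_functions :: "'a::euclidean_space set \<Rightarrow> ('a \<Rightarrow> 'b::real_normed_vector) set" where
  "test_functions S = {\<phi>. (\<forall>k. continuously_differentiable k \<phi>) \<and>
     compact (closure {x. \<phi> x \<noteq> 0}) \<and> closure {x. \<phi> x \<noteq> 0} \<subseteq> S}"

text \<open>The entry \<open>G x $ i $ j\<close> is the weak derivative of the component \<open>v\<^sub>i\<close> in direction \<open>j\<close>.\<close>

definition has_weak_gradient ::
    "(real^'d \<Rightarrow> real^'d) \<Rightarrow> (real^'d \<Rightarrow> real^'d^'d) \<Rightarrow> (real^'d) set \<Rightarrow> bool" where
  "has_weak_gradient v G S \<longleftrightarrow>
     (\<forall>K. compact K \<and> K \<subseteq> S \<longrightarrow> v absolutely_integrable_on K \<and> G absolutely_integrable_on K) \<and>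
     (\<forall>\<phi> \<in> test_functions S. \<forall>i j.
        (LINT x|lebesgue_on S. v x $ i * frechet_derivative \<phi> (at x) (axis j 1)) =
        - (LINT x|lebesgue_on S. G x $ i $ j * \<phi> x))"

text \<open>The weak gradient is unique up to null sets, so the choice below is immaterial.\<close>

definition weak_grad :: "(real^'d) set \<Rightarrow> (real^'d \<Rightarrow> real^'d) \<Rightarrow> real^'d \<Rightarrow> real^'d^'d" where
  "weak_grad S v = (SOME G. has_weak_gradient v G S)"

definition weak_grad_sym :: "(real^'d) set \<Rightarrow> (real^'d \<Rightarrow> real^'d) \<Rightarrow> real^'d \<Rightarrow> real^'d^'d" where
  "weak_grad_sym S v = (\<lambda>x. (1/2) *\<^sub>R (weak_grad S v x + transpose (weak_grad S v x)))"

definition weak_div :: "(real^'d) set \<Rightarrow> (real^'d \<Rightarrow> real^'d) \<Rightarrow> real^'d \<Rightarrow> real" where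
  "weak_div S v = (\<lambda>x. trace (weak_grad S v x))"

definition W1inf :: "(real^'d) set \<Rightarrow> (real^'d \<Rightarrow> real^'d) set" where
  "W1inf S = {v \<in> Linf S. \<exists>G \<in> Linf S. has_weak_gradient v G S}"

definition H1 :: "(real^'d) set \<Rightarrow> (real^'d \<Rightarrow> real^'d) set" where
  "H1 S = {v \<in> L2 S. \<exists>G \<in> L2 S. has_weak_gradient v G S}"

definition h1_inner :: "(real^'d) set \<Rightarrow> (real^'d \<Rightarrow> real^'d) \<Rightarrow> (real^'d \<Rightarrow> real^'d) \<Rightarrow> real" where
  "h1_inner S v w = l2_inner S (weak_grad S v) (weak_grad S w) + l2_inner S v w"

definition h1_norm :: "(real^'d) set \<Rightarrow> (real^'d \<Rightarrow> real^'d) \<Rightarrow> real" where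
  "h1_norm S v = sqrt (h1_inner S v v)"

definition H10 :: "(real^'d) set \<Rightarrow> (real^'d \<Rightarrow> real^'d) set" where
  "H10 S = {v \<in> H1 S. \<forall>\<epsilon>>0. \<exists>\<phi> \<in> test_functions S. h1_norm S (\<lambda>x. v x - \<phi> x) < \<epsilon>}"

text \<open>
  The topological dual of \<open>H1 S\<close>. Functionals are total functions of which only the
  values on \<open>H1 S\<close> matter; boundedness makes them respect almost everywhere equality.
\<close>

definition H1_dual :: "(real^'d) set \<Rightarrow> ((real^'d \<Rightarrow> real^'d) \<Rightarrow> real) set" where
  "H1_dual S = {\<mu>.
     (\<forall>Y \<in> H1 S. \<forall>Z \<in> H1 S. \<mu> (\<lambda>x. Y x + Z x) = \<mu> Y + \<mu> Z) \<and>
     (\<forall>a. \<forall>Y \<in> H1 S. \<mu> (\<lambda>x. a *\<^sub>R Y x) = a * \<mu> Y) \<and>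
     (\<exists>C. \<forall>Y \<in> H1 S. \<bar>\<mu> Y\<bar> \<le> C * h1_norm S Y)}"

definition h1_dual_norm :: "(real^'d) set \<Rightarrow> ((real^'d \<Rightarrow> real^'d) \<Rightarrow> real) \<Rightarrow> real" where
  "h1_dual_norm S \<mu> = (SUP Y \<in> {Y \<in> H1 S. h1_norm S Y \<noteq> 0}. \<mu> Y / h1_norm S Y)"

section \<open>The coupled problem\<close>

definition a_fluid ::
    "real \<Rightarrow> real \<Rightarrow> (real^'d) set \<Rightarrow> (real^'d \<Rightarrow> real^'d) \<Rightarrow> (real^'d \<Rightarrow> real^'d) \<Rightarrow> real" where
  "a_fluid \<alpha> \<nu> \<Omega> u v =
     \<alpha> * l2_inner \<Omega> u v + \<nu> * l2_inner \<Omega> (weak_grad_sym \<Omega> u) (weak_grad_sym \<Omega> v)"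

text \<open>Here the gradient with respect to the reference variable is the full one.\<close>

definition a_solid ::
    "real \<Rightarrow> real \<Rightarrow> (real^'d) set \<Rightarrow> (real^'d \<Rightarrow> real^'d) \<Rightarrow> (real^'d \<Rightarrow> real^'d) \<Rightarrow> real" where
  "a_solid \<beta> \<gamma> B X Y = \<beta> * l2_inner B X Y + \<gamma> * l2_inner B (weak_grad B X) (weak_grad B Y)"

text \<open>
  The multiplier space \<open>\<Lambda>\<close>, its norm \<open>N\<close> and the bilinear form \<open>c\<close> are parameters,
  to be instantiated by \<open>H1_dual B\<close> with \<open>c_dual\<close> or by \<open>H1 B\<close> with \<open>h1_inner B\<close>.
\<close>

definition c_dual :: "((real^'d \<Rightarrow> real^'d) \<Rightarrow> real) \<Rightarrow> (real^'d \<Rightarrow> real^'d) \<Rightarrow> real" where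
  "c_dual \<mu> Y = \<mu> Y"

type_synonym ('d, 'l) triple = "(real^'d \<Rightarrow> real^'d) \<times> (real^'d \<Rightarrow> real^'d) \<times> 'l"

definition V_space :: "(real^'d) set \<Rightarrow> (real^'d) set \<Rightarrow> 'l set \<Rightarrow> ('d::finite, 'l) triple set" where
  "V_space \<Omega> B \<Lambda> = H10 \<Omega> \<times> H1 B \<times> \<Lambda>"

definition V_norm ::
    "(real^'d) set \<Rightarrow> (real^'d) set \<Rightarrow> ('l \<Rightarrow> real) \<Rightarrow> ('d::finite, 'l) triple \<Rightarrow> real" where
  "V_norm \<Omega> B N = (\<lambda>(v, Y, \<mu>). sqrt ((h1_norm \<Omega> v)\<^sup>2 + (h1_norm B Y)\<^sup>2 + (N \<mu>)\<^sup>2))"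

definition A_form ::
    "real \<Rightarrow> real \<Rightarrow> real \<Rightarrow> real \<Rightarrow> (real^'d) set \<Rightarrow> (real^'d) set \<Rightarrow> (real^'d \<Rightarrow> real^'d) \<Rightarrow>
     ('l \<Rightarrow> (real^'d \<Rightarrow> real^'d) \<Rightarrow> real) \<Rightarrow> ('d::finite, 'l) triple \<Rightarrow> ('d, 'l) triple \<Rightarrow> real" where
  "A_form \<alpha> \<nu> \<beta> \<gamma> \<Omega> B Xbar c = (\<lambda>(u, X, l) (v, Y, \<mu>).
     a_fluid \<alpha> \<nu> \<Omega> u v + a_solid \<beta> \<gamma> B X Y
     + c l (\<lambda>s. v (Xbar s) - Y s) - c \<mu> (\<lambda>s. u (Xbar s) - X s))"

definition K_space :: "(real^'d) set \<Rightarrow> (real^'d) set \<Rightarrow> 'l set \<Rightarrow> ('d::finite, 'l) triple set" where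
  "K_space \<Omega> B \<Lambda> = {(v, Y, \<mu>) \<in> V_space \<Omega> B \<Lambda>.
     \<forall>q \<in> L2_zero_mean \<Omega>. l2_inner \<Omega> (weak_div \<Omega> v) q = 0}"

text \<open>Taken in the extended reals so that infimum and supremum are unconditionally meaningful.\<close>

definition inf_sup :: "'v set \<Rightarrow> ('v \<Rightarrow> real) \<Rightarrow> ('v \<Rightarrow> 'v \<Rightarrow> real) \<Rightarrow> ereal" where
  "inf_sup K N a =
     (INF U \<in> {U \<in> K. N U \<noteq> 0}. SUP V \<in> {V \<in> K. N V \<noteq> 0}. ereal (a U V / (N U * N V)))"

end

theory Submission
  imports Defs
begin

text \<open>
  For \<open>U = (u, X, \<lambda>)\<close> and \<open>w = u \<circ> Xbar\<close> the form is tested with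
  \<open>V = (u, X - \<delta> Y, \<lambda> - \<eta> \<mu>)\<close>, where \<open>Y\<close> almost realises the norm of \<open>\<lambda>\<close> and
  \<open>c(\<mu>, w - X) = \<parallel>w - X\<parallel>\<^sup>2\<close>. Then \<open>\<bbbA>(U, V)\<close> equals
  \<open>a\<^sub>f(u, u) + a\<^sub>s(X, X) - \<delta> a\<^sub>s(X, Y) + \<delta> c(\<lambda>, Y) + \<eta> \<parallel>w - X\<parallel>\<^sup>2\<close>. Korn's inequality
  bounds the first term below by the \<open>H1\<close> norm of \<open>u\<close>; the last one controls \<open>X\<close> because
  \<open>\<parallel>w\<parallel> \<le> C \<parallel>u\<parallel>\<close>; the fourth one controls \<open>\<lambda>\<close>; for small \<open>\<delta>\<close> the third one is absorbed.

  The bound for \<open>w\<close> needs the chain rule for \<open>\<phi> \<circ> Xbar\<close> with a test function \<open>\<phi>\<close>. It is obtained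
  without mollifying \<open>Xbar\<close>: the fundamental lemma gives
  \<open>\<bar>Xbar (x + h e) - Xbar x\<bar> \<le> M \<bar>h\<bar>\<close> almost everywhere, difference quotients converge weakly to
  the weak derivative by density of test functions, and \<open>\<phi>\<close> is expanded to second order. The
  passage from test functions to \<open>u\<close> uses that preimages under \<open>Xbar\<close> increase measure at most
  by the factor \<open>(2 L) ^ d\<close>, by a Vitali covering.
\<close>

section \<open>Smooth functions and test functions\<close>

text \<open>The fluid component of the test element is \<open>u\<close> itself, so the divergence
  constraint passes from \<open>U\<close> to \<open>V\<close>, and every correction is made in the
  two unconstrained components. The correction by \<open>\<mu>\<close> is forced by \<beta> \<ge> 0:
  for \<beta> = 0 the solid form sees gradients only, and the L2 part of \<open>X\<close> has to be
  recovered from \<open>w - X\<close> and the bound for \<open>w\<close>. This orders the constants: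
  \<eta> is small against Korn's constant and the norm of composition with \<open>Xbar\<close>, and
  \<delta> is small against \<eta>, because \<open>a_solid\<close> of \<open>X\<close> and
  \<open>Y\<close> is absorbed by what \<eta> yields for \<open>X\<close>. Smallness of \<eta>
  \<delta> also keeps the norm of \<open>V\<close> away from 0.

  The analytic obstacle is the composition. \<open>Xbar\<close> is an arbitrary representative of
  its class and may be discontinuous at points of a null set, so its regularity can be used only
  almost everywhere or under an integral. Zero boundary values help twice: density of test functions
  gives Korn's inequality with constant 2 on every open set, and it reduces the chain rule to smooth
  outer functions.\<close>

lemma frechet_derivative_eqI:
  "(f has_derivative f') (at x) \<Longrightarrow> frechet_derivative f (at x) i = f' i"
  using frechet_derivative_at by metis

lemma has_derivative_frechet:
  "f differentiable (at x) \<Longrightarrow> (f has_derivative frechet_derivative f (at x)) (at x)"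
  using frechet_derivative_works by blast

lemma cont_diff_SucD: "continuously_differentiable (Suc k) f \<Longrightarrow> continuously_differentiable k f"
proof (induction k arbitrary: f)
  case 0
  then show ?case
    by (auto intro!: continuous_at_imp_continuous_on differentiable_imp_continuous_within)
qed auto

lemma cont_diff_const [simp]: "continuously_differentiable k (\<lambda>x. c)"
  by (induction k arbitrary: c) (auto simp: frechet_derivative_const)

lemma cont_diff_add:
  "continuously_differentiable k f \<Longrightarrow> continuously_differentiable k g \<Longrightarrow>
   continuously_differentiable k (\<lambda>x. f x + g x)"
proof (induction k arbitrary: f g)
  case 0
  then show ?case by (auto intro: continuous_intros)
next
  case (Suc k)
  have "frechet_derivative (\<lambda>x. f x + g x) (at x) =
      (\<lambda>i. frechet_derivative f (at x) i + frechet_derivative g (at x) i)" for x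
    using Suc.prems by (intro ext frechet_derivative_eqI has_derivative_add)
      (auto intro: has_derivative_frechet)
  then show ?case using Suc by auto
qed

lemma cont_diff_bounded_linear:
  assumes "bounded_linear l" "continuously_differentiable k f"
  shows "continuously_differentiable k (\<lambda>x. l (f x))"
  using assms(2)
proof (induction k arbitrary: f)
  case 0
  then show ?case using assms(1) by (auto intro: bounded_linear.continuous_on)
next
  case (Suc k)
  have "((\<lambda>x. l (f x)) has_derivative (\<lambda>i. l (frechet_derivative f (at x) i))) (at x)" for x
    using Suc.prems assms(1)
    by (intro bounded_linear.has_derivative[OF assms(1)] has_derivative_frechet) auto
  note D = this
  have "frechet_derivative (\<lambda>x. l (f x)) (at x) i = l (frechet_derivative f (at x) i)" for x i
    by (rule frechet_derivative_eqI[OF D])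
  moreover have "(\<lambda>x. l (f x)) differentiable (at x)" for x
    using D differentiable_def by blast
  ultimately show ?case using Suc by simp
qed

lemma cont_diff_bounded_linear_id:
  assumes "bounded_linear l"
  shows "continuously_differentiable k l"
proof (cases k)
  case 0
  then show ?thesis using assms linear_continuous_on by auto
next
  case (Suc j)
  have "frechet_derivative l (at x) = l" for x
    by (intro frechet_derivative_at[symmetric] bounded_linear_imp_has_derivative assms)
  then show ?thesis
    using assms Suc by (auto simp: bounded_linear_imp_differentiable)
qed

lemma cont_diff_scaleR:
  fixes f :: "'a::euclidean_space \<Rightarrow> real"
  shows "continuously_differentiable k f \<Longrightarrow> continuously_differentiable k g \<Longrightarrow>
   continuously_differentiable k (\<lambda>x. f x *\<^sub>R g x)"
proof (induction k arbitrary: f g)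
  case 0
  then show ?case by (auto intro: continuous_intros)
next
  case (Suc k)
  have "((\<lambda>x. f x *\<^sub>R g x) has_derivative
      (\<lambda>i. f x *\<^sub>R frechet_derivative g (at x) i + frechet_derivative f (at x) i *\<^sub>R g x)) (at x)" for x
    using Suc.prems by (intro has_derivative_scaleR)
      (auto intro: has_derivative_frechet)
  note D = this
  have "frechet_derivative (\<lambda>x. f x *\<^sub>R g x) (at x) i =
      f x *\<^sub>R frechet_derivative g (at x) i + frechet_derivative f (at x) i *\<^sub>R g x" for x i
    by (rule frechet_derivative_eqI[OF D])
  moreover have "(\<lambda>x. f x *\<^sub>R g x) differentiable (at x)" for x
    using D differentiable_def by blast
  ultimately show ?case using Suc cont_diff_SucD[OF Suc.prems(1)] cont_diff_SucD[OF Suc.prems(2)]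
    by (simp add: cont_diff_add)
qed

lemma cont_diff_mult:
  fixes f g :: "'a::euclidean_space \<Rightarrow> real"
  shows "continuously_differentiable k f \<Longrightarrow> continuously_differentiable k g \<Longrightarrow>
   continuously_differentiable k (\<lambda>x. f x * g x)"
  using cont_diff_scaleR[of k f g] by simp

lemma cont_diff_sum:
  "(\<And>i. i \<in> I \<Longrightarrow> continuously_differentiable k (f i)) \<Longrightarrow>
   continuously_differentiable k (\<lambda>x. \<Sum>i\<in>I. f i x)"
  by (induction I rule: infinite_finite_induct) (auto intro: cont_diff_add)

lemma cont_diff_compose:
  fixes f :: "'a::euclidean_space \<Rightarrow> real" and g :: "real \<Rightarrow> real"
  shows "continuously_differentiable k f \<Longrightarrow> continuously_differentiable k g \<Longrightarrow>
   continuously_differentiable k (\<lambda>x. g (f x))"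
proof (induction k arbitrary: f g)
  case 0
  then show ?case by (auto intro: continuous_on_compose2)
next
  case (Suc k)
  \<comment> \<open>A linear map on the reals is multiplication by its value at 1. This writes the
    derivative of the composite as a product, to which \<open>cont_diff_mult\<close> and the
    induction hypothesis apply.\<close>
  have g1: "frechet_derivative g (at y) t = t * frechet_derivative g (at y) 1" for y t
    using linear_scale[OF linear_frechet_derivative, of g "at y" t 1] Suc.prems by auto
  have D: "((\<lambda>x. g (f x)) has_derivative
      (\<lambda>i. frechet_derivative g (at (f x)) (frechet_derivative f (at x) i))) (at x)" for x
  proof -
    have "(f has_derivative frechet_derivative f (at x)) (at x)"
      using Suc.prems(1) by (simp add: has_derivative_frechet)
    moreover have "(g has_derivative frechet_derivative g (at (f x))) (at (f x))"
      using Suc.prems(2) by (simp add: has_derivative_frechet)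
    ultimately show ?thesis by (rule has_derivative_compose)
  qed
  have "frechet_derivative (\<lambda>x. g (f x)) (at x) i =
      frechet_derivative f (at x) i * frechet_derivative g (at (f x)) 1" for x i
    by (rule trans[OF frechet_derivative_eqI[OF D] g1])
  moreover have "(\<lambda>x. g (f x)) differentiable (at x)" for x
    using D differentiable_def by blast
  moreover have "continuously_differentiable k (\<lambda>x. frechet_derivative g (at (f x)) 1)"
    using Suc.IH[OF cont_diff_SucD[OF Suc.prems(1)], of "\<lambda>y. frechet_derivative g (at y) 1"] Suc.prems(2)
    by simp
  ultimately show ?case using Suc.prems(1) by (simp add: cont_diff_mult)
qed

lemma cont_diff_diff:
  "continuously_differentiable k f \<Longrightarrow> continuously_differentiable k g \<Longrightarrow>
   continuously_differentiable k (\<lambda>x. f x - g x)"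
  using cont_diff_add[of k f "\<lambda>x. - g x"] cont_diff_bounded_linear[OF bounded_linear_minus[OF bounded_linear_ident], of k g]
  by simp

section \<open>Bump functions and smooth approximation of indicators\<close>

lemma cont_diff_exp: "continuously_differentiable k (exp :: real \<Rightarrow> real)"
proof (induction k)
  case 0
  show ?case by (auto intro: continuous_intros)
next
  case (Suc k)
  have D: "(exp has_derivative (\<lambda>h. h * exp x)) (at x)" for x :: real
    by (auto intro!: derivative_eq_intros)
  have "frechet_derivative exp (at x) = (\<lambda>h. h * exp x)" for x :: real
    using frechet_derivative_eqI[OF D[of x]] by auto
  then show ?case using Suc D by (auto simp: differentiable_def)
qed

text \<open>The family is closed under differentiation up to linear combinations; \<open>n = 0\<close> is the
  standard smooth function vanishing exactly on the nonpositive reals.\<close>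

definition flat :: "nat \<Rightarrow> real \<Rightarrow> real" where
  "flat n t = (if t > 0 then inverse t ^ n * exp (- inverse t) else 0)"

lemma flat_pos: "t > 0 \<Longrightarrow> flat n t > 0" and flat_nonneg: "flat n t \<ge> 0"
  and flat_eq_0: "t \<le> 0 \<Longrightarrow> flat n t = 0"
  by (auto simp: flat_def)

text \<open>Away from 0 this is the product and chain rule. At 0 the quotient from the right is
  \<open>s ^ (n + 1) / exp s\<close> with \<open>s = inverse h\<close>, where the exponential beats
  the power; from the left it is 0.\<close>

lemma flat_deriv: "(flat n has_real_derivative flat (n + 2) t - n * flat (n + 1) t) (at t)"
proof (cases "t = 0")
  case False
  show ?thesis
  proof (cases "t > 0")
    case True
    have "((\<lambda>s. s ^ n * exp (- s)) has_real_derivative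
        real n * s ^ (n - 1) * exp (- s) - s ^ n * exp (- s)) (at s)" for s :: real
      by (auto intro!: derivative_eq_intros)
    from DERIV_chain2[OF this DERIV_inverse, of t]
    have "((\<lambda>t. inverse t ^ n * exp (- inverse t)) has_real_derivative
        (real n * inverse t ^ (n - 1) * exp (- inverse t) - inverse t ^ n * exp (- inverse t))
          * - (inverse t ^ Suc (Suc 0))) (at t)" using True by simp
    \<comment> \<open>For \<open>n = 0\<close> the exponent \<open>n - 1\<close> is truncated to 0,
      which is harmless because of the factor \<open>real n\<close>.\<close>
    moreover have "(real n * inverse t ^ (n - 1) * exp (- inverse t) - inverse t ^ n * exp (- inverse t))
          * - (inverse t ^ Suc (Suc 0)) = flat (n + 2) t - n * flat (n + 1) t"
      using True by (cases n) (auto simp: flat_def algebra_simps)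
    ultimately have "((\<lambda>t. inverse t ^ n * exp (- inverse t)) has_real_derivative
       flat (n + 2) t - n * flat (n + 1) t) (at t)" by simp
    then show ?thesis
      by (rule has_field_derivative_transform_within_open[of _ _ _ "{0<..}"])
        (use True in \<open>auto simp: flat_def\<close>)
  next
    case f: False
    have "((\<lambda>t. 0) has_real_derivative 0) (at t)" by auto
    then have "(flat n has_real_derivative 0) (at t)"
      by (rule has_field_derivative_transform_within_open[of _ _ _ "{..<0}"])
        (use f False in \<open>auto simp: flat_def\<close>)
    then show ?thesis using f by (simp add: flat_def)
  qed
next
  case True
  have "((\<lambda>s::real. s ^ (n + 1) / exp s) \<longlongrightarrow> 0) at_top"
    by (rule tendsto_power_div_exp_0)
  then have "((\<lambda>h. inverse h ^ (n + 1) / exp (inverse h)) \<longlongrightarrow> (0::real)) (at_right 0)"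
    by (rule filterlim_compose) (rule filterlim_inverse_at_top_right)
  moreover have "eventually (\<lambda>h::real. inverse h ^ (n + 1) / exp (inverse h) = flat n h / h) (at_right 0)"
    by (auto simp: eventually_at_filter flat_def exp_minus field_simps)
  ultimately have R: "((\<lambda>h. flat n h / h) \<longlongrightarrow> 0) (at_right 0)"
    by (simp add: filterlim_cong)
  have L: "((\<lambda>h. flat n h / h) \<longlongrightarrow> 0) (at_left 0)"
    by (rule tendsto_eventually) (auto simp: eventually_at_filter flat_def)
  have "((\<lambda>h. flat n h / h) \<longlongrightarrow> 0) (at 0)"
    using filterlim_split_at[OF L R] .
  then show ?thesis using True by (simp add: DERIV_def flat_def)
qed

text \<open>The induction has to leave \<open>n\<close> free, because differentiation raises the
  index to \<open>n + 1\<close> and \<open>n + 2\<close>.\<close>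

lemma cont_diff_flat: "continuously_differentiable k (flat n)"
proof (induction k arbitrary: n)
  case 0
  have "isCont (flat n) t" for t by (rule DERIV_isCont[OF flat_deriv])
  then show ?case by (auto intro!: continuous_at_imp_continuous_on)
next
  case (Suc k)
  have D: "(flat n has_derivative (\<lambda>h. h * (flat (n + 2) t - n * flat (n + 1) t))) (at t)" for t
    using flat_deriv[of n t] by (simp add: has_field_derivative_def mult_commute_abs)
  have "frechet_derivative (flat n) (at t) 1 = flat (n + 2) t - real n * flat (n + 1) t" for t
    using frechet_derivative_eqI[OF D[of t]] by simp
  then show ?case using D Suc
    by (auto simp: differentiable_def intro!: cont_diff_diff cont_diff_mult)
qed

text \<open>The squared norm is a polynomial in the coordinates, hence smooth also at the centre,
  where the norm itself is not differentiable.\<close>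

lemma cont_diff_bump: "continuously_differentiable k (\<lambda>y::'a::euclidean_space. flat 0 (r\<^sup>2 - (norm (y - x))\<^sup>2))"
proof -
  have 1: "continuously_differentiable k (\<lambda>y::'a. (y - x) \<bullet> b)" for b
    using cont_diff_add[OF cont_diff_bounded_linear_id[OF bounded_linear_inner_left[of b]] cont_diff_const[of k "- (x \<bullet> b)"]]
    by (simp add: inner_diff_left)
  have "continuously_differentiable k (\<lambda>y::'a. r\<^sup>2 + (- 1) * (\<Sum>b\<in>Basis. ((y - x) \<bullet> b) * ((y - x) \<bullet> b)))"
    by (intro cont_diff_add cont_diff_mult cont_diff_sum 1 cont_diff_const)
  moreover have "(\<Sum>b\<in>Basis. ((y - x) \<bullet> b) * ((y - x) \<bullet> b)) = (norm (y - x))\<^sup>2" for y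
    unfolding power2_norm_eq_inner by (rule euclidean_inner[symmetric])
  ultimately have "continuously_differentiable k (\<lambda>y::'a. r\<^sup>2 - (norm (y - x))\<^sup>2)"
    by simp
  then show ?thesis
    by (rule cont_diff_compose[OF _ cont_diff_flat])
qed

text \<open>Stands in for mollified indicators. A finite union W of balls around points of K is
  exactly the set where a sum s of bumps is positive; a saturating function of \<open>n * s\<close>
  tends to 1 there, stays 0 elsewhere and never exceeds the indicator of W.\<close>

lemma smooth_approx_indicator:
  fixes K U :: "'a::euclidean_space set"
  assumes "compact K" "open U" "K \<subseteq> U"
  obtains W and \<psi> :: "nat \<Rightarrow> 'a \<Rightarrow> real" where "open W" "K \<subseteq> W" "W \<subseteq> U"
    "\<And>n. \<psi> n \<in> test_functions U" "\<And>n x. 0 \<le> \<psi> n x" "\<And>n x. \<psi> n x \<le> indicator W x"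
    "\<And>x. (\<lambda>n. \<psi> n x) \<longlonglongrightarrow> indicator W x"
proof -
  \<comment> \<open>Closed balls are fitted into U so that also the closures of the supports stay in
    U.\<close>
  have "\<exists>r>0. cball x r \<subseteq> U" if "x \<in> K" for x
    using that assms open_contains_cball by (metis subsetD)
  then obtain r where r: "\<And>x. x \<in> K \<Longrightarrow> r x > 0 \<and> cball x (r x) \<subseteq> U" by metis
  have "K \<subseteq> (\<Union>x\<in>K. ball x (r x))" using r by force
  then obtain F where F: "F \<subseteq> K" "finite F" "K \<subseteq> (\<Union>x\<in>F. ball x (r x))"
    using compactE_image[OF assms(1), of K "\<lambda>x. ball x (r x)"] by auto
  define s where "s y = (\<Sum>x\<in>F. flat 0 ((r x)\<^sup>2 - (norm (y - x))\<^sup>2))" for y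
  \<comment> \<open>Vanishes together with s and increases to 1 wherever s is positive.\<close>
  define \<psi> where "\<psi> n y = 1 - exp (- real n * s y)" for n y
  define W where "W = (\<Union>x\<in>F. ball x (r x))"
  have s0: "s y \<ge> 0" for y by (auto simp: s_def intro!: sum_nonneg flat_nonneg)
  have bW: "flat 0 ((r x)\<^sup>2 - (norm (y - x))\<^sup>2) > 0 \<longleftrightarrow> y \<in> ball x (r x)" if "x \<in> F" for x y
  proof -
    have "r x > 0" using r F that by auto
    then have "(r x)\<^sup>2 - (norm (y - x))\<^sup>2 > 0 \<longleftrightarrow> norm (y - x) < r x"
      using power2_less_imp_less[of "norm (y - x)" "r x"] power_strict_mono[of "norm (y - x)" "r x" 2]
      by auto
    then show ?thesis
      using flat_pos[of "(r x)\<^sup>2 - (norm (y - x))\<^sup>2" 0] flat_eq_0[of "(r x)\<^sup>2 - (norm (y - x))\<^sup>2" 0]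
      by (auto simp: dist_norm norm_minus_commute)
  qed
  have sW: "s y > 0 \<longleftrightarrow> y \<in> W" for y
  proof
    assume "s y > 0"
    then have "\<not> (\<forall>x\<in>F. flat 0 ((r x)\<^sup>2 - (norm (y - x))\<^sup>2) \<le> 0)"
      using sum_nonpos[of F "\<lambda>x. flat 0 ((r x)\<^sup>2 - (norm (y - x))\<^sup>2)"] by (auto simp: s_def)
    then obtain x where "x \<in> F" "flat 0 ((r x)\<^sup>2 - (norm (y - x))\<^sup>2) > 0"
      by (auto simp: not_le)
    then show "y \<in> W" using bW by (auto simp: W_def)
  next
    assume "y \<in> W"
    then obtain x where "x \<in> F" "y \<in> ball x (r x)" by (auto simp: W_def)
    then show "s y > 0" unfolding s_def
      using bW by (intro sum_pos2[OF F(2) \<open>x \<in> F\<close>]) (simp_all add: flat_nonneg)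
  qed
  have cls: "compact (\<Union>x\<in>F. cball x (r x))" using F by auto
  have cW: "closure W \<subseteq> (\<Union>x\<in>F. cball x (r x))" unfolding W_def
    by (rule closure_minimal) (use F ball_subset_cball in \<open>auto intro!: closed_UN\<close>)
  have supp: "{x. \<psi> n x \<noteq> 0} \<subseteq> W" for n
    using sW s0 by (auto simp: \<psi>_def) (metis less_eq_real_def)
  have CD: "continuously_differentiable k (\<psi> n)" for k n
  proof -
    have "continuously_differentiable k s"
      unfolding s_def by (intro cont_diff_sum cont_diff_bump)
    then have "continuously_differentiable k (\<lambda>y. 1 + (-1) * exp (- real n * s y))"
      by (rule cont_diff_add[OF cont_diff_const cont_diff_mult[OF cont_diff_const cont_diff_compose[OF cont_diff_mult[OF cont_diff_const] cont_diff_exp]]])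
    then show ?thesis by (simp add: \<psi>_def[abs_def])
  qed
  show thesis
  proof
    show "open W" "K \<subseteq> W" using F by (auto simp: W_def)
    show "W \<subseteq> U" using r F by (fastforce simp: W_def)
    show "0 \<le> \<psi> n x" for n x using s0[of x] by (simp add: \<psi>_def)
    show "\<psi> n x \<le> indicator W x" for n x 
    proof (cases "x \<in> W")
      case True
      then show ?thesis by (simp add: \<psi>_def)
    next
      case False
      then have "\<psi> n x = 0" using supp[of n] by blast
      then show ?thesis using False by simp
    qed
    show "\<psi> n \<in> test_functions U" for n
    proof -
      have "closure {x. \<psi> n x \<noteq> 0} \<subseteq> (\<Union>x\<in>F. cball x (r x))"
        using closure_mono[OF supp[of n]] cW by auto
      moreover have "(\<Union>x\<in>F. cball x (r x)) \<subseteq> U" using r F by auto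
      ultimately show ?thesis
        using CD compact_Int_closed[OF cls, of "closure {x. \<psi> n x \<noteq> 0}"]
        by (auto simp: test_functions_def Int_absorb1)
    qed
    show "(\<lambda>n. \<psi> n x) \<longlonglongrightarrow> indicator W x" for x
    proof (cases "x \<in> W")
      case True
      then have "s x > 0" using sW by auto
      then have "(\<lambda>n. 1 - exp (- s x) ^ n) \<longlonglongrightarrow> 1 - 0"
        by (intro tendsto_intros LIMSEQ_realpow_zero) auto
      moreover have "exp (- s x) ^ n = exp (- real n * s x)" for n
        by (metis exp_of_nat_mult mult_minus_left mult_minus_right)
      ultimately show ?thesis using True by (simp add: \<psi>_def)
    next
      case False
      then have "\<psi> n x = 0" for n using supp[of n] by auto
      then show ?thesis using False by simp
    qed
  qed
qed

section \<open>Test functions: supports, bounds and closure properties\<close>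

lemma
  assumes "\<phi> \<in> test_functions S"
  shows test_function_cont_diff: "continuously_differentiable k \<phi>"
    and test_function_compact: "compact (closure {x. \<phi> x \<noteq> 0})"
    and test_function_support: "closure {x. \<phi> x \<noteq> 0} \<subseteq> S"
proof -
  have "(\<forall>k. continuously_differentiable k \<phi>) \<and> compact (closure {x. \<phi> x \<noteq> 0})
      \<and> closure {x. \<phi> x \<noteq> 0} \<subseteq> S"
    using assms unfolding test_functions_def by (rule CollectD)
  then show "continuously_differentiable k \<phi>" "compact (closure {x. \<phi> x \<noteq> 0})"
      "closure {x. \<phi> x \<noteq> 0} \<subseteq> S" by iprover+
qed

lemma eq_0_outside_support: "x \<notin> closure {x. \<phi> x \<noteq> 0} \<Longrightarrow> \<phi> x = 0"
  using closure_subset[of "{x. \<phi> x \<noteq> 0}"] by blast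

lemma test_function_eq_0: "\<phi> \<in> test_functions S \<Longrightarrow> x \<notin> S \<Longrightarrow> \<phi> x = 0"
  using test_function_support[of \<phi> S] closure_subset[of "{x. \<phi> x \<noteq> 0}"] by blast

lemma test_function_continuous: "\<phi> \<in> test_functions S \<Longrightarrow> continuous_on UNIV \<phi>"
  using test_function_cont_diff[of \<phi> S 0] by simp

lemma test_function_borel: 
  fixes \<phi> :: "'a::euclidean_space \<Rightarrow> 'b::euclidean_space"
  shows "\<phi> \<in> test_functions S \<Longrightarrow> \<phi> \<in> borel_measurable lebesgue"
  by (intro measurable_completion) (simp add: borel_measurable_continuous_onI test_function_continuous)

lemma test_function_differentiable: "\<phi> \<in> test_functions S \<Longrightarrow> \<phi> differentiable (at x)"
  using test_function_cont_diff[of \<phi> S 1] by simp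

lemma test_function_bounded:
  assumes "\<phi> \<in> test_functions S"
  obtains C where "C > 0" "\<And>x. norm (\<phi> x) \<le> C"
proof -
  have "compact (\<phi> ` closure {x. \<phi> x \<noteq> 0})"
    using test_function_compact[OF assms] test_function_continuous[OF assms]
    by (intro compact_continuous_image) (auto intro: continuous_on_subset)
  then obtain C where C: "C > 0" "\<And>y. y \<in> \<phi> ` closure {x. \<phi> x \<noteq> 0} \<Longrightarrow> norm y \<le> C"
    using bounded_pos compact_imp_bounded by metis
  then have "norm (\<phi> x) \<le> C" for x
    using closure_subset[of "{x. \<phi> x \<noteq> 0}"] by (cases "\<phi> x = 0") auto
  then show thesis using that C by blast
qed

lemma test_functionI:
  assumes "\<And>k. continuously_differentiable k \<phi>" "compact K" "K \<subseteq> S" "\<And>x. x \<notin> K \<Longrightarrow> \<phi> x = 0"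
  shows "\<phi> \<in> test_functions S"
proof -
  have "closure {x. \<phi> x \<noteq> 0} \<subseteq> K"
    using assms by (intro closure_minimal) (auto simp: compact_imp_closed)
  then show ?thesis
    using assms compact_Int_closed[of K "closure {x. \<phi> x \<noteq> 0}"]
    by (auto simp: test_functions_def Int_absorb1)
qed

lemma test_function_partial:
  assumes "\<phi> \<in> test_functions S" "i \<in> Basis"
  shows "(\<lambda>x. frechet_derivative \<phi> (at x) i) \<in> test_functions S"
proof (rule test_functionI)
  show "continuously_differentiable k (\<lambda>x. frechet_derivative \<phi> (at x) i)" for k
    using test_function_cont_diff[OF assms(1), of "Suc k"] assms(2) by simp
  show "frechet_derivative \<phi> (at x) i = 0" if "x \<notin> closure {x. \<phi> x \<noteq> 0}" for x
  proof (rule frechet_derivative_eqI)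
    have "((\<lambda>x. 0) has_derivative (\<lambda>i. 0)) (at x)" by auto
    then show "(\<phi> has_derivative (\<lambda>i. 0)) (at x)"
      by (rule has_derivative_transform_within_open[of _ _ _ UNIV "- closure {x. \<phi> x \<noteq> 0}"])
        (use that closure_subset[of "{x. \<phi> x \<noteq> 0}"] in auto)
  qed
qed (rule test_function_compact[OF assms(1)] test_function_support[OF assms(1)])+

lemma test_function_add:
  assumes "\<phi> \<in> test_functions S" "\<psi> \<in> test_functions S"
  shows "(\<lambda>x. \<phi> x + \<psi> x) \<in> test_functions S"
proof (rule test_functionI)
  show "compact (closure {x. \<phi> x \<noteq> 0} \<union> closure {x. \<psi> x \<noteq> 0})"
    by (intro compact_Un test_function_compact[OF assms(1)] test_function_compact[OF assms(2)])
  show "\<phi> x + \<psi> x = 0" if "x \<notin> closure {x. \<phi> x \<noteq> 0} \<union> closure {x. \<psi> x \<noteq> 0}" for x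
    using that eq_0_outside_support[of x \<phi>] eq_0_outside_support[of x \<psi>] by auto
  show "continuously_differentiable k (\<lambda>x. \<phi> x + \<psi> x)" for k
    by (rule cont_diff_add[OF test_function_cont_diff[OF assms(1)] test_function_cont_diff[OF assms(2)]])
  show "closure {x. \<phi> x \<noteq> 0} \<union> closure {x. \<psi> x \<noteq> 0} \<subseteq> S"
    using test_function_support[OF assms(1)] test_function_support[OF assms(2)] by blast
qed

lemma test_function_linear_image:
  assumes "bounded_linear l" "\<phi> \<in> test_functions S"
  shows "(\<lambda>x. l (\<phi> x)) \<in> test_functions S"
proof (rule test_functionI)
  show "l (\<phi> x) = 0" if "x \<notin> closure {x. \<phi> x \<noteq> 0}" for x
    using that closure_subset[of "{x. \<phi> x \<noteq> 0}"] linear_0[OF bounded_linear.linear[OF assms(1)]]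
    by (cases "\<phi> x = 0") auto
qed (rule cont_diff_bounded_linear[OF assms(1)] test_function_cont_diff[OF assms(2)]
    test_function_compact[OF assms(2)] test_function_support[OF assms(2)])+

lemma test_function_cmult:
  "\<psi> \<in> test_functions S \<Longrightarrow> (\<lambda>x. c * \<psi> x :: real) \<in> test_functions S"
  using test_function_linear_image[OF bounded_linear_mult_right] .

lemma cont_diff_translate:
  "continuously_differentiable k f \<Longrightarrow> continuously_differentiable k (\<lambda>x. f (x + a))"
proof (induction k arbitrary: f)
  case 0
  then show ?case by (auto intro!: continuous_intros intro: continuous_on_compose2)
next
  case (Suc k)
  have D: "((\<lambda>x. f (x + a)) has_derivative frechet_derivative f (at (x + a))) (at x)" for x
  proof -
    have "((\<lambda>x. x + a) has_derivative (\<lambda>h. h)) (at x)" by (auto intro!: derivative_eq_intros)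
    moreover have "(f has_derivative frechet_derivative f (at (x + a))) (at (x + a))"
      using Suc.prems by (simp add: has_derivative_frechet)
    ultimately show ?thesis by (rule has_derivative_compose)
  qed
  have "frechet_derivative (\<lambda>x. f (x + a)) (at x) i = frechet_derivative f (at (x + a)) i" for x i
    by (rule frechet_derivative_eqI[OF D])
  moreover have "(\<lambda>x. f (x + a)) differentiable (at x)" for x
    using D differentiable_def by blast
  moreover have "continuously_differentiable k (\<lambda>x. frechet_derivative f (at (x + a)) i)"
    if "i \<in> Basis" for i
    using Suc.IH[of "\<lambda>x. frechet_derivative f (at x) i"] Suc.prems that by simp
  ultimately show ?case by simp
qed

lemma test_function_Lipschitz:
  fixes \<phi> :: "'a::euclidean_space \<Rightarrow> 'b::euclidean_space"
  assumes "\<phi> \<in> test_functions S"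
  obtains C where "C > 0" "\<And>x y. norm (\<phi> x - \<phi> y) \<le> C * norm (x - y)"
proof -
  have "\<exists>C. \<forall>x. norm (frechet_derivative \<phi> (at x) i) \<le> C" if "i \<in> Basis" for i
    using test_function_bounded[OF test_function_partial[OF assms that]] by metis
  then obtain C where C: "\<And>i x. i \<in> Basis \<Longrightarrow> norm (frechet_derivative \<phi> (at x) i) \<le> C i"
    by metis
  \<comment> \<open>The summand 1 keeps D positive even if all the bounds \<open>C i\<close> are
    0.\<close>
  define D where "D = (\<Sum>i\<in>Basis. C i) + 1"
  have C0: "C i \<ge> 0" if "i \<in> Basis" for i using C[OF that] norm_ge_zero order_trans by blast
  then have D: "D > 0" unfolding D_def by (smt (verit) sum_nonneg)
  have on: "onorm (frechet_derivative \<phi> (at x)) \<le> D" for x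
  proof (rule onorm_bound)
    fix h :: 'a
    have lin: "linear (frechet_derivative \<phi> (at x))"
      using assms test_function_differentiable linear_frechet_derivative by blast
    have "norm (frechet_derivative \<phi> (at x) h) = norm (\<Sum>i\<in>Basis. (h \<bullet> i) *\<^sub>R frechet_derivative \<phi> (at x) i)"
      by (subst euclidean_representation[of h, symmetric])
        (simp only: linear_sum[OF lin] linear_scale[OF lin])
    also have "\<dots> \<le> (\<Sum>i\<in>Basis. norm h * C i)"
      by (rule order_trans[OF norm_sum sum_mono]) (auto intro!: mult_mono C Basis_le_norm)
    also have "\<dots> \<le> D * norm h"
      by (simp add: D_def flip: sum_distrib_left) (simp add: algebra_simps)
    finally show "norm (frechet_derivative \<phi> (at x) h) \<le> D * norm h" .
  qed (use D in simp)
  have "norm (\<phi> x - \<phi> y) \<le> D * norm (x - y)" for x y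
    by (rule differentiable_bound[of UNIV \<phi> "\<lambda>x. frechet_derivative \<phi> (at x)"])
      (use assms test_function_differentiable on in \<open>auto intro: has_derivative_frechet\<close>)
  then show thesis using that D by blast
qed

text \<open>The integrability clause of \<open>has_weak_gradient\<close>, isolated so that it can be
  used for single components and matrix entries.\<close>

definition locally_integrable_on :: "('a::euclidean_space \<Rightarrow> 'b::euclidean_space) \<Rightarrow> 'a set \<Rightarrow> bool"
  (infix \<open>locally'_integrable'_on\<close> 50) where
  "f locally_integrable_on S \<longleftrightarrow> (\<forall>K. compact K \<and> K \<subseteq> S \<longrightarrow> f absolutely_integrable_on K)"

lemma open_sets_lebesgue: "open S \<Longrightarrow> S \<in> sets lebesgue" by auto

text \<open>The definitions integrate over S, whereas translation invariance holds on the whole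
  space; integrands supported in S can be moved between the two.\<close>

lemma lebesgue_on_supported:
  fixes f :: "'a::euclidean_space \<Rightarrow> 'b::euclidean_space"
  assumes "S \<in> sets lebesgue" "\<And>x. x \<notin> S \<Longrightarrow> f x = 0"
  shows "integral\<^sup>L (lebesgue_on S) f = integral\<^sup>L lebesgue f"
    "integrable (lebesgue_on S) f \<longleftrightarrow> integrable lebesgue f"
proof -
  have "(\<lambda>x. if x \<in> S then f x else 0) = f" using assms by auto
  then show "integral\<^sup>L (lebesgue_on S) f = integral\<^sup>L lebesgue f"
    "integrable (lebesgue_on S) f \<longleftrightarrow> integrable lebesgue f"
    using Lebesgue_Measure.integral_restrict_UNIV[OF assms(1), of f] Lebesgue_Measure.integrable_restrict_UNIV[OF assms(1), of f] by auto
qed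

lemma integrable_mult_test:
  fixes f :: "'a::euclidean_space \<Rightarrow> real"
  assumes "integrable lebesgue f" "\<psi> \<in> test_functions S"
  shows "integrable lebesgue (\<lambda>x. f x * \<psi> x)"
proof -
  obtain C where C: "\<And>x. norm (\<psi> x) \<le> C" using test_function_bounded[OF assms(2)] by blast
  show ?thesis
  proof (rule Bochner_Integration.integrable_bound[OF integrable_mult_right[OF assms(1), of C]])
    show "(\<lambda>x. f x * \<psi> x) \<in> borel_measurable lebesgue"
      by (intro borel_measurable_times borel_measurable_integrable[OF assms(1)] test_function_borel[OF assms(2)])
    have "norm (f x * \<psi> x) \<le> norm (C * f x)" for x
      unfolding norm_mult by (subst mult.commute) (rule mult_mono, use C[of x] in auto)
    then show "AE x in lebesgue. norm (f x * \<psi> x) \<le> norm (C * f x)"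
      by simp
  qed
qed

lemma locally_integrable_mult_test:
  fixes f :: "'a::euclidean_space \<Rightarrow> real"
  assumes "f locally_integrable_on S" "\<psi> \<in> test_functions S"
  shows "integrable lebesgue (\<lambda>x. f x * \<psi> x)"
proof -
  define K where "K = closure {x. \<psi> x \<noteq> 0}"
  have K: "compact K" "K \<subseteq> S" using assms by (auto simp: K_def test_functions_def)
  have "integrable lebesgue (\<lambda>x. (indicator K x *\<^sub>R f x) * \<psi> x)"
    using assms(1) K
    by (intro integrable_mult_test[OF _ assms(2)]) (auto simp: locally_integrable_on_def set_integrable_def)
  moreover have "(indicator K x *\<^sub>R f x) * \<psi> x = f x * \<psi> x" for x
    using eq_0_outside_support[of x \<psi>] by (auto simp: K_def indicator_def)
  ultimately show ?thesis by (simp only:)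
qed

section \<open>The fundamental lemma of the calculus of variations\<close>

lemma lebesgue_distr_translation:
  "distr lebesgue lebesgue (\<lambda>x::'a::euclidean_space. x + a) = lebesgue"
  and translation_measurable: "(\<lambda>x::'a. x + a) \<in> lebesgue \<rightarrow>\<^sub>M lebesgue"
proof -
  \<comment> \<open>A translation is the affine change of variables in which all scale factors are
    1.\<close>
  have eq: "(\<lambda>x::'a. a + (\<Sum>j\<in>Basis. (1 * (x \<bullet> j)) *\<^sub>R j)) = (\<lambda>x. x + a)"
    by (simp add: euclidean_representation add.commute)
  show "(\<lambda>x::'a. x + a) \<in> lebesgue \<rightarrow>\<^sub>M lebesgue"
    using lebesgue_affine_measurable[of "\<lambda>_. 1" a] unfolding eq by simp
  have "lebesgue = density (distr lebesgue lebesgue (\<lambda>x::'a. x + a)) (\<lambda>_. 1)"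
    using lebesgue_affine_euclidean[of "\<lambda>_. 1" a] unfolding eq by simp
  then show "distr lebesgue lebesgue (\<lambda>x::'a. x + a) = lebesgue"
    by (simp add: density_1)
qed

lemma
  fixes f :: "'a::euclidean_space \<Rightarrow> 'b::euclidean_space"
  assumes "integrable lebesgue f"
  shows integral_lebesgue_translation: "(LINT x|lebesgue. f (x + a)) = integral\<^sup>L lebesgue f"
    and integrable_lebesgue_translation: "integrable lebesgue (\<lambda>x. f (x + a))"
proof -
  have m: "f \<in> borel_measurable lebesgue" using assms by auto
  have "integral\<^sup>L (distr lebesgue lebesgue (\<lambda>x. x + a)) f = (LINT x|lebesgue. f (x + a))"
    by (rule integral_distr[OF translation_measurable m])
  then show "(LINT x|lebesgue. f (x + a)) = integral\<^sup>L lebesgue f"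
    by (simp add: lebesgue_distr_translation)
  show "integrable lebesgue (\<lambda>x. f (x + a))"
    using integrable_distr_eq[OF translation_measurable m, of a] assms
    by (simp add: lebesgue_distr_translation)
qed

text \<open>Dominated convergence for an f that may be integrable only locally: g is typically its
  cut-off to a compact set containing all the supports, so the two agree wherever
  \<open>\<psi> n\<close> does not vanish.\<close>

lemma tendsto_integral_indicator_mult:
  fixes f g :: "'a::euclidean_space \<Rightarrow> real"
  assumes "integrable lebesgue g" "\<And>n. \<psi> n \<in> borel_measurable lebesgue"
    "\<And>n x. \<bar>f x * \<psi> n x\<bar> \<le> \<bar>g x\<bar>" "\<And>n x. f x * \<psi> n x = g x * \<psi> n x"
    "\<And>x. (\<lambda>n. \<psi> n x) \<longlonglongrightarrow> h x" 
  shows "(\<lambda>n. LINT x|lebesgue. f x * \<psi> n x) \<longlonglongrightarrow> (LINT x|lebesgue. g x * h x)"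
proof -
  have "(\<lambda>n. LINT x|lebesgue. g x * \<psi> n x) \<longlonglongrightarrow> (LINT x|lebesgue. g x * h x)"
  proof (rule integral_dominated_convergence[where w = "\<lambda>x. \<bar>g x\<bar>"])
    show "(\<lambda>x. g x * h x) \<in> borel_measurable lebesgue"
      by (intro borel_measurable_times borel_measurable_integrable[OF assms(1)]
          borel_measurable_LIMSEQ_real[OF assms(5,2)])
    show "(\<lambda>x. g x * \<psi> n x) \<in> borel_measurable lebesgue" for n
      by (intro borel_measurable_times borel_measurable_integrable[OF assms(1)] assms(2))
    show "AE x in lebesgue. norm (g x * \<psi> n x) \<le> \<bar>g x\<bar>" for n
      using assms(3,4) by auto
  qed (use assms in \<open>auto intro!: tendsto_intros\<close>)
  then show ?thesis unfolding assms(4) .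
qed

text \<open>Two successive limits: test functions tend to the indicator of an open set between K and
  \<open>U m\<close>, and then \<open>U m\<close> shrinks to K. All supports stay in one compact
  neighbourhood C of K, where f is integrable.\<close>

lemma locally_integrable_compact_nonpos:
  fixes f :: "'a::euclidean_space \<Rightarrow> real"
  assumes "open S" "f locally_integrable_on S" "compact K" "K \<subseteq> S"
    and test: "\<And>\<psi>. \<psi> \<in> test_functions S \<Longrightarrow> (\<And>x. 0 \<le> \<psi> x) \<Longrightarrow> (LINT x|lebesgue. f x * \<psi> x) \<le> 0"
  shows "(LINT x|lebesgue. f x * indicator K x) \<le> 0"
proof (cases "K = {}")
  \<comment> \<open>The distance to the empty set is 0 by convention, so the sets \<open>U m\<close>
    below are neighbourhoods shrinking to K only if K is nonempty.\<close>
  case False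
  obtain d where d: "d > 0" "(\<Union>x\<in>K. cball x d) \<subseteq> S"
    using compact_subset_open_imp_cball_epsilon_subset[OF assms(3,1,4)] by blast
  define C where "C = (\<Union>x\<in>K. cball x d)"
  define g where "g x = indicator C x * f x" for x
  have "C = {x + y |x y. x \<in> K \<and> y \<in> cball 0 d}"
    by (auto simp: C_def dist_norm) (metis add_diff_cancel_left' diff_add_cancel norm_minus_commute add.commute)
  then have "compact C"
    using compact_sums[OF assms(3) compact_cball[of 0 d]] by simp
  then have g: "integrable lebesgue g"
    using assms(2) d by (auto simp: locally_integrable_on_def set_integrable_def g_def[abs_def] C_def)
  have KC: "K \<subseteq> C" unfolding C_def using d(1) by force
  define U where "U m = {x. infdist x K < d / (real m + 1)}" for m :: nat
  have U: "open (U m)" for m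
    unfolding U_def by (intro open_Collect_less continuous_intros)
  have KU: "K \<subseteq> U m" for m using d by (auto simp: U_def)
  have UC: "U m \<subseteq> C" for m
  proof
    fix x assume x: "x \<in> U m"
    obtain y where y: "y \<in> K" "infdist x K = dist x y"
      using infdist_attains_inf[of K x] assms(3) False by (auto simp: compact_imp_closed)
    have "d / (real m + 1) \<le> d" using d by (simp add: field_simps)
    then show "x \<in> C" using x y by (auto simp: U_def C_def dist_commute intro!: bexI[of _ y])
  qed
  have *: "\<exists>W. open W \<and> K \<subseteq> W \<and> W \<subseteq> U m \<and> (LINT x|lebesgue. g x * indicator W x) \<le> 0" for m
  proof -
    obtain W and \<psi> :: "nat \<Rightarrow> 'a \<Rightarrow> real" where W: "open W" "K \<subseteq> W" "W \<subseteq> U m"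
      and \<psi>: "\<And>n. \<psi> n \<in> test_functions (U m)" "\<And>n x. 0 \<le> \<psi> n x" "\<And>n x. \<psi> n x \<le> indicator W x"
      "\<And>x. (\<lambda>n. \<psi> n x) \<longlonglongrightarrow> indicator W x"
      using smooth_approx_indicator[OF assms(3) U KU] by metis
    have S: "\<psi> n \<in> test_functions S" for n
      using \<psi>(1)[of n] UC d unfolding test_functions_def C_def by blast
    have z: "\<psi> n x = 0" if "x \<notin> C" for n x
      using test_function_eq_0[OF \<psi>(1)] UC that by blast
    have "(\<lambda>n. LINT x|lebesgue. f x * \<psi> n x) \<longlonglongrightarrow> (LINT x|lebesgue. g x * indicator W x)"
    proof (rule tendsto_integral_indicator_mult[OF g test_function_borel[OF S] _ _ \<psi>(4)])
      show "\<bar>f x * \<psi> n x\<bar> \<le> \<bar>g x\<bar>" for n x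
      proof (cases "x \<in> C")
        case True
        have "\<psi> n x \<le> 1" using \<psi>(3)[of n x] by (cases "x \<in> W") auto
        then show ?thesis using True \<psi>(2)[of n x] by (simp add: g_def abs_mult mult_left_le)
      qed (use z in simp)
      show "f x * \<psi> n x = g x * \<psi> n x" for n x using z by (cases "x \<in> C") (auto simp: g_def)
    qed
    then have "(LINT x|lebesgue. g x * indicator W x) \<le> 0"
      by (rule LIMSEQ_le_const2) (use test[OF S \<psi>(2)] in auto)
    then show ?thesis using W by blast
  qed
  then obtain W where W: "\<And>m. open (W m)" "\<And>m. K \<subseteq> W m" "\<And>m. W m \<subseteq> U m"
    "\<And>m. (LINT x|lebesgue. g x * indicator (W m) x) \<le> 0" by metis
  have "(\<lambda>m. LINT x|lebesgue. g x * indicator (W m) x) \<longlonglongrightarrow> (LINT x|lebesgue. g x * indicator K x)"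
  proof (rule tendsto_integral_indicator_mult[OF g])
    show "(\<lambda>n. indicator (W n) x) \<longlonglongrightarrow> (indicator K x :: real)" for x
    proof (cases "x \<in> K")
      case True
      then have "x \<in> W m" for m using W(2) by blast
      then show ?thesis using True by simp
    next
      case False
      then have "infdist x K > 0"
        using infdist_pos_not_in_closed[of K x] assms(3) \<open>K \<noteq> {}\<close> by (auto simp: compact_imp_closed)
      moreover have "(\<lambda>m. d / (real m + 1)) \<longlonglongrightarrow> 0"
        using tendsto_mult_left[OF LIMSEQ_inverse_real_of_nat, of d] by (simp add: divide_inverse add.commute)
      ultimately have "\<forall>\<^sub>F m in sequentially. d / (real m + 1) < infdist x K"
        by (rule order_tendstoD(2)[rotated])
      then have "\<forall>\<^sub>F m in sequentially. indicator (W m) x = (0::real)"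
        by eventually_elim (use W(3) in \<open>force simp: U_def indicator_def\<close>)
      then show ?thesis using False by (simp add: tendsto_eventually)
    qed
    show "indicator (W n) \<in> borel_measurable lebesgue" for n
      using W(1) by (intro borel_measurable_indicator open_sets_lebesgue)
    show "\<bar>g x * indicator (W n) x\<bar> \<le> \<bar>g x\<bar>" for n x by (auto simp: indicator_def)
  qed auto
  then have "(LINT x|lebesgue. g x * indicator K x) \<le> 0"
    by (rule LIMSEQ_le_const2) (use W(4) in auto)
  moreover have "g x * indicator K x = f x * indicator K x" for x
    using KC by (cases "x \<in> K") (auto simp: g_def)
  ultimately show ?thesis by simp
qed simp

text \<open>On a compact piece \<open>C n\<close> of S the set A where f is positive is approximated
  from inside by compact sets T. The integral of f over T is at most 0 although f is positive on T,
  so T is null and A has measure below every e.\<close>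

lemma nonpos_AE_if_compact_integrals_nonpos:
  fixes f :: "'a::euclidean_space \<Rightarrow> real"
  assumes "open S" "f locally_integrable_on S"
    and K: "\<And>K. compact K \<Longrightarrow> K \<subseteq> S \<Longrightarrow> (LINT x|lebesgue. f x * indicator K x) \<le> 0"
  shows "AE x in lebesgue. x \<in> S \<longrightarrow> f x \<le> 0"
proof -
  obtain C where C: "\<And>n::nat. compact (C n)" "\<And>n. C n \<subseteq> S" "(\<Union>n. C n) = S"
    using open_Union_compact_subsets[OF assms(1)] by (metis range_subsetD)
  have "AE x in lebesgue. x \<in> C n \<longrightarrow> f x \<le> 0" for n
  proof -
    define h where "h x = f x * indicator (C n) x" for x
    have h: "integrable lebesgue h"
      using assms(2) C(1)[of n] C(2)[of n] by (auto simp: locally_integrable_on_def set_integrable_def h_def[abs_def] mult.commute)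
    define A where "A = {x. h x > 0}"
    have A: "A \<in> sets lebesgue"
      using measurable_sets[OF borel_measurable_integrable[OF h], of "{0<..}"]
      by (simp add: A_def vimage_def)
    have AC: "A \<subseteq> C n" by (auto simp: A_def h_def indicator_def split: if_splits)
    have "emeasure lebesgue A \<le> 0 + ennreal e" if "e > 0" for e
    proof -
      obtain T where T: "closed T" "T \<subseteq> A" "A - T \<in> lmeasurable" "emeasure lebesgue (A - T) < ennreal e"
        using sets_lebesgue_inner_closed[OF A \<open>e > 0\<close>] by metis
      have cT: "compact T"
      proof -
        have "C n \<inter> T = T" using T(2) AC by blast
        then show ?thesis using compact_Int_closed[OF C(1) T(1), of n] by simp
      qed
      have eq: "f x * indicator T x = h x * indicator T x" for x
        using T(2) AC by (auto simp: h_def indicator_def)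
      have Ts: "T \<in> sets lebesgue" using T(1) by auto
      have iT: "integrable lebesgue (\<lambda>x. h x * indicator T x)"
        using integrable_real_mult_indicator[OF Ts h] .
      have nn: "AE x in lebesgue. 0 \<le> h x * indicator T x"
      proof (rule AE_I2)
        show "0 \<le> h x * indicator T x" for x
          using T(2) by (cases "x \<in> T") (auto simp: A_def less_imp_le)
      qed
      have "(LINT x|lebesgue. h x * indicator T x) \<le> 0"
        using K[OF cT] T AC C(2)[of n] unfolding eq by blast
      then have "(LINT x|lebesgue. h x * indicator T x) = 0"
        using integral_nonneg_AE[OF nn] by linarith
      then have "AE x in lebesgue. h x * indicator T x = 0"
        using integral_nonneg_eq_0_iff_AE[OF iT nn] by simp
      then have "AE x in lebesgue. x \<notin> T"
        by eventually_elim (use T(2) in \<open>auto simp: A_def indicator_def\<close>)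
      then have "emeasure lebesgue T = 0"
        using Ts by (simp add: AE_iff_null null_sets_def AE_iff_null_sets)
      moreover have "emeasure lebesgue A = emeasure lebesgue T + emeasure lebesgue (A - T)"
      proof -
        have "T \<union> (A - T) = A" using T(2) by blast
        then show ?thesis using plus_emeasure[OF Ts, of "A - T"] A Ts by (simp del: emeasure_completion)
      qed
      ultimately show ?thesis using T(4) by (simp del: emeasure_completion add: less_imp_le)
    qed
    then have "emeasure lebesgue A \<le> 0" by (rule ennreal_le_epsilon)
    then have "A \<in> null_sets lebesgue" using A by (simp add: null_sets_def del: emeasure_completion)
    then have "AE x in lebesgue. x \<notin> A" by (rule AE_not_in)
    then show ?thesis by eventually_elim (auto simp: A_def h_def)
  qed
  then have "AE x in lebesgue. \<forall>n. x \<in> C n \<longrightarrow> f x \<le> 0" unfolding AE_all_countable by blast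
  then show ?thesis by eventually_elim (use C(3) in auto)
qed

text \<open>The one-sided form turns an estimate against nonnegative test functions into an almost
  everywhere bound, which is how increments are estimated later.\<close>

lemma fundamental_lemma_nonpos:
  fixes f :: "'a::euclidean_space \<Rightarrow> real"
  assumes "open S" "f locally_integrable_on S"
    and "\<And>\<psi>. \<psi> \<in> test_functions S \<Longrightarrow> (\<And>x. 0 \<le> \<psi> x) \<Longrightarrow> (LINT x|lebesgue. f x * \<psi> x) \<le> 0"
  shows "AE x in lebesgue. x \<in> S \<longrightarrow> f x \<le> 0"
  using nonpos_AE_if_compact_integrals_nonpos[OF assms(1,2)]
    locally_integrable_compact_nonpos[OF assms(1,2) _ _ assms(3)] by blast

lemma fundamental_lemma:
  fixes f :: "'a::euclidean_space \<Rightarrow> real"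
  assumes "open S" "f locally_integrable_on S"
    and z: "\<And>\<psi>. \<psi> \<in> test_functions S \<Longrightarrow> (LINT x|lebesgue. f x * \<psi> x) = 0"
  shows "AE x in lebesgue. x \<in> S \<longrightarrow> f x = 0"
proof -
  have "AE x in lebesgue. x \<in> S \<longrightarrow> f x \<le> 0"
    by (rule fundamental_lemma_nonpos[OF assms(1,2)]) (simp add: z)
  moreover have "AE x in lebesgue. x \<in> S \<longrightarrow> - f x \<le> 0"
    by (rule fundamental_lemma_nonpos[OF assms(1)])
      (use assms(2) in \<open>simp_all add: z locally_integrable_on_def set_integrable_def\<close>)
  ultimately show ?thesis by eventually_elim auto
qed

section \<open>Density of test functions in L1\<close>

lemma test_function_integrable:
  fixes \<psi> :: "'a::euclidean_space \<Rightarrow> real"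
  assumes "\<psi> \<in> test_functions S"
  shows "integrable lebesgue \<psi>"
proof -
  have "(\<lambda>x::'a. 1::real) locally_integrable_on S"
    using lmeasurable_compact
    by (auto simp: locally_integrable_on_def set_integrable_def fmeasurable_def
        simp del: emeasure_completion intro!: integrable_real_indicator)
  from locally_integrable_mult_test[OF this assms] show ?thesis by simp
qed

lemma test_function_mono: "S \<subseteq> T \<Longrightarrow> \<psi> \<in> test_functions S \<Longrightarrow> \<psi> \<in> test_functions T"
  unfolding test_functions_def by blast

text \<open>By induction on integrable functions. For the indicator of A, the open set W from
  \<open>smooth_approx_indicator\<close> contains a closed subset T of A and lies in an open
  superset U of A, both of almost the same measure. Density later enlarges the class of weights in a
  weak limit.\<close>

lemma test_functions_dense_L1:
  fixes k :: "'a::euclidean_space \<Rightarrow> real"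
  assumes "open S" "bounded S" "integrable lebesgue k" "\<And>x. x \<notin> S \<Longrightarrow> k x = 0" "e > 0"
  obtains \<psi> where "\<psi> \<in> test_functions S" "(LINT x|lebesgue. \<bar>k x - \<psi> x\<bar>) < e"
proof -
  have S: "S \<in> sets lebesgue" using assms(1) by auto
  have fm: "emeasure lebesgue S < \<infinity>"
    using bounded_set_imp_lmeasurable[OF assms(2) S] by (simp add: fmeasurable_def del: emeasure_completion)
  have iS: "integrable (lebesgue_on S) \<psi>" if "\<psi> \<in> test_functions S" for \<psi> :: "'a \<Rightarrow> real"
    using lebesgue_on_supported(2)[OF S, of \<psi>] test_function_eq_0[OF that] test_function_integrable[OF that]
    by blast
  have "integrable (lebesgue_on S) k"
    using lebesgue_on_supported(2)[OF S, of k] assms by blast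
  then have "\<forall>e>0. \<exists>\<psi>\<in>test_functions S. (LINT x|lebesgue_on S. \<bar>k x - \<psi> x\<bar>) < e"
  proof (induction rule: integrable_induct)
    case (base A c)
    show ?case
    proof (intro allI impI)
      fix e :: real assume "e > 0"
      \<comment> \<open>Then \<bar>c\<bar> times twice \<eta> is below e, and the summand 1 covers c
        = 0.\<close>
      define \<eta> where "\<eta> = e / (4 * (\<bar>c\<bar> + 1))"
      have \<eta>: "\<eta> > 0" using \<open>e > 0\<close> by (simp add: \<eta>_def)
      have A: "A \<in> sets lebesgue" "A \<subseteq> S"
        using base(1) S by (auto simp: sets_restrict_space_iff)
      obtain U where U: "open U" "A \<subseteq> U" "U - A \<in> lmeasurable" "emeasure lebesgue (U - A) < ennreal \<eta>"
        using sets_lebesgue_outer_open[OF A(1) \<eta>] by metis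
      obtain T where T: "closed T" "T \<subseteq> A" "A - T \<in> lmeasurable" "emeasure lebesgue (A - T) < ennreal \<eta>"
        using sets_lebesgue_inner_closed[OF A(1) \<eta>] by metis
      have T': "compact T"
        using T A assms(2) by (meson bounded_subset compact_eq_bounded_closed)
      have "T \<subseteq> U \<inter> S" using T U A by blast
      then obtain W and \<psi> :: "nat \<Rightarrow> 'a \<Rightarrow> real" where W: "open W" "T \<subseteq> W" "W \<subseteq> U \<inter> S"
        and \<psi>: "\<And>n. \<psi> n \<in> test_functions (U \<inter> S)" "\<And>n x. 0 \<le> \<psi> n x" "\<And>n x. \<psi> n x \<le> indicator W x"
        "\<And>x. (\<lambda>n. \<psi> n x) \<longlonglongrightarrow> indicator W x"
        using smooth_approx_indicator[OF T' _ \<open>T \<subseteq> U \<inter> S\<close>] U(1) assms(1) by (metis open_Int)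
      have \<psi>S: "\<psi> n \<in> test_functions S" for n using test_function_mono[OF _ \<psi>(1)] by blast
      have ind: "integrable lebesgue (indicator X :: 'a \<Rightarrow> real)" if "X \<in> lmeasurable" for X
        using that by (auto simp: fmeasurable_def simp del: emeasure_completion intro!: integrable_real_indicator)
      have Wl: "W \<in> lmeasurable" using W assms(2)
        by (intro bounded_set_imp_lmeasurable) (auto intro: bounded_subset)
      have Al: "A \<in> lmeasurable" using A assms(2)
        by (intro bounded_set_imp_lmeasurable) (auto intro: bounded_subset)
      have 1: "(\<lambda>n. LINT x|lebesgue. \<bar>indicator A x - \<psi> n x\<bar>) \<longlonglongrightarrow> (LINT x|lebesgue. \<bar>indicator A x - indicator W x\<bar>)"
      proof (rule integral_dominated_convergence[where w = "\<lambda>x. indicator A x + indicator W x"])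
        show "AE x in lebesgue. norm \<bar>indicator A x - \<psi> n x\<bar> \<le> indicator A x + indicator W x" for n
        proof (rule AE_I2)
          show "norm \<bar>indicator A x - \<psi> n x\<bar> \<le> indicator A x + indicator W x" for x
            using \<psi>(2,3)[of n x] by (cases "x \<in> A") auto
        qed
        show "(\<lambda>x. \<bar>indicator A x - \<psi> n x\<bar>) \<in> borel_measurable lebesgue" for n
          using A(1) by (intro borel_measurable_abs borel_measurable_diff borel_measurable_indicator
              test_function_borel[OF \<psi>S])
        show "(\<lambda>x. \<bar>indicator A x - indicator W x\<bar> :: real) \<in> borel_measurable lebesgue"
          using A(1) W(1) by (intro borel_measurable_abs borel_measurable_diff borel_measurable_indicator) auto
        show "integrable lebesgue (\<lambda>x. indicator A x + indicator W x :: real)"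
          using ind Al Wl by (intro Bochner_Integration.integrable_add)
        show "AE x in lebesgue. (\<lambda>n. \<bar>indicator A x - \<psi> n x\<bar>) \<longlonglongrightarrow> \<bar>indicator A x - indicator W x\<bar>"
          by (intro AE_I2 tendsto_intros \<psi>(4))
      qed
      \<comment> \<open>A point where the indicators of A and W differ lies in \<open>U - A\<close>
        or in \<open>A - T\<close>, because T \<subseteq> W \<subseteq> U.\<close>
      have "(LINT x|lebesgue. \<bar>indicator A x - indicator W x\<bar>) \<le> (LINT x|lebesgue. indicator (U - A) x + indicator (A - T) x :: real)"
      proof (rule integral_mono)
        show "integrable lebesgue (\<lambda>x. \<bar>indicator A x - indicator W x\<bar> :: real)"
          using ind Al Wl by (intro Bochner_Integration.integrable_abs Bochner_Integration.integrable_diff)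
        show "integrable lebesgue (\<lambda>x. indicator (U - A) x + indicator (A - T) x :: real)"
          using ind U(3) T(3) by (intro Bochner_Integration.integrable_add)
        show "\<bar>indicator A x - indicator W x\<bar> \<le> (indicator (U - A) x + indicator (A - T) x :: real)" for x
          using W by (auto simp: indicator_def)
      qed
      also have "\<dots> = measure lebesgue (U - A) + measure lebesgue (A - T)"
        using ind U(3) T(3) by (subst Bochner_Integration.integral_add) auto
      also have "\<dots> < 2 * \<eta>"
      proof -
        have "measure lebesgue (U - A) < \<eta>" "measure lebesgue (A - T) < \<eta>"
          using U(3,4) T(3,4) \<eta> emeasure_eq_measure2[OF U(3)] emeasure_eq_measure2[OF T(3)]
          by (auto simp: ennreal_less_iff simp del: emeasure_completion measure_completion)
        then show ?thesis by simp
      qed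
      finally have "eventually (\<lambda>n. (LINT x|lebesgue. \<bar>indicator A x - \<psi> n x\<bar>) < 2 * \<eta>) sequentially"
        using order_tendstoD(2)[OF 1] by blast
      then obtain n where n: "(LINT x|lebesgue. \<bar>indicator A x - \<psi> n x\<bar>) < 2 * \<eta>"
        by (auto simp: eventually_sequentially)
      have "(LINT x|lebesgue_on S. \<bar>indicator A x *\<^sub>R c - c * \<psi> n x\<bar>)
          = (LINT x|lebesgue. \<bar>indicator A x *\<^sub>R c - c * \<psi> n x\<bar>)"
        using A(2) test_function_eq_0[OF \<psi>S]
        by (intro lebesgue_on_supported(1)[OF S]) (auto simp: indicator_def)
      also have "\<dots> = (LINT x|lebesgue. \<bar>c\<bar> * \<bar>indicator A x - \<psi> n x\<bar>)"
        by (simp add: abs_mult[symmetric] algebra_simps)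
      also have "\<dots> = \<bar>c\<bar> * (LINT x|lebesgue. \<bar>indicator A x - \<psi> n x\<bar>)" by simp
      also have "\<dots> \<le> \<bar>c\<bar> * (2 * \<eta>)" using n by (intro mult_left_mono) auto
      also have "\<dots> < e" using \<open>e > 0\<close> by (simp add: \<eta>_def field_simps add_pos_nonneg)
      finally show "\<exists>\<psi>\<in>test_functions S. (LINT x|lebesgue_on S. \<bar>indicator A x *\<^sub>R c - \<psi> x\<bar>) < e"
        by (rule bexI[of _ "\<lambda>x. c * \<psi> n x"]) (rule test_function_cmult[OF \<psi>S])
    qed
  next
    case (add f g)
    show ?case
    proof (intro allI impI)
      fix e :: real assume "e > 0"
      then obtain \<psi> \<theta> where *: "\<psi> \<in> test_functions S" "(LINT x|lebesgue_on S. \<bar>f x - \<psi> x\<bar>) < e / 2"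
        "\<theta> \<in> test_functions S" "(LINT x|lebesgue_on S. \<bar>g x - \<theta> x\<bar>) < e / 2"
        using add.IH(1)[rule_format, of "e / 2"] add.IH(2)[rule_format, of "e / 2"] \<open>e > 0\<close> by auto
      have "(LINT x|lebesgue_on S. \<bar>f x + g x - (\<psi> x + \<theta> x)\<bar>)
          \<le> (LINT x|lebesgue_on S. \<bar>f x - \<psi> x\<bar> + \<bar>g x - \<theta> x\<bar>)"
        using add.hyps iS[OF *(1)] iS[OF *(3)] by (intro integral_mono) auto
      also have "\<dots> < e"
        using add.hyps iS[OF *(1)] iS[OF *(3)] *(2,4) by simp
      finally show "\<exists>\<psi>\<in>test_functions S. (LINT x|lebesgue_on S. \<bar>f x + g x - \<psi> x\<bar>) < e"
        by (rule bexI[of _ "\<lambda>x. \<psi> x + \<theta> x"]) (rule test_function_add[OF *(1,3)])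
    qed
  next
    case (lim f s)
    show ?case
    proof (intro allI impI)
      fix e :: real assume "e > 0"
      have "(\<lambda>n. LINT x|lebesgue_on S. \<bar>f x - s n x\<bar>) \<longlonglongrightarrow> (LINT x|lebesgue_on S. \<bar>f x - f x\<bar>)"
      proof (rule integral_dominated_convergence[where w = "\<lambda>x. 3 * norm (f x)"])
        show "AE x in lebesgue_on S. (\<lambda>n. \<bar>f x - s n x\<bar>) \<longlonglongrightarrow> \<bar>f x - f x\<bar>"
          using lim.hyps(2) by (intro AE_I2 tendsto_intros) auto
        \<comment> \<open>The induction principle supplies approximants with
          \<open>norm (s n x) \<le> 2 * norm (f x)\<close>, whence the factor 3.\<close>
        show "AE x in lebesgue_on S. norm \<bar>f x - s n x\<bar> \<le> 3 * norm (f x)" for n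
          using lim.hyps(3) by (intro AE_I2) (smt (verit) real_norm_def)
      qed (use lim.hyps in auto)
      then have "eventually (\<lambda>n. (LINT x|lebesgue_on S. \<bar>f x - s n x\<bar>) < e / 2) sequentially"
        using \<open>e > 0\<close> by (intro order_tendstoD(2)) auto
      then obtain n where n: "(LINT x|lebesgue_on S. \<bar>f x - s n x\<bar>) < e / 2"
        by (auto simp: eventually_sequentially)
      obtain \<psi> where \<psi>: "\<psi> \<in> test_functions S" "(LINT x|lebesgue_on S. \<bar>s n x - \<psi> x\<bar>) < e / 2"
        using lim.IH \<open>e > 0\<close> by (metis half_gt_zero)
      have "(LINT x|lebesgue_on S. \<bar>f x - \<psi> x\<bar>)
          \<le> (LINT x|lebesgue_on S. \<bar>f x - s n x\<bar> + \<bar>s n x - \<psi> x\<bar>)"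
        using lim.hyps iS[OF \<psi>(1)] by (intro integral_mono) auto
      also have "\<dots> < e"
        using lim.hyps iS[OF \<psi>(1)] n \<psi>(2) by simp
      finally show "\<exists>\<psi>\<in>test_functions S. (LINT x|lebesgue_on S. \<bar>f x - \<psi> x\<bar>) < e"
        using \<psi>(1) by blast
    qed
  qed
  then obtain \<psi> where \<psi>: "\<psi> \<in> test_functions S" "(LINT x|lebesgue_on S. \<bar>k x - \<psi> x\<bar>) < e"
    using \<open>e > 0\<close> by blast
  have "(LINT x|lebesgue_on S. \<bar>k x - \<psi> x\<bar>) = (LINT x|lebesgue. \<bar>k x - \<psi> x\<bar>)"
    using assms(4) test_function_eq_0[OF \<psi>(1)] by (intro lebesgue_on_supported(1)[OF S]) auto
  then show thesis using that \<psi> by simp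
qed

section \<open>Translates of test functions and differentiation under the integral sign\<close>

lemma test_function_translate:
  assumes "\<psi> \<in> test_functions S" "\<And>x. x + a \<in> closure {x. \<psi> x \<noteq> 0} \<Longrightarrow> x \<in> T"
  shows "(\<lambda>x. \<psi> (x + a)) \<in> test_functions T"
proof (rule test_functionI)
  show "continuously_differentiable k (\<lambda>x. \<psi> (x + a))" for k
    by (rule cont_diff_translate[OF test_function_cont_diff[OF assms(1)]])
  show "compact ((\<lambda>x. x - a) ` closure {x. \<psi> x \<noteq> 0})"
    using test_function_compact[OF assms(1)] by (rule compact_translation_subtract)
  show "(\<lambda>x. x - a) ` closure {x. \<psi> x \<noteq> 0} \<subseteq> T" using assms(2) by force
  show "\<psi> (x + a) = 0" if "x \<notin> (\<lambda>x. x - a) ` closure {x. \<psi> x \<noteq> 0}" for x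
  proof (rule eq_0_outside_support[of _ \<psi>])
    show "x + a \<notin> closure {x. \<psi> x \<noteq> 0}" using that by force
  qed
qed

lemma test_function_line_deriv:
  fixes \<psi> :: "'a::euclidean_space \<Rightarrow> real"
  assumes "\<psi> \<in> test_functions S"
  shows "((\<lambda>t. \<psi> (x - t *\<^sub>R e)) has_real_derivative - frechet_derivative \<psi> (at (x - t *\<^sub>R e)) e) (at t)"
proof -
  have 1: "((\<lambda>t. x - t *\<^sub>R e) has_derivative (\<lambda>h. - (h *\<^sub>R e))) (at t)"
    by (auto intro!: derivative_eq_intros)
  have 2: "(\<psi> has_derivative frechet_derivative \<psi> (at (x - t *\<^sub>R e))) (at (x - t *\<^sub>R e))"
    by (rule has_derivative_frechet[OF test_function_differentiable[OF assms]])
  have "frechet_derivative \<psi> (at y) (- (h *\<^sub>R e)) = - frechet_derivative \<psi> (at y) e * h" for y h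
    using linear_scale[OF linear_frechet_derivative[OF test_function_differentiable[OF assms]], of y "-h" e]
    by simp
  then have eq: "(\<lambda>h. frechet_derivative \<psi> (at y) (- (h *\<^sub>R e))) = (*) (- frechet_derivative \<psi> (at y) e)" for y
    by (intro ext)
  show ?thesis using has_derivative_compose[OF 1 2] unfolding eq has_field_derivative_def .
qed

text \<open>The derivative falls on the smooth factor: the Lipschitz constant C of \<psi> dominates
  the difference quotients by C \<bar>f\<bar>, which is integrable.\<close>

lemma translation_integral_deriv:
  fixes f :: "'a::euclidean_space \<Rightarrow> real"
  assumes f: "integrable lebesgue f" and \<psi>: "\<psi> \<in> test_functions S" and e: "e \<in> Basis"
  shows "((\<lambda>t. LINT x|lebesgue. f x * \<psi> (x - t *\<^sub>R e)) has_real_derivative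
     - (LINT x|lebesgue. f x * frechet_derivative \<psi> (at (x - t *\<^sub>R e)) e)) (at t)"
  unfolding DERIV_def tendsto_at_iff_sequentially comp_def
proof (intro allI impI)
  fix X :: "nat \<Rightarrow> real" assume X: "\<forall>i. X i \<in> UNIV - {0}" "X \<longlonglongrightarrow> 0"
  obtain C where C: "C > 0" "\<And>x y. norm (\<psi> x - \<psi> y) \<le> C * norm (x - y)"
    using test_function_Lipschitz[OF \<psi>] by blast
  have tr: "\<psi> \<in> test_functions UNIV" using test_function_mono[OF _ \<psi>] by blast
  have trt: "(\<lambda>x. \<psi> (x - s *\<^sub>R e)) \<in> test_functions UNIV" for s
    using test_function_translate[OF tr, of "- (s *\<^sub>R e)" UNIV] by simp
  have i: "integrable lebesgue (\<lambda>x. f x * \<psi> (x - s *\<^sub>R e))" for s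
    by (rule integrable_mult_test[OF f trt])
  have d: "(\<lambda>x. frechet_derivative \<psi> (at (x - t *\<^sub>R e)) e) \<in> test_functions UNIV"
    using test_function_translate[OF test_function_partial[OF tr e], of "- (t *\<^sub>R e)" UNIV] by simp
  have "(\<lambda>n. LINT x|lebesgue. f x * ((\<psi> (x - (t + X n) *\<^sub>R e) - \<psi> (x - t *\<^sub>R e)) / X n))
     \<longlonglongrightarrow> (LINT x|lebesgue. f x * - frechet_derivative \<psi> (at (x - t *\<^sub>R e)) e)"
  proof (rule integral_dominated_convergence[where w = "\<lambda>x. C * \<bar>f x\<bar>"])
    show "(\<lambda>x. f x * - frechet_derivative \<psi> (at (x - t *\<^sub>R e)) e) \<in> borel_measurable lebesgue"
      by (intro borel_measurable_times borel_measurable_uminus borel_measurable_integrable[OF f] test_function_borel[OF d])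
    show "(\<lambda>x. f x * ((\<psi> (x - (t + X n) *\<^sub>R e) - \<psi> (x - t *\<^sub>R e)) / X n)) \<in> borel_measurable lebesgue" for n
      by (intro borel_measurable_times borel_measurable_divide borel_measurable_diff
          borel_measurable_const borel_measurable_integrable[OF f] test_function_borel[OF trt])
    show "AE x in lebesgue. norm (f x * ((\<psi> (x - (t + X n) *\<^sub>R e) - \<psi> (x - t *\<^sub>R e)) / X n)) \<le> C * \<bar>f x\<bar>" for n
    proof (rule AE_I2)
      fix x
      have "norm (\<psi> (x - (t + X n) *\<^sub>R e) - \<psi> (x - t *\<^sub>R e)) \<le> C * \<bar>X n\<bar>"
        using C(2)[of "x - (t + X n) *\<^sub>R e" "x - t *\<^sub>R e"] e by (simp add: algebra_simps)
      then have "\<bar>(\<psi> (x - (t + X n) *\<^sub>R e) - \<psi> (x - t *\<^sub>R e)) / X n\<bar> \<le> C"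
        using X(1) by (simp add: divide_simps)
      then show "norm (f x * ((\<psi> (x - (t + X n) *\<^sub>R e) - \<psi> (x - t *\<^sub>R e)) / X n)) \<le> C * \<bar>f x\<bar>"
        unfolding real_norm_def abs_mult by (subst mult.commute) (rule mult_right_mono, auto)
    qed
    show "AE x in lebesgue. (\<lambda>n. f x * ((\<psi> (x - (t + X n) *\<^sub>R e) - \<psi> (x - t *\<^sub>R e)) / X n))
        \<longlonglongrightarrow> f x * - frechet_derivative \<psi> (at (x - t *\<^sub>R e)) e"
    proof (intro AE_I2 tendsto_mult tendsto_const)
      fix x
      from test_function_line_deriv[OF \<psi>, of x e t]
      show "(\<lambda>n. (\<psi> (x - (t + X n) *\<^sub>R e) - \<psi> (x - t *\<^sub>R e)) / X n) \<longlonglongrightarrow> - frechet_derivative \<psi> (at (x - t *\<^sub>R e)) e"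
        unfolding DERIV_def tendsto_at_iff_sequentially comp_def using X by blast
    qed
  qed (use f in auto)
  moreover have "(LINT x|lebesgue. f x * ((\<psi> (x - (t + X n) *\<^sub>R e) - \<psi> (x - t *\<^sub>R e)) / X n))
     = ((LINT x|lebesgue. f x * \<psi> (x - (t + X n) *\<^sub>R e)) - (LINT x|lebesgue. f x * \<psi> (x - t *\<^sub>R e))) / X n" for n
    using i by (simp add: right_diff_distrib diff_divide_distrib)
  moreover have "(LINT x|lebesgue. f x * - frechet_derivative \<psi> (at (x - t *\<^sub>R e)) e)
     = - (LINT x|lebesgue. f x * frechet_derivative \<psi> (at (x - t *\<^sub>R e)) e)"
    by simp
  ultimately show "(\<lambda>n. ((LINT x|lebesgue. f x * \<psi> (x - (t + X n) *\<^sub>R e)) - (LINT x|lebesgue. f x * \<psi> (x - t *\<^sub>R e))) / X n)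
     \<longlonglongrightarrow> - (LINT x|lebesgue. f x * frechet_derivative \<psi> (at (x - t *\<^sub>R e)) e)"
    by (simp only:)
qed

section \<open>Difference quotients and weak derivatives\<close>

lemma translate_swap:
  fixes f :: "'a::euclidean_space \<Rightarrow> real"
  assumes "integrable lebesgue f" "\<psi> \<in> test_functions S"
  shows "(LINT x|lebesgue. f (x + a) * \<psi> x) = (LINT x|lebesgue. f x * \<psi> (x - a))"
    and "integrable lebesgue (\<lambda>x. f (x + a) * \<psi> x)"
    and "integrable lebesgue (\<lambda>x. f x * \<psi> (x - a))"
proof -
  have "(\<lambda>x. \<psi> (x + - a)) \<in> test_functions UNIV"
    by (rule test_function_translate[OF assms(2)]) simp
  then show i: "integrable lebesgue (\<lambda>x. f x * \<psi> (x - a))"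
    using integrable_mult_test[OF assms(1)] by simp
  from integral_lebesgue_translation[OF i, of a]
  show "(LINT x|lebesgue. f (x + a) * \<psi> x) = (LINT x|lebesgue. f x * \<psi> (x - a))" by simp
  from integrable_lebesgue_translation[OF i, of a]
  show "integrable lebesgue (\<lambda>x. f (x + a) * \<psi> x)" by simp
qed

text \<open>Discrete integration by parts: a shift of the variable puts the increment on \<psi>,
  where \<open>translation_integral_deriv\<close> at 0 gives the limit. For integrable f this is its
  distributional derivative, tested with \<psi>.\<close>

lemma integral_quotient_LIMSEQ:
  fixes f :: "'a::euclidean_space \<Rightarrow> real"
  assumes f: "integrable lebesgue f" and \<psi>: "\<psi> \<in> test_functions S" and e: "e \<in> Basis"
    and h: "\<And>n. h n \<noteq> 0" "h \<longlonglongrightarrow> 0"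
  shows "(\<lambda>n. LINT x|lebesgue. ((f (x + h n *\<^sub>R e) - f x) / h n) * \<psi> x)
      \<longlonglongrightarrow> - (LINT x|lebesgue. f x * frechet_derivative \<psi> (at x) e)"
proof -
  from translation_integral_deriv[OF f \<psi> e, of 0]
  have "(\<lambda>n. ((LINT x|lebesgue. f x * \<psi> (x - h n *\<^sub>R e)) - (LINT x|lebesgue. f x * \<psi> x)) / h n)
     \<longlonglongrightarrow> - (LINT x|lebesgue. f x * frechet_derivative \<psi> (at x) e)"
    unfolding DERIV_def tendsto_at_iff_sequentially comp_def
    by (elim allE[of _ h]) (use h in simp)
  moreover have "((LINT x|lebesgue. f x * \<psi> (x - h n *\<^sub>R e)) - (LINT x|lebesgue. f x * \<psi> x)) / h n
     = (LINT x|lebesgue. ((f (x + h n *\<^sub>R e) - f x) / h n) * \<psi> x)" for n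
    using translate_swap[OF f \<psi>, of "h n *\<^sub>R e"] integrable_mult_test[OF f \<psi>]
    by (simp add: left_diff_distrib diff_divide_distrib)
  ultimately show ?thesis by simp
qed

lemma frechet_derivative_translate:
  assumes "\<psi> \<in> test_functions S"
  shows "frechet_derivative (\<lambda>x. \<psi> (x - a)) (at x) e = frechet_derivative \<psi> (at (x - a)) e"
proof (rule frechet_derivative_eqI)
  have "((\<lambda>x. x - a) has_derivative (\<lambda>h. h)) (at x)" by (auto intro!: derivative_eq_intros)
  moreover have "(\<psi> has_derivative frechet_derivative \<psi> (at (x - a))) (at (x - a))"
    by (rule has_derivative_frechet[OF test_function_differentiable[OF assms]])
  ultimately show "((\<lambda>x. \<psi> (x - a)) has_derivative frechet_derivative \<psi> (at (x - a))) (at x)"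
    by (rule has_derivative_compose)
qed

text \<open>Pairing f with the translate of \<psi> by t is the same as pairing \<psi> with the
  translate of f by -t. Computing the derivative at t = 0 in both ways gives the identity.\<close>

lemma test_function_parts:
  fixes f \<psi> :: "'a::euclidean_space \<Rightarrow> real"
  assumes f: "f \<in> test_functions T" and \<psi>: "\<psi> \<in> test_functions S" and e: "e \<in> Basis"
  shows "(LINT x|lebesgue. f x * frechet_derivative \<psi> (at x) e) =
    - (LINT x|lebesgue. frechet_derivative f (at x) e * \<psi> x)"
proof -
  note fi = test_function_integrable[OF f] and \<psi>i = test_function_integrable[OF \<psi>]
  have 1: "((\<lambda>t. LINT x|lebesgue. f x * \<psi> (x - t *\<^sub>R e)) has_real_derivative
     - (LINT x|lebesgue. f x * frechet_derivative \<psi> (at x) e)) (at 0)"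
    using translation_integral_deriv[OF fi \<psi> e, of 0] by simp
  have "((\<lambda>t. LINT x|lebesgue. \<psi> x * f (x - t *\<^sub>R e)) has_real_derivative
     - (LINT x|lebesgue. \<psi> x * frechet_derivative f (at x) e)) (at (- 0))"
    using translation_integral_deriv[OF \<psi>i f e, of 0] by simp
  then have "((\<lambda>t. LINT x|lebesgue. \<psi> x * f (x - (- t) *\<^sub>R e)) has_real_derivative
     (LINT x|lebesgue. \<psi> x * frechet_derivative f (at x) e)) (at 0)"
    using DERIV_mirror[of "\<lambda>t. LINT x|lebesgue. \<psi> x * f (x - t *\<^sub>R e)" _ 0] by simp
  moreover have "(LINT x|lebesgue. \<psi> x * f (x - (- t) *\<^sub>R e)) = (LINT x|lebesgue. f x * \<psi> (x - t *\<^sub>R e))" for t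
    using translate_swap(1)[OF fi \<psi>, of "t *\<^sub>R e"] by (simp add: mult.commute)
  ultimately have "((\<lambda>t. LINT x|lebesgue. f x * \<psi> (x - t *\<^sub>R e)) has_real_derivative
     (LINT x|lebesgue. \<psi> x * frechet_derivative f (at x) e)) (at 0)"
    by simp
  from DERIV_unique[OF 1 this] show ?thesis by (simp add: mult.commute)
qed

lemma test_function_quotient_LIMSEQ:
  fixes \<psi> :: "'a::euclidean_space \<Rightarrow> real"
  assumes "\<psi> \<in> test_functions S" "\<And>n. h n \<noteq> 0" "h \<longlonglongrightarrow> 0"
  shows "(\<lambda>n. (\<psi> (x + h n *\<^sub>R e) - \<psi> x) / h n) \<longlonglongrightarrow> frechet_derivative \<psi> (at x) e"
proof -
  have D: "((\<lambda>t. \<psi> (x - t *\<^sub>R e)) has_real_derivative - frechet_derivative \<psi> (at x) e) (at 0)"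
    using test_function_line_deriv[OF assms(1), of x e 0] by simp
  have "(\<lambda>n. - h n) \<longlonglongrightarrow> 0" using tendsto_minus[OF assms(3)] by simp
  then have "(\<lambda>n. (\<psi> (x - (0 + - h n) *\<^sub>R e) - \<psi> (x - 0 *\<^sub>R e)) / (- h n)) \<longlonglongrightarrow> - frechet_derivative \<psi> (at x) e"
    using D assms(2) unfolding DERIV_def tendsto_at_iff_sequentially comp_def
    by (elim allE[of _ "\<lambda>n. - h n"]) simp
  from tendsto_minus[OF this] show ?thesis by (simp add: minus_divide_left)
qed

text \<open>The exchange of i and j is an exact identity for difference quotients, by translation
  invariance, and passes to the limit with first derivatives alone. It is the double integration by
  parts behind Korn's inequality.\<close>

lemma test_function_mixed:
  fixes f g :: "'a::euclidean_space \<Rightarrow> real"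
  assumes f: "f \<in> test_functions T" and g: "g \<in> test_functions S"
    and i: "i \<in> Basis" and j: "j \<in> Basis"
  shows "(LINT x|lebesgue. frechet_derivative f (at x) i * frechet_derivative g (at x) j) =
    (LINT x|lebesgue. frechet_derivative f (at x) j * frechet_derivative g (at x) i)"
proof -
  have lim: "(\<lambda>n. LINT x|lebesgue. ((f (x + h n *\<^sub>R i) - f x) / h n) * ((g (x + h n *\<^sub>R j) - g x) / h n))
     \<longlonglongrightarrow> (LINT x|lebesgue. frechet_derivative f (at x) i * frechet_derivative g (at x) j)"
    if h: "\<And>n. h n \<noteq> 0" "h \<longlonglongrightarrow> 0" "\<And>n. \<bar>h n\<bar> \<le> 1" and ij: "i \<in> Basis" "j \<in> Basis" for i j h
  proof -
    obtain C where C: "C > 0" "\<And>x y. norm (f x - f y) \<le> C * norm (x - y)"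
      using test_function_Lipschitz[OF f] by blast
    obtain D where D: "D > 0" "\<And>x y. norm (g x - g y) \<le> D * norm (x - y)"
      using test_function_Lipschitz[OF g] by blast
    obtain R where R: "closure {x. f x \<noteq> 0} \<subseteq> cball 0 R" "R > 0"
      using bounded_subset_ballD[OF compact_imp_bounded[OF test_function_compact[OF f]], of 0]
        ball_subset_cball by (metis subset_trans)
    have tr: "(\<lambda>x. \<phi> (x + a)) \<in> borel_measurable lebesgue" "\<phi> \<in> borel_measurable lebesgue"
      if "\<phi> \<in> test_functions X" for \<phi> :: "'a \<Rightarrow> real" and a X
      using test_function_borel[OF test_function_translate[OF that, of a UNIV]]
        test_function_borel[OF that] by auto
    \<comment> \<open>Since \<open>\<bar>h n\<bar> \<le> 1\<close>, the quotients of f vanish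
      outside the ball around the support enlarged by 1, which gives an integrable bound uniform in
      n.\<close>
    have qf: "\<bar>(f (x + h n *\<^sub>R i) - f x) / h n\<bar> \<le> C * indicator (cball 0 (R + 1)) x" for n x
    proof (cases "x \<in> cball 0 (R + 1)")
      case True
      have "\<bar>f (x + h n *\<^sub>R i) - f x\<bar> \<le> C * \<bar>h n\<bar>"
        using C(2)[of "x + h n *\<^sub>R i" x] ij by simp
      then show ?thesis using h(1) True by (simp add: divide_simps)
    next
      case False
      then have "norm x > R + 1" by simp
      then have "x \<notin> cball 0 R" "x + h n *\<^sub>R i \<notin> cball 0 R"
        using norm_diff_ineq[of x "h n *\<^sub>R i"] h(3)[of n] ij by auto
      then have "f x = 0" "f (x + h n *\<^sub>R i) = 0"
        using R(1) eq_0_outside_support[of _ f] by blast+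
      then show ?thesis using False by simp
    qed
    have qg: "\<bar>(g (x + h n *\<^sub>R j) - g x) / h n\<bar> \<le> D" for n x
    proof -
      have "\<bar>g (x + h n *\<^sub>R j) - g x\<bar> \<le> D * \<bar>h n\<bar>"
        using D(2)[of "x + h n *\<^sub>R j" x] ij by simp
      then show ?thesis using h(1) by (simp add: divide_simps)
    qed
    show ?thesis
    proof (rule integral_dominated_convergence[where w = "\<lambda>x. C * indicator (cball 0 (R + 1)) x * D"])
      show "(\<lambda>x. frechet_derivative f (at x) i * frechet_derivative g (at x) j) \<in> borel_measurable lebesgue"
        by (intro borel_measurable_times test_function_borel[OF test_function_partial[OF f]]
            test_function_borel[OF test_function_partial[OF g]] ij)
      show "(\<lambda>x. ((f (x + h n *\<^sub>R i) - f x) / h n) * ((g (x + h n *\<^sub>R j) - g x) / h n)) \<in> borel_measurable lebesgue" for n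
        by (intro borel_measurable_times borel_measurable_divide borel_measurable_diff
            borel_measurable_const tr[OF f] tr[OF g])
      show "integrable lebesgue (\<lambda>x. C * indicator (cball 0 (R + 1)) x * D)"
        using lmeasurable_compact[OF compact_cball, of 0 "R + 1"]
        by (intro integrable_mult_left integrable_mult_right integrable_real_indicator)
          (auto simp: fmeasurable_def simp del: emeasure_completion)
      show "AE x in lebesgue. norm (((f (x + h n *\<^sub>R i) - f x) / h n) * ((g (x + h n *\<^sub>R j) - g x) / h n))
          \<le> C * indicator (cball 0 (R + 1)) x * D" for n
        unfolding real_norm_def abs_mult
        using C D by (intro AE_I2 mult_mono qf qg) (auto intro: mult_nonneg_nonneg)
      show "AE x in lebesgue. (\<lambda>n. ((f (x + h n *\<^sub>R i) - f x) / h n) * ((g (x + h n *\<^sub>R j) - g x) / h n))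
         \<longlonglongrightarrow> frechet_derivative f (at x) i * frechet_derivative g (at x) j"
        by (intro AE_I2 tendsto_mult test_function_quotient_LIMSEQ[OF f h(1,2)] test_function_quotient_LIMSEQ[OF g h(1,2)])
    qed
  qed
  \<comment> \<open>The integral \<open>c a b\<close> depends on \<open>a - b\<close> only.
    Replacing the shifts (a, b) by (-b, -a) therefore keeps the first and last of the four terms of
    the expanded product and swaps the other two.\<close>
  have eq: "(LINT x|lebesgue. ((f (x + h *\<^sub>R i) - f x) / h) * ((g (x + h *\<^sub>R j) - g x) / h)) =
      (LINT x|lebesgue. ((f (x + (- h) *\<^sub>R j) - f x) / (- h)) * ((g (x + (- h) *\<^sub>R i) - g x) / (- h)))" for h
  proof -
    let ?a = "h *\<^sub>R i" and ?b = "h *\<^sub>R j"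
    have int: "integrable lebesgue (\<lambda>x. f (x + a) * g (x + b))" for a b
      by (rule integrable_mult_test[OF integrable_lebesgue_translation[OF test_function_integrable[OF f]]
            test_function_translate[OF g, of b UNIV]]) simp
    define c where "c a b = (LINT x|lebesgue. f (x + a) * g (x + b))" for a b
    have sh: "c (a + d) (b + d) = c a b" for a b d
      using integral_lebesgue_translation[OF int[of a b], of d] by (simp add: c_def algebra_simps)
    have int0: "integrable lebesgue (\<lambda>x. f x * g (x + b))" "integrable lebesgue (\<lambda>x. f (x + a) * g x)"
        "integrable lebesgue (\<lambda>x. f x * g x)" for a b
      using int[of 0 b] int[of a 0] int[of 0 0] by simp_all
    have ex: "(LINT x|lebesgue. (f (x + a) - f x) * (g (x + b) - g x)) = c a b - c a 0 - c 0 b + c 0 0" for a b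
      using int[of a b] int0(1)[of b] int0(2)[of a] int0(3)
      by (simp add: c_def algebra_simps)
    have "(LINT x|lebesgue. (f (x + ?a) - f x) * (g (x + ?b) - g x)) =
      (LINT x|lebesgue. (f (x - ?b) - f x) * (g (x - ?a) - g x))"
      using ex[of ?a ?b] ex[of "- ?b" "- ?a"] sh[of "- ?b" "?a + ?b" "- ?a"] sh[of "- ?b" ?b 0] sh[of 0 ?a "- ?a"]
      by simp
    then show ?thesis by (simp add: power2_eq_square[symmetric] flip: times_divide_times_eq)
  qed
  define h where "h n = 1 / real (Suc n)" for n
  have h: "h n \<noteq> 0" "\<bar>h n\<bar> \<le> 1" "h \<longlonglongrightarrow> 0" for n
    using LIMSEQ_inverse_real_of_nat by (auto simp: h_def[abs_def] inverse_eq_divide)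
  have h': "(\<lambda>n. - h n) \<longlonglongrightarrow> 0" using tendsto_minus[OF h(3)] by simp
  have A: "(\<lambda>n. LINT x|lebesgue. ((f (x + h n *\<^sub>R i) - f x) / h n) * ((g (x + h n *\<^sub>R j) - g x) / h n))
     \<longlonglongrightarrow> (LINT x|lebesgue. frechet_derivative f (at x) i * frechet_derivative g (at x) j)"
    by (rule lim[OF h(1) h(3) h(2) i j])
  have B: "(\<lambda>n. LINT x|lebesgue. ((f (x + (- h n) *\<^sub>R j) - f x) / (- h n)) * ((g (x + (- h n) *\<^sub>R i) - g x) / (- h n)))
     \<longlonglongrightarrow> (LINT x|lebesgue. frechet_derivative f (at x) j * frechet_derivative g (at x) i)"
    by (rule lim[of "\<lambda>n. - h n"]) (use h h' i j in simp_all)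
  show ?thesis using LIMSEQ_unique[OF A] B unfolding eq by blast
qed

text \<open>From these points every translation by a vector of length at most d stays in S; the
  strict inequality for a continuous function makes the set visibly open.\<close>

definition shrink :: "'a::euclidean_space set \<Rightarrow> real \<Rightarrow> 'a set" where
  "shrink S d = {x. d < infdist x (- S)}"

lemma open_shrink: "open (shrink S d)"
  unfolding shrink_def by (intro open_Collect_less continuous_intros)

lemma shrink_add:
  assumes "x \<in> shrink S d" "norm a \<le> d"
  shows "x + a \<in> S"
proof (rule ccontr)
  assume "x + a \<notin> S"
  then have "infdist x (- S) \<le> dist x (x + a)" by (intro infdist_le) auto
  then show False using assms by (simp add: shrink_def dist_norm)
qed

lemma shrink_subset: "0 \<le> d \<Longrightarrow> shrink S d \<subseteq> S"
  using shrink_add[of _ S d 0] by auto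

lemma compact_subset_shrink:
  fixes S :: "'a::euclidean_space set"
  assumes "compact K" "K \<subseteq> S" "open S" "bounded S"
  obtains d where "d > 0" "K \<subseteq> shrink S d"
proof -
  \<comment> \<open>For an empty complement \<open>infdist\<close> would be 0 and
    \<open>shrink S d\<close> empty for every d > 0; boundedness of S excludes this.\<close>
  have ne: "- S \<noteq> {}" using assms(4) by (metis Compl_empty_eq double_complement not_bounded_UNIV)
  obtain d where d: "d > 0" "(\<Union>x\<in>K. cball x d) \<subseteq> S"
    using compact_subset_open_imp_cball_epsilon_subset[OF assms(1,3,2)] by blast
  have "K \<subseteq> shrink S (d / 2)"
  proof
    fix x assume x: "x \<in> K"
    obtain y where y: "y \<in> - S" "infdist x (- S) = dist x y"
      using infdist_attains_inf[of "- S" x] assms(3) ne by auto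
    then have "y \<notin> cball x d" using x d by blast
    then show "x \<in> shrink S (d / 2)" using y d(1) by (auto simp: shrink_def)
  qed
  then show thesis using that[of "d / 2"] d(1) by simp
qed

lemma abs_integral_mult_test_le:
  fixes g :: "'a::euclidean_space \<Rightarrow> real"
  assumes g: "g locally_integrable_on S" "AE x in lebesgue. x \<in> S \<longrightarrow> \<bar>g x\<bar> \<le> M"
    and \<psi>: "\<psi> \<in> test_functions S" "\<And>x. 0 \<le> \<psi> x"
  shows "\<bar>LINT x|lebesgue. g x * \<psi> x\<bar> \<le> M * (LINT x|lebesgue. \<psi> x)"
proof -
  note i = locally_integrable_mult_test[OF g(1) \<psi>(1)]
  have "\<bar>LINT x|lebesgue. g x * \<psi> x\<bar> \<le> (LINT x|lebesgue. \<bar>g x * \<psi> x\<bar>)"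
    by (rule integral_abs_bound)
  also have "\<dots> \<le> (LINT x|lebesgue. M * \<psi> x)"
  proof (rule integral_mono_AE)
    show "integrable lebesgue (\<lambda>x. \<bar>g x * \<psi> x\<bar>)" using i by simp
    show "integrable lebesgue (\<lambda>x. M * \<psi> x)" using test_function_integrable[OF \<psi>(1)] by simp
    show "AE x in lebesgue. \<bar>g x * \<psi> x\<bar> \<le> M * \<psi> x"
      using g(2)
    proof eventually_elim
      case (elim x)
      then show ?case
        using \<psi>(2)[of x] test_function_eq_0[OF \<psi>(1), of x]
        by (cases "x \<in> S") (auto simp: abs_mult intro: mult_right_mono)
    qed
  qed
  finally show ?thesis by simp
qed

text \<open>Plays the part of a Lipschitz estimate for f. Paired with a nonnegative \<psi>, the
  translates of f have a derivative in t bounded by M times the integral of \<psi>; the mean value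
  theorem bounds the integrated increment, and the fundamental lemma makes this bound pointwise
  almost everywhere.\<close>

lemma weak_derivative_increment_bound:
  fixes f g :: "'a::euclidean_space \<Rightarrow> real"
  assumes f: "integrable lebesgue f"
    and g: "g locally_integrable_on S" "AE x in lebesgue. x \<in> S \<longrightarrow> \<bar>g x\<bar> \<le> M"
    and e: "e \<in> Basis"
    and weak: "\<And>\<psi>. \<psi> \<in> test_functions S \<Longrightarrow>
      (LINT x|lebesgue. f x * frechet_derivative \<psi> (at x) e) = - (LINT x|lebesgue. g x * \<psi> x)"
    and h: "\<bar>h\<bar> \<le> d"
  shows "AE x in lebesgue. x \<in> shrink S d \<longrightarrow> \<bar>f (x + h *\<^sub>R e) - f x\<bar> \<le> M * \<bar>h\<bar>"
proof -
  have key: "\<bar>LINT x|lebesgue. (f (x + h *\<^sub>R e) - f x) * \<psi> x\<bar> \<le> M * \<bar>h\<bar> * (LINT x|lebesgue. \<psi> x)"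
    if \<psi>: "\<psi> \<in> test_functions (shrink S d)" "\<And>x. 0 \<le> \<psi> x" for \<psi>
  proof -
    define F where "F t = (LINT x|lebesgue. f x * \<psi> (x - t *\<^sub>R e))" for t
    define D where "D t = - (LINT x|lebesgue. f x * frechet_derivative \<psi> (at (x - t *\<^sub>R e)) e)" for t
    have D: "\<bar>D t\<bar> \<le> M * (LINT x|lebesgue. \<psi> x)" if t: "\<bar>t\<bar> \<le> d" for t
    proof -
      \<comment> \<open>The weak equation may be tested with the translate, which is still supported
        in S by the choice of \<open>shrink\<close>.\<close>
      define \<theta> where "\<theta> x = \<psi> (x - t *\<^sub>R e)" for x
      have \<theta>: "\<theta> \<in> test_functions S"
        using test_function_translate[OF \<psi>(1), of "- (t *\<^sub>R e)" S] test_function_support[OF \<psi>(1)]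
          shrink_add[of "_ - t *\<^sub>R e" S d "t *\<^sub>R e"] t e by (force simp: \<theta>_def[abs_def])
      have "D t = - (LINT x|lebesgue. f x * frechet_derivative \<theta> (at x) e)"
        unfolding D_def \<theta>_def[abs_def] frechet_derivative_translate[OF \<psi>(1)] ..
      then have "D t = (LINT x|lebesgue. g x * \<theta> x)" using weak[OF \<theta>] by simp
      then have "\<bar>D t\<bar> \<le> M * (LINT x|lebesgue. \<theta> x)"
        using abs_integral_mult_test_le[OF g \<theta>] \<psi>(2) by (simp add: \<theta>_def)
      also have "(LINT x|lebesgue. \<theta> x) = (LINT x|lebesgue. \<psi> x)"
        using integral_lebesgue_translation[OF test_function_integrable[OF \<psi>(1)], of "- (t *\<^sub>R e)"]
        by (simp add: \<theta>_def)
      finally show ?thesis .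
    qed
    have "norm (F h - F 0) \<le> (M * (LINT x|lebesgue. \<psi> x)) * norm (h - 0)"
    proof (rule field_differentiable_bound[of "{-d..d}"])
      show "(F has_field_derivative D t) (at t within {-d..d})" for t
        using translation_integral_deriv[OF f \<psi>(1) e, of t] unfolding F_def[abs_def] D_def
        by (rule has_field_derivative_at_within)
      show "norm (D t) \<le> M * (LINT x|lebesgue. \<psi> x)" if "t \<in> {-d..d}" for t
        using D[of t] that by auto
    qed (use h in auto)
    moreover have "(LINT x|lebesgue. (f (x + h *\<^sub>R e) - f x) * \<psi> x) = F h - F 0"
      using translate_swap[OF f \<psi>(1), of "h *\<^sub>R e"] integrable_mult_test[OF f \<psi>(1)]
      by (simp add: F_def left_diff_distrib)
    ultimately show ?thesis by (simp add: algebra_simps)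
  qed
  \<comment> \<open>The signs 1 and -1 give the two halves of the absolute value.\<close>
  have one: "AE x in lebesgue. x \<in> shrink S d \<longrightarrow> c * (f (x + h *\<^sub>R e) - f x) - M * \<bar>h\<bar> \<le> 0"
    if c: "c = 1 \<or> c = -1" for c
  proof (rule fundamental_lemma_nonpos[OF open_shrink])
    have fi: "integrable lebesgue (\<lambda>x. c * (f (x + h *\<^sub>R e) - f x))"
      using f integrable_lebesgue_translation[OF f] by simp
    show "(\<lambda>x. c * (f (x + h *\<^sub>R e) - f x) - M * \<bar>h\<bar>) locally_integrable_on shrink S d"
      unfolding locally_integrable_on_def
    proof (intro allI impI)
      fix K assume K: "compact K \<and> K \<subseteq> shrink S d"
      have 1: "(\<lambda>x. c * (f (x + h *\<^sub>R e) - f x)) absolutely_integrable_on K"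
        using fi K unfolding set_integrable_def
        by (intro integrable_mult_indicator) (auto simp: compact_imp_closed)
      have 2: "(\<lambda>x. M * \<bar>h\<bar>) absolutely_integrable_on K"
        using K lmeasurable_compact[of K] by (simp add: absolutely_integrable_on_const)
      show "(\<lambda>x. c * (f (x + h *\<^sub>R e) - f x) - M * \<bar>h\<bar>) absolutely_integrable_on K"
        by (rule set_integral_diff(1)[OF 1 2])
    qed
    fix \<psi> :: "'a \<Rightarrow> real" assume \<psi>: "\<psi> \<in> test_functions (shrink S d)" "\<And>x. 0 \<le> \<psi> x"
    have "(LINT x|lebesgue. (c * (f (x + h *\<^sub>R e) - f x) - M * \<bar>h\<bar>) * \<psi> x)
       = (LINT x|lebesgue. c * ((f (x + h *\<^sub>R e) - f x) * \<psi> x) - (M * \<bar>h\<bar>) * \<psi> x)"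
      by (simp add: algebra_simps)
    also have "\<dots> = c * (LINT x|lebesgue. (f (x + h *\<^sub>R e) - f x) * \<psi> x) - M * \<bar>h\<bar> * (LINT x|lebesgue. \<psi> x)"
      using translate_swap(2)[OF f \<psi>(1), of "h *\<^sub>R e"] integrable_mult_test[OF f \<psi>(1)]
        test_function_integrable[OF \<psi>(1)]
      by (simp add: left_diff_distrib)
    also have "\<dots> \<le> 0" using key[OF \<psi>] c by (auto simp: abs_le_iff)
    finally show "(LINT x|lebesgue. (c * (f (x + h *\<^sub>R e) - f x) - M * \<bar>h\<bar>) * \<psi> x) \<le> 0" .
  qed
  show ?thesis using one[of 1, simplified] one[of "-1", simplified]
    by eventually_elim (auto simp: abs_le_iff)
qed

lemma AE_bounded_mult_integrable:
  fixes k q :: "'a::euclidean_space \<Rightarrow> real"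
  assumes "integrable lebesgue k" "q \<in> borel_measurable lebesgue"
    "AE x in lebesgue. k x \<noteq> 0 \<longrightarrow> \<bar>q x\<bar> \<le> M" 
  shows "integrable lebesgue (\<lambda>x. q x * k x)"
    and "\<bar>LINT x|lebesgue. q x * k x\<bar> \<le> M * (LINT x|lebesgue. \<bar>k x\<bar>)"
proof -
  have ae: "AE x in lebesgue. norm (q x * k x) \<le> M * \<bar>k x\<bar>"
    using assms(3)
  proof eventually_elim
    case (elim x)
    then show ?case by (cases "k x = 0") (auto simp: abs_mult intro: mult_right_mono)
  qed
  show i: "integrable lebesgue (\<lambda>x. q x * k x)"
  proof (rule Bochner_Integration.integrable_bound[OF integrable_mult_right[OF integrable_abs[OF assms(1)], of M]])
    show "(\<lambda>x. q x * k x) \<in> borel_measurable lebesgue"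
      using assms(1,2) by (intro borel_measurable_times) auto
    show "AE x in lebesgue. norm (q x * k x) \<le> norm (M * \<bar>k x\<bar>)"
      using ae by eventually_elim auto
  qed
  have "\<bar>LINT x|lebesgue. q x * k x\<bar> \<le> (LINT x|lebesgue. \<bar>q x * k x\<bar>)" by (rule integral_abs_bound)
  also have "\<dots> \<le> (LINT x|lebesgue. M * \<bar>k x\<bar>)"
    using i assms(1) ae by (intro integral_mono_AE) auto
  finally show "\<bar>LINT x|lebesgue. q x * k x\<bar> \<le> M * (LINT x|lebesgue. \<bar>k x\<bar>)" by simp
qed

text \<open>The quotients are bounded by M almost everywhere, uniformly in n, so convergence against
  test functions extends to integrable weights by density in L1. In the chain rule the weight
  contains a derivative of \<phi> composed with the map, which need not be smooth.\<close>

lemma weak_derivative_quotient_LIMSEQ: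
  fixes f g k :: "'a::euclidean_space \<Rightarrow> real"
  assumes f: "integrable lebesgue f"
    and g: "g locally_integrable_on S" "AE x in lebesgue. x \<in> S \<longrightarrow> \<bar>g x\<bar> \<le> M"
      "(\<lambda>x. indicator S x * g x) \<in> borel_measurable lebesgue"
    and e: "e \<in> Basis"
    and weak: "\<And>\<psi>. \<psi> \<in> test_functions S \<Longrightarrow>
      (LINT x|lebesgue. f x * frechet_derivative \<psi> (at x) e) = - (LINT x|lebesgue. g x * \<psi> x)"
    and h: "\<And>n. h n \<noteq> 0" "\<And>n. \<bar>h n\<bar> \<le> d" "h \<longlonglongrightarrow> 0"
    and S: "bounded S" and M: "M \<ge> 0"
    and k: "integrable lebesgue k" "\<And>x. x \<notin> shrink S d \<Longrightarrow> k x = 0"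
  shows "(\<lambda>n. LINT x|lebesgue. ((f (x + h n *\<^sub>R e) - f x) / h n) * k x) \<longlonglongrightarrow> (LINT x|lebesgue. g x * k x)"
proof -
  have d: "d \<ge> 0" using h(2)[of 0] by linarith
  define Q where "Q n x = (f (x + h n *\<^sub>R e) - f x) / h n" for n x
  \<comment> \<open>Outside S the values of g are arbitrary; the cut-off is measurable on the whole
    space and agrees with g wherever k does not vanish.\<close>
  define G where "G x = indicator S x * g x" for x
  have Gg: "g x * u x = G x * u x" if "\<And>x. x \<notin> shrink S d \<Longrightarrow> u x = 0" for x and u :: "'a \<Rightarrow> real"
    using that[of x] shrink_subset[OF d, of S] by (cases "x \<in> S") (auto simp: G_def)
  have Qm: "Q n \<in> borel_measurable lebesgue" for n
    unfolding Q_def[abs_def] using borel_measurable_integrable[OF integrable_lebesgue_translation[OF f]]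
    by (intro borel_measurable_divide borel_measurable_diff borel_measurable_integrable[OF f]) auto
  have Qb: "AE x in lebesgue. x \<in> shrink S d \<longrightarrow> \<bar>Q n x\<bar> \<le> M" for n
  proof -
    have "AE x in lebesgue. x \<in> shrink S d \<longrightarrow> \<bar>f (x + h n *\<^sub>R e) - f x\<bar> \<le> M * \<bar>h n\<bar>"
      by (rule weak_derivative_increment_bound[OF f g(1,2) e _ h(2)]) (rule weak)
    then show ?thesis
    proof eventually_elim
    case (elim x)
    then show ?case using h(1)[of n] by (auto simp: Q_def divide_simps)
  qed
  qed
  have Gb: "AE x in lebesgue. x \<in> shrink S d \<longrightarrow> \<bar>G x\<bar> \<le> M"
    using g(2) by eventually_elim (use M in \<open>auto simp: G_def indicator_def\<close>)
  have Gm: "G \<in> borel_measurable lebesgue" using g(3) by (simp add: G_def[abs_def])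
  have test: "(\<lambda>n. LINT x|lebesgue. Q n x * \<psi> x) \<longlonglongrightarrow> (LINT x|lebesgue. G x * \<psi> x)"
    if \<psi>: "\<psi> \<in> test_functions (shrink S d)" for \<psi>
  proof -
    have \<psi>S: "\<psi> \<in> test_functions S" using test_function_mono[OF shrink_subset[OF d] \<psi>] .
    have "(\<lambda>n. LINT x|lebesgue. Q n x * \<psi> x) \<longlonglongrightarrow> - (LINT x|lebesgue. f x * frechet_derivative \<psi> (at x) e)"
      unfolding Q_def by (rule integral_quotient_LIMSEQ[OF f \<psi> e h(1,3)])
    moreover have "- (LINT x|lebesgue. f x * frechet_derivative \<psi> (at x) e) = (LINT x|lebesgue. G x * \<psi> x)"
      using weak[OF \<psi>S] Gg[of \<psi>] test_function_eq_0[OF \<psi>] by simp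
    ultimately show ?thesis by simp
  qed
  have bs: "bounded (shrink S d)" using bounded_subset[OF S shrink_subset[OF d]] .
  have "(\<lambda>n. LINT x|lebesgue. Q n x * k x) \<longlonglongrightarrow> (LINT x|lebesgue. G x * k x)"
  proof (rule LIMSEQ_I)
    fix r :: real assume r: "r > 0"
    \<comment> \<open>Three errors of size at most r / 4 add up to less than r; M + 1 avoids
      dividing by 0 when M = 0.\<close>
    have "r / (4 * (M + 1)) > 0" using r M by simp
    then obtain \<psi> where \<psi>: "\<psi> \<in> test_functions (shrink S d)" "(LINT x|lebesgue. \<bar>k x - \<psi> x\<bar>) < r / (4 * (M + 1))"
      using test_functions_dense_L1[OF open_shrink bs k] by blast
    let ?k = "\<lambda>x. k x - \<psi> x"
    have ki: "integrable lebesgue ?k" using k(1) test_function_integrable[OF \<psi>(1)] by simp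
    have k0: "?k x = 0" if "x \<notin> shrink S d" for x using k(2)[OF that] test_function_eq_0[OF \<psi>(1) that] by simp
    have small: "integrable lebesgue (\<lambda>x. q x * k x)" "integrable lebesgue (\<lambda>x. q x * \<psi> x)"
       "\<bar>(LINT x|lebesgue. q x * k x) - (LINT x|lebesgue. q x * \<psi> x)\<bar> \<le> r / 4"
      if q: "q \<in> borel_measurable lebesgue" "AE x in lebesgue. x \<in> shrink S d \<longrightarrow> \<bar>q x\<bar> \<le> M" for q
    proof -
      show 1: "integrable lebesgue (\<lambda>x. q x * k x)"
        by (rule AE_bounded_mult_integrable(1)[OF k(1) q(1), of M])
          (rule eventually_mono[OF q(2)], use k(2) in auto)
      show 2: "integrable lebesgue (\<lambda>x. q x * \<psi> x)"
        by (rule AE_bounded_mult_integrable(1)[OF test_function_integrable[OF \<psi>(1)] q(1), of M])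
          (rule eventually_mono[OF q(2)], use test_function_eq_0[OF \<psi>(1)] in auto)
      have "\<bar>LINT x|lebesgue. q x * ?k x\<bar> \<le> M * (LINT x|lebesgue. \<bar>?k x\<bar>)"
        by (rule AE_bounded_mult_integrable(2)[OF ki q(1)])
          (rule eventually_mono[OF q(2)], use k0 in auto)
      also have "\<dots> \<le> (M + 1) * (r / (4 * (M + 1)))"
        using \<psi>(2) M by (intro mult_mono) auto
      also have "\<dots> = r / 4" using M by (simp add: divide_simps)
      finally show "\<bar>(LINT x|lebesgue. q x * k x) - (LINT x|lebesgue. q x * \<psi> x)\<bar> \<le> r / 4"
        using 1 2 by (simp add: right_diff_distrib)
    qed
    obtain N where N: "\<And>n. n \<ge> N \<Longrightarrow> norm ((LINT x|lebesgue. Q n x * \<psi> x) - (LINT x|lebesgue. G x * \<psi> x)) < r / 4"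
      using LIMSEQ_D[OF test[OF \<psi>(1)], of "r / 4"] r by auto
    have "norm ((LINT x|lebesgue. Q n x * k x) - (LINT x|lebesgue. G x * k x)) < r" if "n \<ge> N" for n
      using N[OF that] small(3)[OF Qm Qb, of n] small(3)[OF Gm Gb]
      unfolding real_norm_def by linarith
    then show "\<exists>N. \<forall>n\<ge>N. norm ((LINT x|lebesgue. Q n x * k x) - (LINT x|lebesgue. G x * k x)) < r" by blast
  qed
  moreover have "g x * k x = G x * k x" for x by (rule Gg) (rule k(2))
  ultimately show ?thesis by (simp only: Q_def)
qed

text \<open>The constant is the sum of the Lipschitz constants of the partial derivatives, which are
  test functions themselves.\<close>

lemma test_function_Taylor:
  fixes \<phi> :: "'a::euclidean_space \<Rightarrow> real"
  assumes "\<phi> \<in> test_functions S"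
  obtains C where "C > 0" "\<And>a b. \<bar>\<phi> b - \<phi> a - (\<Sum>i\<in>Basis. frechet_derivative \<phi> (at a) i * ((b - a) \<bullet> i))\<bar> \<le> C * (norm (b - a))\<^sup>2"
proof -
  have "\<exists>C>0. \<forall>x y. norm (frechet_derivative \<phi> (at x) i - frechet_derivative \<phi> (at y) i) \<le> C * norm (x - y)"
    if "i \<in> Basis" for i
    using test_function_Lipschitz[OF test_function_partial[OF assms that]] by metis
  then obtain L where L: "\<And>i. i \<in> Basis \<Longrightarrow> L i > 0"
    "\<And>i x y. i \<in> Basis \<Longrightarrow> norm (frechet_derivative \<phi> (at x) i - frechet_derivative \<phi> (at y) i) \<le> L i * norm (x - y)"
    by metis
  define C where "C = sum L Basis"
  have C: "C > 0" unfolding C_def using L(1) by (intro sum_pos) auto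
  have lin: "linear (frechet_derivative \<phi> (at x))" for x
    using assms test_function_differentiable linear_frechet_derivative by blast
  have ex: "frechet_derivative \<phi> (at x) h = (\<Sum>i\<in>Basis. frechet_derivative \<phi> (at x) i * (h \<bullet> i))" for x h
  proof -
    have "frechet_derivative \<phi> (at x) h = frechet_derivative \<phi> (at x) (\<Sum>i\<in>Basis. (h \<bullet> i) *\<^sub>R i)"
      by (simp only: euclidean_representation)
    also have "\<dots> = (\<Sum>i\<in>Basis. frechet_derivative \<phi> (at x) i * (h \<bullet> i))"
      by (simp only: linear_sum[OF lin] linear_scale[OF lin] real_scaleR_def mult.commute)
    finally show ?thesis .
  qed
  have "\<bar>\<phi> b - \<phi> a - frechet_derivative \<phi> (at a) (b - a)\<bar> \<le> C * (norm (b - a))\<^sup>2" for a b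
  proof -
    have "norm (\<phi> b - \<phi> a - frechet_derivative \<phi> (at a) (b - a)) \<le> norm (b - a) * (C * norm (b - a))"
    proof (rule differentiable_bound_linearization[where S = "cball a (norm (b - a))"])
      show "a + t *\<^sub>R (b - a) \<in> cball a (norm (b - a))" if "t \<in> {0..1}" for t
        using that by (auto simp: dist_norm mult_left_le_one_le)
      show "(\<phi> has_derivative frechet_derivative \<phi> (at x)) (at x within cball a (norm (b - a)))" for x
        using has_derivative_frechet[OF test_function_differentiable[OF assms]] has_derivative_at_withinI by blast
      fix x assume "x \<in> cball a (norm (b - a))"
      then have x: "norm (x - a) \<le> norm (b - a)" by (simp add: dist_norm norm_minus_commute)
      show "onorm (frechet_derivative \<phi> (at x) - frechet_derivative \<phi> (at a)) \<le> C * norm (b - a)"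
        unfolding fun_diff_def
      proof (rule onorm_bound)
        fix v :: 'a
        have "\<bar>frechet_derivative \<phi> (at x) v - frechet_derivative \<phi> (at a) v\<bar>
          = \<bar>\<Sum>i\<in>Basis. (frechet_derivative \<phi> (at x) i - frechet_derivative \<phi> (at a) i) * (v \<bullet> i)\<bar>"
          by (simp only: ex[of _ v] sum_subtractf[symmetric] left_diff_distrib)
        also have "\<dots> \<le> (\<Sum>i\<in>Basis. (L i * norm (b - a)) * norm v)"
        proof (rule order_trans[OF sum_abs sum_mono])
          fix i :: 'a assume i: "i \<in> Basis"
          have "\<bar>frechet_derivative \<phi> (at x) i - frechet_derivative \<phi> (at a) i\<bar> \<le> L i * norm (x - a)"
            using L(2)[OF i, of x a] by simp
          also have "\<dots> \<le> L i * norm (b - a)"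
            using L(1)[OF i] x by (intro mult_left_mono) auto
          finally show "\<bar>(frechet_derivative \<phi> (at x) i - frechet_derivative \<phi> (at a) i) * (v \<bullet> i)\<bar> \<le> (L i * norm (b - a)) * norm v"
            unfolding abs_mult using L(1)[OF i] i by (intro mult_mono Basis_le_norm) auto
        qed
        also have "\<dots> = C * norm (b - a) * norm v" by (simp add: C_def sum_distrib_right)
        finally show "norm (frechet_derivative \<phi> (at x) v - frechet_derivative \<phi> (at a) v) \<le> C * norm (b - a) * norm v"
          by simp
      qed (use C in simp)
    qed auto
    then show ?thesis by (simp add: power2_eq_square algebra_simps)
  qed
  then have "\<bar>\<phi> b - \<phi> a - (\<Sum>i\<in>Basis. frechet_derivative \<phi> (at a) i * ((b - a) \<bullet> i))\<bar> \<le> C * (norm (b - a))\<^sup>2" for a b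
    by (metis ex)
  then show thesis using that[OF C] by blast
qed

section \<open>The chain rule for a bounded map with bounded weak gradient\<close>

lemma sum_Basis_vec: "(\<Sum>b\<in>Basis. F b) = (\<Sum>k\<in>UNIV. F (axis (k::'n::finite) (1::real)))"
proof -
  have B: "Basis = (\<lambda>k::'n. axis k (1::real)) ` UNIV" by (auto simp: Basis_vec_def)
  have I: "inj (\<lambda>k::'n. axis k (1::real))" by (auto simp: inj_on_def axis_eq_axis)
  show ?thesis unfolding B sum.reindex[OF I] by simp
qed

lemma axis_Basis: "axis j (1::real) \<in> Basis"
  by (auto simp: Basis_vec_def)

lemma integrable_if_bounded:
  fixes u :: "'a::euclidean_space \<Rightarrow> real"
  assumes "open S" "bounded S" "u \<in> borel_measurable (lebesgue_on S)"
    and b: "AE x in lebesgue. x \<in> S \<longrightarrow> \<bar>u x\<bar> \<le> C"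
  shows "integrable lebesgue (\<lambda>x. if x \<in> S then u x else 0)"
proof -
  have S: "S \<in> sets lebesgue" using assms(1) by auto
  then have "S \<in> lmeasurable" using bounded_set_imp_lmeasurable[OF assms(2)] by blast
  then have "emeasure lebesgue S < \<infinity>" by (simp add: fmeasurable_def del: emeasure_completion)
  then show ?thesis
  proof (rule integrableI_bounded_set[OF S borel_measurable_if_I[OF assms(3) S]])
    show "AE x in lebesgue. x \<in> S \<longrightarrow> norm (if x \<in> S then u x else 0) \<le> C"
      using b by eventually_elim auto
  qed auto
qed

lemma locally_integrable_onI_bounded:
  fixes u :: "'a::euclidean_space \<Rightarrow> real"
  assumes "integrable lebesgue (\<lambda>x. if x \<in> S then u x else 0)"
  shows "u locally_integrable_on S"
  unfolding locally_integrable_on_def set_integrable_def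
proof (intro allI impI)
  fix K assume K: "compact K \<and> K \<subseteq> S"
  then have "integrable lebesgue (\<lambda>x. indicator K x *\<^sub>R (if x \<in> S then u x else 0))"
    using assms by (intro integrable_mult_indicator) (auto simp: compact_imp_closed)
  moreover have "indicator K x *\<^sub>R (if x \<in> S then u x else 0) = indicator K x *\<^sub>R u x" for x
    using K by (auto simp: indicator_def)
  ultimately show "integrable lebesgue (\<lambda>x. indicator K x *\<^sub>R u x)" by (simp only:)
qed

text \<open>Expanding \<phi> around \<open>X x\<close>, the quotient of the composite is the sum of
  \<open>D k (X x)\<close> times the quotients of the components of X, up to an error of order h,
  because the increments of X are of order h almost everywhere. After pairing with \<psi>, the left
  side converges by shifting the increment to \<psi>, the right side by the weak convergence of the
  quotients.\<close>

lemma weak_chain_rule: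
  fixes X :: "real^'d \<Rightarrow> real^'d" and G :: "real^'d \<Rightarrow> real^'d^'d" and \<phi> \<psi> :: "real^'d \<Rightarrow> real"
  assumes B: "open B" "bounded B"
    and X: "X \<in> borel_measurable (lebesgue_on B)" "AE x in lebesgue. x \<in> B \<longrightarrow> norm (X x) \<le> R"
    and G: "G \<in> borel_measurable (lebesgue_on B)" "AE x in lebesgue. x \<in> B \<longrightarrow> norm (G x) \<le> M"
    and weak: "\<And>\<psi> k. \<psi> \<in> test_functions B \<Longrightarrow>
      (LINT x|lebesgue_on B. X x $ k * frechet_derivative \<psi> (at x) (axis j 1)) =
        - (LINT x|lebesgue_on B. G x $ k $ j * \<psi> x)"
    and \<phi>: "\<phi> \<in> test_functions T" and \<psi>: "\<psi> \<in> test_functions B"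
  shows "(LINT x|lebesgue_on B. \<phi> (X x) * frechet_derivative \<psi> (at x) (axis j 1)) =
    - (LINT x|lebesgue_on B. (\<Sum>k\<in>UNIV. frechet_derivative \<phi> (at (X x)) (axis k 1) * G x $ k $ j) * \<psi> x)"
proof -
  define e :: "real^'d" where "e = axis j 1"
  have e: "e \<in> Basis" by (simp add: e_def axis_Basis)
  have Bs: "B \<in> sets lebesgue" using B by auto
  \<comment> \<open>A negative M is compatible with the hypotheses when B is empty, hence the
    truncation at 0.\<close>
  define M' where "M' = max M 0"
  have M': "M' \<ge> 0" by (simp add: M'_def)
  define D where "D k x = frechet_derivative \<phi> (at x) (axis k 1)" for k :: 'd and x
  define f where "f k x = (if x \<in> B then X x $ k else 0)" for k :: 'd and x
  define g where "g k x = G x $ k $ j" for k x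
  define \<Phi> where "\<Phi> x = (if x \<in> B then \<phi> (X x) else 0)" for x
  have Dt: "D k \<in> test_functions T" for k
    unfolding D_def[abs_def] by (rule test_function_partial[OF \<phi> axis_Basis])
  have comp: "(\<lambda>x. u (X x)) \<in> borel_measurable (lebesgue_on B)" if "u \<in> test_functions T" for u :: "real^'d \<Rightarrow> real"
    by (rule borel_measurable_continuous_on[OF test_function_continuous[OF that] X(1)])
  have fi: "integrable lebesgue (f k)" for k
    unfolding f_def[abs_def]
  proof (rule integrable_if_bounded[OF B])
    show "(\<lambda>x. X x $ k) \<in> borel_measurable (lebesgue_on B)"
      by (rule borel_measurable_continuous_on[OF _ X(1)]) (intro continuous_intros)
    show "AE x in lebesgue. x \<in> B \<longrightarrow> \<bar>X x $ k\<bar> \<le> R"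
      using X(2) by eventually_elim (use component_le_norm_cart order_trans in blast)
  qed
  have gm: "g k \<in> borel_measurable (lebesgue_on B)" for k
    unfolding g_def[abs_def] by (rule borel_measurable_continuous_on[OF _ G(1)]) (intro continuous_intros)
  have gb: "AE x in lebesgue. x \<in> B \<longrightarrow> \<bar>g k x\<bar> \<le> M'" for k
    using G(2)
  proof eventually_elim
    case (elim x)
    have "\<bar>g k x\<bar> \<le> norm (G x)"
      unfolding g_def by (meson component_le_norm_cart order_trans Finite_Cartesian_Product.norm_nth_le)
    then show ?case using elim by (auto simp: M'_def)
  qed
  have gi: "integrable lebesgue (\<lambda>x. if x \<in> B then g k x else 0)" for k
    by (rule integrable_if_bounded[OF B gm gb])
  have gl: "g k locally_integrable_on B" for k by (rule locally_integrable_onI_bounded[OF gi])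
  have gI: "(\<lambda>x. indicator B x * g k x) \<in> borel_measurable lebesgue" for k
  proof -
    have "(\<lambda>x. indicator B x * g k x) = (\<lambda>x. if x \<in> B then g k x else 0)" by (auto simp: indicator_def)
    then show ?thesis using borel_measurable_integrable[OF gi[of k]] by simp
  qed
  have on_B: "(LINT x|lebesgue_on B. q x * \<theta> x) = (LINT x|lebesgue. (if x \<in> B then q x else 0) * \<theta> x)"
    "(LINT x|lebesgue_on B. q x * \<theta> x) = (LINT x|lebesgue. q x * \<theta> x)"
    if \<theta>: "\<theta> \<in> test_functions B" for q \<theta> :: "real^'d \<Rightarrow> real"
  proof -
    have z: "\<theta> x = 0" if "x \<notin> B" for x using test_function_eq_0[OF \<theta> that] .
    have "(\<lambda>x. if x \<in> B then q x * \<theta> x else 0) = (\<lambda>x. (if x \<in> B then q x else 0) * \<theta> x)"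
      "(\<lambda>x. if x \<in> B then q x * \<theta> x else 0) = (\<lambda>x. q x * \<theta> x)"
      using z by auto
    then show "(LINT x|lebesgue_on B. q x * \<theta> x) = (LINT x|lebesgue. (if x \<in> B then q x else 0) * \<theta> x)"
      "(LINT x|lebesgue_on B. q x * \<theta> x) = (LINT x|lebesgue. q x * \<theta> x)"
      using Lebesgue_Measure.integral_restrict_UNIV[OF Bs, of "\<lambda>x. q x * \<theta> x"] by simp_all
  qed
  have fw: "(LINT x|lebesgue. f k x * frechet_derivative \<theta> (at x) e) = - (LINT x|lebesgue. g k x * \<theta> x)"
    if \<theta>: "\<theta> \<in> test_functions B" for \<theta> k
    using weak[OF \<theta>, of k] on_B(1)[OF test_function_partial[OF \<theta> e], of "\<lambda>x. X x $ k"]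
      on_B(2)[OF \<theta>, of "g k"] by (simp add: f_def g_def e_def)
  obtain CP where CP: "\<And>x. norm (\<phi> x) \<le> CP" using test_function_bounded[OF \<phi>] by blast
  have \<Phi>i: "integrable lebesgue \<Phi>"
    unfolding \<Phi>_def[abs_def] by (rule integrable_if_bounded[OF B comp[OF \<phi>], where C = CP]) (use CP in auto)
  \<comment> \<open>The part of each term that does not depend on the step; it serves as the fixed
    integrable weight in the weak limit of the quotients.\<close>
  define kk where "kk k x = (if x \<in> B then D k (X x) else 0) * \<psi> x" for k x
  have kki: "integrable lebesgue (kk k)" for k
  proof -
    obtain C where C: "\<And>x. norm (D k x) \<le> C" using test_function_bounded[OF Dt] by blast
    have "integrable lebesgue (\<lambda>x. if x \<in> B then D k (X x) else 0)"
      by (rule integrable_if_bounded[OF B comp[OF Dt], where C = C]) (use C in auto)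
    then show ?thesis unfolding kk_def[abs_def] by (rule integrable_mult_test[OF _ \<psi>])
  qed
  obtain d where d: "d > 0" "closure {x. \<psi> x \<noteq> 0} \<subseteq> shrink B d"
    using compact_subset_shrink[OF test_function_compact[OF \<psi>] test_function_support[OF \<psi>] B] by blast
  have \<psi>0: "\<psi> x = 0" if "x \<notin> shrink B d" for x
    using that d(2) eq_0_outside_support[of x \<psi>] by blast
  \<comment> \<open>The steps never exceed d, so translates of points of \<open>shrink B d\<close>
    remain in B.\<close>
  define h where "h n = d / real (Suc n)" for n
  have h: "h n \<noteq> 0" "\<bar>h n\<bar> \<le> d" for n
    using d by (auto simp: h_def field_simps)
  have h0: "h \<longlonglongrightarrow> 0"
    using tendsto_mult_left[OF LIMSEQ_inverse_real_of_nat, of d] by (simp add: h_def[abs_def] divide_inverse)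
  have lim_k: "(\<lambda>n. LINT x|lebesgue. ((f k (x + h n *\<^sub>R e) - f k x) / h n) * kk k x) \<longlonglongrightarrow> (LINT x|lebesgue. g k x * kk k x)" for k
    by (rule weak_derivative_quotient_LIMSEQ[OF fi gl gb gI e _ h h0 B(2) M' kki])
      (simp_all add: fw kk_def \<psi>0)
  have lim_\<Phi>: "(\<lambda>n. LINT x|lebesgue. ((\<Phi> (x + h n *\<^sub>R e) - \<Phi> x) / h n) * \<psi> x)
      \<longlonglongrightarrow> - (LINT x|lebesgue. \<Phi> x * frechet_derivative \<psi> (at x) e)"
    by (rule integral_quotient_LIMSEQ[OF \<Phi>i \<psi> e h(1) h0])
  obtain C where C: "C > 0" "\<And>a b. \<bar>\<phi> b - \<phi> a - (\<Sum>i\<in>Basis. frechet_derivative \<phi> (at a) i * ((b - a) \<bullet> i))\<bar> \<le> C * (norm (b - a))\<^sup>2"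
    using test_function_Taylor[OF \<phi>] by blast
  define r where "r n x = ((\<Phi> (x + h n *\<^sub>R e) - \<Phi> x) / h n) * \<psi> x
      - (\<Sum>k\<in>UNIV. ((f k (x + h n *\<^sub>R e) - f k x) / h n) * kk k x)" for n x
  \<comment> \<open>Every component of the increment of X is at most
    \<open>M' * \<bar>h n\<bar>\<close>, so its norm is at most \<open>CARD('d)\<close> times that.
    Squaring and multiplying by the Taylor constant gives W times the squared step, of which one
    factor is lost in the quotient.\<close>
  define W where "W = C * (real CARD('d) * M')\<^sup>2"
  have W: "W \<ge> 0" using C by (simp add: W_def)
  have incr: "AE x in lebesgue. \<forall>k. x \<in> shrink B d \<longrightarrow> \<bar>f k (x + h n *\<^sub>R e) - f k x\<bar> \<le> M' * \<bar>h n\<bar>" for n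
  proof -
    have "AE x in lebesgue. x \<in> shrink B d \<longrightarrow> \<bar>f k (x + h n *\<^sub>R e) - f k x\<bar> \<le> M' * \<bar>h n\<bar>" for k
      by (rule weak_derivative_increment_bound[OF fi gl gb e _ h(2)]) (rule fw)
    then have "AE x in lebesgue. \<forall>k\<in>UNIV. x \<in> shrink B d \<longrightarrow> \<bar>f k (x + h n *\<^sub>R e) - f k x\<bar> \<le> M' * \<bar>h n\<bar>"
      by (intro AE_finite_allI) auto
    then show ?thesis by (rule eventually_mono) blast
  qed
  have rb: "AE x in lebesgue. norm (r n x) \<le> W * \<bar>h n\<bar> * \<bar>\<psi> x\<bar>" for n
    using incr[of n]
  proof eventually_elim
    case (elim x)
    show ?case
    proof (cases "x \<in> shrink B d")
      case False
      then show ?thesis using \<psi>0 by (simp add: r_def kk_def)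
    next
      case True
      have xB: "x \<in> B" "x + h n *\<^sub>R e \<in> B"
        using True shrink_add[OF True, of 0] shrink_add[OF True, of "h n *\<^sub>R e"] d h(2)[of n] e by auto
      define a where "a = X x"
      define b where "b = X (x + h n *\<^sub>R e)"
      have ba: "\<bar>(b - a) $ k\<bar> \<le> M' * \<bar>h n\<bar>" for k
        using elim True xB by (auto simp: a_def b_def f_def)
      have "norm (b - a) \<le> (\<Sum>k\<in>UNIV. \<bar>(b - a) $ k\<bar>)" by (rule norm_le_l1_cart)
      also have "\<dots> \<le> (\<Sum>k\<in>(UNIV::'d set). M' * \<bar>h n\<bar>)" by (intro sum_mono ba)
      also have "\<dots> = real CARD('d) * M' * \<bar>h n\<bar>" by simp
      finally have nb: "(norm (b - a))\<^sup>2 \<le> (real CARD('d) * M' * \<bar>h n\<bar>)\<^sup>2" by (intro power_mono) auto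
      have "\<bar>\<phi> b - \<phi> a - (\<Sum>k\<in>UNIV. D k a * (b - a) $ k)\<bar> \<le> C * (norm (b - a))\<^sup>2"
        using C(2)[of b a] unfolding sum_Basis_vec D_def by (simp add: inner_axis)
      also have "\<dots> \<le> C * (real CARD('d) * M' * \<bar>h n\<bar>)\<^sup>2" using nb C(1) by (intro mult_left_mono) auto
      also have "\<dots> = W * \<bar>h n\<bar> * \<bar>h n\<bar>" by (simp add: W_def power_mult_distrib power2_eq_square)
      finally have T: "\<bar>\<phi> b - \<phi> a - (\<Sum>k\<in>UNIV. D k a * (b - a) $ k)\<bar> \<le> W * \<bar>h n\<bar> * \<bar>h n\<bar>" .
      have "r n x = (\<phi> b - \<phi> a - (\<Sum>k\<in>UNIV. D k a * (b - a) $ k)) / h n * \<psi> x"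
      proof -
        have "(\<Sum>k\<in>UNIV. ((f k (x + h n *\<^sub>R e) - f k x) / h n) * kk k x)
          = (\<Sum>k\<in>UNIV. D k a * (b - a) $ k) / h n * \<psi> x"
          unfolding sum_divide_distrib sum_distrib_right
          using xB by (intro sum.cong) (simp_all add: f_def kk_def a_def b_def)
        then show ?thesis using xB
          by (simp add: r_def \<Phi>_def a_def b_def diff_divide_distrib left_diff_distrib)
      qed
      also have "norm \<dots> \<le> W * \<bar>h n\<bar> * \<bar>\<psi> x\<bar>"
        unfolding real_norm_def abs_mult abs_divide
        using T h(1)[of n] by (intro mult_right_mono) (simp_all add: divide_simps)
      finally show ?thesis .
    qed
  qed
  have qi: "integrable lebesgue (\<lambda>x. ((f k (x + h n *\<^sub>R e) - f k x) / h n) * kk k x)" for n k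
  proof (rule AE_bounded_mult_integrable(1)[OF kki, where M = M'])
    show "(\<lambda>x. (f k (x + h n *\<^sub>R e) - f k x) / h n) \<in> borel_measurable lebesgue"
      using borel_measurable_integrable[OF integrable_lebesgue_translation[OF fi]]
      by (intro borel_measurable_divide borel_measurable_diff borel_measurable_integrable[OF fi]) auto
    show "AE x in lebesgue. kk k x \<noteq> 0 \<longrightarrow> \<bar>(f k (x + h n *\<^sub>R e) - f k x) / h n\<bar> \<le> M'"
      using incr[of n]
    proof eventually_elim
      case (elim x)
      then show ?case using \<psi>0[of x] h(1)[of n] by (auto simp: kk_def divide_simps)
    qed
  qed
  have \<Phi>qi: "integrable lebesgue (\<lambda>x. ((\<Phi> (x + h n *\<^sub>R e) - \<Phi> x) / h n) * \<psi> x)" for n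
    using translate_swap(2)[OF \<Phi>i \<psi>, of "h n *\<^sub>R e"] integrable_mult_test[OF \<Phi>i \<psi>]
    by (simp add: left_diff_distrib diff_divide_distrib)
  have ri: "integrable lebesgue (r n)" for n
    unfolding r_def[abs_def] using qi \<Phi>qi by (intro Bochner_Integration.integrable_diff Bochner_Integration.integrable_sum)
  have "(\<lambda>n. LINT x|lebesgue. r n x) \<longlonglongrightarrow> 0"
  proof (rule Lim_null_comparison)
    have "norm (LINT x|lebesgue. r n x) \<le> W * \<bar>h n\<bar> * (LINT x|lebesgue. \<bar>\<psi> x\<bar>)" for n
    proof -
      have "norm (LINT x|lebesgue. r n x) \<le> (LINT x|lebesgue. norm (r n x))" by (rule integral_norm_bound)
      also have "\<dots> \<le> (LINT x|lebesgue. W * \<bar>h n\<bar> * \<bar>\<psi> x\<bar>)"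
        using ri rb test_function_integrable[OF \<psi>] by (intro integral_mono_AE) auto
      finally show ?thesis by simp
    qed
    then show "\<forall>\<^sub>F n in sequentially. norm (LINT x|lebesgue. r n x) \<le> W * \<bar>h n\<bar> * (LINT x|lebesgue. \<bar>\<psi> x\<bar>)" by simp
    have "(\<lambda>n. W * \<bar>h n\<bar> * (LINT x|lebesgue. \<bar>\<psi> x\<bar>)) \<longlonglongrightarrow> W * \<bar>0\<bar> * (LINT x|lebesgue. \<bar>\<psi> x\<bar>)"
      by (intro tendsto_intros h0)
    then show "(\<lambda>n. W * \<bar>h n\<bar> * (LINT x|lebesgue. \<bar>\<psi> x\<bar>)) \<longlonglongrightarrow> 0" by simp
  qed
  moreover have "(LINT x|lebesgue. r n x) = (LINT x|lebesgue. ((\<Phi> (x + h n *\<^sub>R e) - \<Phi> x) / h n) * \<psi> x)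
      - (\<Sum>k\<in>UNIV. LINT x|lebesgue. ((f k (x + h n *\<^sub>R e) - f k x) / h n) * kk k x)" for n
    unfolding r_def using qi \<Phi>qi
    by (subst Bochner_Integration.integral_diff) (auto intro!: Bochner_Integration.integrable_sum Bochner_Integration.integral_sum)
  moreover have "(\<lambda>n. (LINT x|lebesgue. ((\<Phi> (x + h n *\<^sub>R e) - \<Phi> x) / h n) * \<psi> x)
      - (\<Sum>k\<in>UNIV. LINT x|lebesgue. ((f k (x + h n *\<^sub>R e) - f k x) / h n) * kk k x))
      \<longlonglongrightarrow> - (LINT x|lebesgue. \<Phi> x * frechet_derivative \<psi> (at x) e) - (\<Sum>k\<in>UNIV. LINT x|lebesgue. g k x * kk k x)"
    by (intro tendsto_diff lim_\<Phi> tendsto_sum lim_k)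
  ultimately have eq: "- (LINT x|lebesgue. \<Phi> x * frechet_derivative \<psi> (at x) e) = (\<Sum>k\<in>UNIV. LINT x|lebesgue. g k x * kk k x)"
    using LIMSEQ_unique by fastforce
  have gki: "integrable lebesgue (\<lambda>x. g k x * kk k x)" for k
  proof -
    have "integrable lebesgue (\<lambda>x. (indicator B x * g k x) * kk k x)"
    proof (rule AE_bounded_mult_integrable(1)[OF kki gI, where M = M'])
      show "AE x in lebesgue. kk k x \<noteq> 0 \<longrightarrow> \<bar>indicator B x * g k x\<bar> \<le> M'"
        using gb[of k] by eventually_elim (use M' in \<open>auto simp: indicator_def\<close>)
    qed
    moreover have "(indicator B x * g k x) * kk k x = g k x * kk k x" for x
      by (auto simp: kk_def indicator_def)
    ultimately show ?thesis by (simp only:)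
  qed
  have "(LINT x|lebesgue_on B. (\<Sum>k\<in>UNIV. D k (X x) * G x $ k $ j) * \<psi> x)
     = (LINT x|lebesgue. (if x \<in> B then (\<Sum>k\<in>UNIV. D k (X x) * G x $ k $ j) else 0) * \<psi> x)"
    by (rule on_B(1)[OF \<psi>])
  also have "\<dots> = (LINT x|lebesgue. (\<Sum>k\<in>UNIV. g k x * kk k x))"
    by (intro Bochner_Integration.integral_cong) (auto simp: kk_def g_def sum_distrib_left mult_ac)
  also have "\<dots> = (\<Sum>k\<in>UNIV. LINT x|lebesgue. g k x * kk k x)"
    by (rule Bochner_Integration.integral_sum) (rule gki)
  finally show ?thesis
    using eq on_B(1)[OF test_function_partial[OF \<psi> e], of "\<lambda>x. \<phi> (X x)"]
    by (simp add: \<Phi>_def D_def e_def)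
qed

section \<open>Composition with a map that does not contract distances\<close>

text \<open>The Lipschitz condition on the inverse, stated for X itself so that it applies directly
  to points of B.\<close>

locale expanding_map =
  fixes B :: "'a::euclidean_space set" and X :: "'a \<Rightarrow> 'a" and L :: real
  assumes open_B: "open B" and X_borel: "X \<in> borel_measurable (lebesgue_on B)" and L: "L > 0"
    and expand: "\<And>x y. x \<in> B \<Longrightarrow> y \<in> B \<Longrightarrow> dist x y \<le> L * dist (X x) (X y)"
begin

definition preimg :: "'a set \<Rightarrow> 'a set" where "preimg E = {x \<in> B. X x \<in> E}"

lemma B_sets: "B \<in> sets lebesgue" using open_B by auto

lemma preimg_borel: "E \<in> sets borel \<Longrightarrow> preimg E \<in> sets lebesgue"
proof -
  assume "E \<in> sets borel"
  then have "X -` E \<inter> B \<in> sets (lebesgue_on B)"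
    using measurable_sets[OF X_borel] by simp
  moreover have "X -` E \<inter> B = preimg E" by (auto simp: preimg_def)
  ultimately show ?thesis using B_sets by (simp add: sets_restrict_space_iff)
qed

text \<open>The preimage is the image of a null set under the Lipschitz inverse. This reaches null
  sets that are not Borel, which the measurability of X leaves open.\<close>

lemma preimg_null:
  assumes "N \<in> null_sets lebesgue"
  shows "preimg N \<in> null_sets lebesgue"
proof -
  define g where "g = inv_into B X"
  have inj: "inj_on X B"
  proof (rule inj_onI)
    fix x y assume "x \<in> B" "y \<in> B" "X x = X y"
    then show "x = y" using expand[of x y] by simp
  qed
  have "negligible (g ` (N \<inter> X ` B))"
  proof (rule negligible_locally_Lipschitz_image)
    show "negligible (N \<inter> X ` B)"
      using assms negligible_subset[of N "N \<inter> X ` B"] by (simp add: negligible_iff_null_sets)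
    fix x assume x: "x \<in> N \<inter> X ` B"
    have "norm (g y - g x) \<le> L * norm (y - x)" if yN: "y \<in> N \<inter> X ` B" for y
    proof -
      obtain a where "x = X a" "a \<in> B" using x by blast
      moreover obtain b where "y = X b" "b \<in> B" using yN by blast
      ultimately show ?thesis using expand[of b a] inj by (simp add: g_def dist_norm)
    qed
    then show "\<exists>T M. open T \<and> x \<in> T \<and> (\<forall>y\<in>N \<inter> X ` B \<inter> T. norm (g y - g x) \<le> M * norm (y - x))"
      by (intro exI[of _ UNIV] exI[of _ L]) auto
  qed simp
  moreover have "preimg N \<subseteq> g ` (N \<inter> X ` B)"
  proof
    fix x assume "x \<in> preimg N"
    then have "x = g (X x)" "X x \<in> N \<inter> X ` B" using inj by (auto simp: preimg_def g_def)
    then show "x \<in> g ` (N \<inter> X ` B)" by blast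
  qed
  ultimately show ?thesis using negligible_subset negligible_iff_null_sets by blast
qed

lemma preimg_sets:
  assumes "E \<in> sets lebesgue"
  shows "preimg E \<in> sets lebesgue"
  using assms
proof (rule sets_completionE)
  fix S N N' assume *: "E = S \<union> N" "N \<subseteq> N'" "N' \<in> null_sets lborel" "S \<in> sets lborel"
  have "preimg N' \<in> null_sets lebesgue" using * by (intro preimg_null null_sets_completionI)
  moreover have "preimg N \<subseteq> preimg N'" using * by (auto simp: preimg_def)
  ultimately have "preimg N \<in> sets lebesgue" by (metis null_sets_completion_subset null_setsD2)
  moreover have "preimg E = preimg S \<union> preimg N" using * by (auto simp: preimg_def)
  ultimately show ?thesis using preimg_borel[of S] * by auto
qed

text \<open>Two image points in \<open>ball c r\<close> are less than 2 r apart, so a nonempty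
  preimage lies in the ball of radius 2 L r around any of its points. The centre c itself may fail
  to be an image point, whence 2 L in place of L.\<close>

lemma emeasure_preimg_ball:
  "emeasure lebesgue (preimg (ball c r)) \<le> ennreal ((2 * L) ^ DIM('a)) * emeasure lebesgue (ball c r)"
proof (cases "preimg (ball c r) = {}")
  case False
  then obtain y where y: "y \<in> B" "X y \<in> ball c r" by (auto simp: preimg_def)
  then have r: "r > 0" by (metis ball_eq_empty empty_iff not_le)
  have "preimg (ball c r) \<subseteq> ball y (2 * L * r)"
  proof
    fix x assume x: "x \<in> preimg (ball c r)"
    then have "dist (X y) (X x) < 2 * r"
      using y dist_triangle[of "X y" "X x" c] by (auto simp: preimg_def dist_commute)
    then have "L * dist (X y) (X x) < L * (2 * r)" using L by simp
    moreover have "dist y x \<le> L * dist (X y) (X x)" using x y expand by (auto simp: preimg_def)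
    ultimately show "x \<in> ball y (2 * L * r)" by (simp add: algebra_simps)
  qed
  then have "emeasure lebesgue (preimg (ball c r)) \<le> emeasure lebesgue (ball y (2 * L * r))"
    by (rule emeasure_mono) auto
  also have "\<dots> = ennreal ((2 * L) ^ DIM('a)) * emeasure lebesgue (ball c r)"
    using r L by (simp add: emeasure_ball ennreal_mult[symmetric] power_mult_distrib mult_ac)
  finally show ?thesis .
qed simp

text \<open>An arbitrary cover by balls would count overlaps. The Vitali balls are disjoint and
  exhaust E up to a null set, so the estimate for single balls can be summed.\<close>

lemma emeasure_preimg_open:
  assumes "open E"
  shows "emeasure lebesgue (preimg E) \<le> ennreal ((2 * L) ^ DIM('a)) * emeasure lebesgue E"
proof -
  define K where "K = {(c, r) |c r. r > 0 \<and> ball c r \<subseteq> E}"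
  have 1: "\<exists>i. i \<in> K \<and> x \<in> ball (fst i) (snd i) \<and> snd i < d" if "x \<in> E" "d > 0" for x d
  proof -
    obtain e where e: "e > 0" "ball x e \<subseteq> E" using openE[OF assms \<open>x \<in> E\<close>] by blast
    define \<rho> where "\<rho> = min e (d / 2)"
    have \<rho>: "\<rho> > 0" "\<rho> < d" "ball x \<rho> \<subseteq> E" using e that by (auto simp: \<rho>_def)
    then have "(x, \<rho>) \<in> K" unfolding K_def by blast
    then show ?thesis using \<rho> by (intro exI[of _ "(x, \<rho>)"]) simp
  qed
  obtain C where C: "countable C" "C \<subseteq> K"
     "pairwise (\<lambda>i j. disjnt (ball (fst i) (snd i)) (ball (fst j) (snd j))) C"
     "negligible (E - (\<Union>i \<in> C. ball (fst i) (snd i)))"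
    by (rule Vitali_covering_theorem_balls[of E K fst snd, OF 1])
  let ?b = "\<lambda>i. ball (fst i) (snd i)"
  let ?N = "E - (\<Union>i \<in> C. ?b i)"
  have dis: "disjoint_family_on ?b C"
    using C(3) by (auto simp: disjoint_family_on_def pairwise_def disjnt_def)
  then have dis': "disjoint_family_on (\<lambda>i. preimg (?b i)) C"
    unfolding disjoint_family_on_def preimg_def by blast
  \<comment> \<open>The part of E that the balls miss is null, and so is its preimage.\<close>
  have N: "preimg ?N \<in> null_sets lebesgue" using C(4) by (intro preimg_null) (simp add: negligible_iff_null_sets)
  have sb: "preimg (?b i) \<in> sets lebesgue" for i by (intro preimg_borel) auto
  have U: "(\<Union>i\<in>C. preimg (?b i)) \<in> sets lebesgue" using C(1) sb by (intro sets.countable_UN') auto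
  have "preimg E \<subseteq> (\<Union>i\<in>C. preimg (?b i)) \<union> preimg ?N" by (auto simp: preimg_def)
  then have "emeasure lebesgue (preimg E) \<le> emeasure lebesgue ((\<Union>i\<in>C. preimg (?b i)) \<union> preimg ?N)"
    using U N by (intro emeasure_mono) auto
  also have "\<dots> = emeasure lebesgue (\<Union>i\<in>C. preimg (?b i))"
    by (rule emeasure_Un_null_set[OF U N])
  also have "\<dots> = (\<integral>\<^sup>+i. emeasure lebesgue (preimg (?b i)) \<partial>count_space C)"
    by (rule emeasure_UN_countable[OF sb C(1) dis'])
  also have "\<dots> \<le> (\<integral>\<^sup>+i. ennreal ((2 * L) ^ DIM('a)) * emeasure lebesgue (?b i) \<partial>count_space C)"
    by (intro nn_integral_mono emeasure_preimg_ball)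
  also have "\<dots> = ennreal ((2 * L) ^ DIM('a)) * (\<integral>\<^sup>+i. emeasure lebesgue (?b i) \<partial>count_space C)"
    by (rule nn_integral_cmult) simp
  also have "(\<integral>\<^sup>+i. emeasure lebesgue (?b i) \<partial>count_space C) = emeasure lebesgue (\<Union>i\<in>C. ?b i)"
    by (rule emeasure_UN_countable[OF _ C(1) dis, symmetric]) auto
  also have "ennreal ((2 * L) ^ DIM('a)) * \<dots> \<le> ennreal ((2 * L) ^ DIM('a)) * emeasure lebesgue E"
  proof (intro mult_left_mono emeasure_mono UN_least)
    show "?b i \<subseteq> E" if "i \<in> C" for i using subsetD[OF C(2) that] by (auto simp: K_def)
  qed (use assms in auto)
  finally show ?thesis .
qed

text \<open>Outer regularity reduces this to open sets: an excess of measure e / c costs at most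
  e.\<close>

lemma emeasure_preimg:
  assumes "E \<in> sets lebesgue"
  shows "emeasure lebesgue (preimg E) \<le> ennreal ((2 * L) ^ DIM('a)) * emeasure lebesgue E"
proof (rule ennreal_le_epsilon)
  fix e :: real assume e: "0 < e"
  define c where "c = (2 * L) ^ DIM('a)"
  have c: "c > 0" using L by (simp add: c_def)
  obtain U where U: "open U" "E \<subseteq> U" "U - E \<in> lmeasurable" "emeasure lebesgue (U - E) < ennreal (e / c)"
    using sets_lebesgue_outer_open[OF assms, of "e / c"] e c by auto
  have "emeasure lebesgue (preimg E) \<le> emeasure lebesgue (preimg U)"
    using U(1,2) by (intro emeasure_mono preimg_borel) (auto simp: preimg_def)
  also have "\<dots> \<le> ennreal c * emeasure lebesgue U" unfolding c_def by (rule emeasure_preimg_open[OF U(1)])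
  also have "emeasure lebesgue U = emeasure lebesgue E + emeasure lebesgue (U - E)"
  proof -
    have "E \<union> (U - E) = U" using U(2) by blast
    then show ?thesis using plus_emeasure[OF assms fmeasurableD[OF U(3)]] by (simp del: emeasure_completion)
  qed
  also have "ennreal c * \<dots> \<le> ennreal c * (emeasure lebesgue E + ennreal (e / c))"
    using U(4) by (intro mult_left_mono add_left_mono) (auto simp del: emeasure_completion)
  also have "\<dots> = ennreal c * emeasure lebesgue E + ennreal e"
    using c e by (simp add: distrib_left ennreal_mult[symmetric] del: emeasure_completion)
  finally show "emeasure lebesgue (preimg E) \<le> ennreal ((2 * L) ^ DIM('a)) * emeasure lebesgue E + ennreal e"
    by (simp only: c_def)
qed

text \<open>Measurability with respect to the completed algebra on both sides, so that composition
  with a merely Lebesgue measurable representative is again measurable.\<close>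

lemma X_lebesgue: "X \<in> lebesgue_on B \<rightarrow>\<^sub>M lebesgue"
proof (rule measurableI)
  fix A :: "'a set" assume "A \<in> sets lebesgue"
  then have "preimg A \<in> sets lebesgue" by (rule preimg_sets)
  moreover have "X -` A \<inter> space (lebesgue_on B) = preimg A" by (auto simp: preimg_def)
  moreover have "preimg A \<subseteq> B" by (auto simp: preimg_def)
  ultimately show "X -` A \<inter> space (lebesgue_on B) \<in> sets (lebesgue_on B)"
    using B_sets by (simp add: sets_restrict_space_iff)
qed auto

text \<open>Takes the place of a change of variables: the image under X of the measure on B is
  dominated by a multiple of Lebesgue measure.\<close>

lemma nn_integral_comp_le:
  assumes u: "u \<in> borel_measurable lebesgue"
  shows "(\<integral>\<^sup>+x. u (X x) \<partial>lebesgue_on B) \<le> ennreal ((2 * L) ^ DIM('a)) * (\<integral>\<^sup>+x. u x \<partial>lebesgue)"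
proof -
  have "distr (lebesgue_on B) lebesgue X \<le> scale_measure (ennreal ((2 * L) ^ DIM('a))) lebesgue"
  proof (subst le_measure, simp, intro ballI)
    fix A :: "'a set" assume "A \<in> sets (distr (lebesgue_on B) lebesgue X)"
    then have A: "A \<in> sets lebesgue" by simp
    have "emeasure (distr (lebesgue_on B) lebesgue X) A = emeasure (lebesgue_on B) (X -` A \<inter> B)"
      using emeasure_distr[OF X_lebesgue A] by simp
    also have "X -` A \<inter> B = preimg A" by (auto simp: preimg_def)
    also have "emeasure (lebesgue_on B) (preimg A) = emeasure lebesgue (preimg A)"
      by (rule emeasure_restrict_space) (use B_sets in \<open>auto simp: preimg_def\<close>)
    also have "\<dots> \<le> emeasure (scale_measure (ennreal ((2 * L) ^ DIM('a))) lebesgue) A"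
      using emeasure_preimg[OF A] by (simp add: emeasure_scale_measure del: emeasure_completion)
    finally show "emeasure (distr (lebesgue_on B) lebesgue X) A
       \<le> emeasure (scale_measure (ennreal ((2 * L) ^ DIM('a))) lebesgue) A" .
  qed
  then have "(\<integral>\<^sup>+x. u x \<partial>distr (lebesgue_on B) lebesgue X)
      \<le> (\<integral>\<^sup>+x. u x \<partial>scale_measure (ennreal ((2 * L) ^ DIM('a))) lebesgue)"
    by (rule nn_integral_mono_measure[rotated]) simp
  then show ?thesis
    using nn_integral_distr[OF X_lebesgue, of u] u by (simp add: nn_integral_scale_measure)
qed

end

section \<open>Square-integrable functions and \<open>H1\<close>\<close>

text \<open>Elements are functions, so \<open>ip v v = 0\<close> does not force v = 0. The laws are
  demanded on V only, since the integral of a function that is not integrable has a default value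
  and breaks linearity. L2 and H1 are both instances.\<close>

locale semi_inner_space =
  fixes V :: "('a \<Rightarrow> 'b::real_vector) set" and ip :: "('a \<Rightarrow> 'b) \<Rightarrow> ('a \<Rightarrow> 'b) \<Rightarrow> real"
  assumes add_closed: "v \<in> V \<Longrightarrow> w \<in> V \<Longrightarrow> (\<lambda>x. v x + w x) \<in> V"
    and scale_closed: "v \<in> V \<Longrightarrow> (\<lambda>x. a *\<^sub>R v x) \<in> V"
    and ip_add: "v \<in> V \<Longrightarrow> w \<in> V \<Longrightarrow> z \<in> V \<Longrightarrow> ip (\<lambda>x. v x + w x) z = ip v z + ip w z"
    and ip_scale: "v \<in> V \<Longrightarrow> z \<in> V \<Longrightarrow> ip (\<lambda>x. a *\<^sub>R v x) z = a * ip v z"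
    and ip_sym: "v \<in> V \<Longrightarrow> w \<in> V \<Longrightarrow> ip v w = ip w v"
    and ip_nonneg: "v \<in> V \<Longrightarrow> 0 \<le> ip v v"
begin

definition nrm :: "('a \<Rightarrow> 'b) \<Rightarrow> real" where "nrm v = sqrt (ip v v)"

lemma nrm_nonneg: "v \<in> V \<Longrightarrow> 0 \<le> nrm v"
  by (simp add: nrm_def ip_nonneg)

lemma nrm_sq: "v \<in> V \<Longrightarrow> (nrm v)\<^sup>2 = ip v v"
  by (simp add: nrm_def ip_nonneg)

lemma diff_closed: "v \<in> V \<Longrightarrow> w \<in> V \<Longrightarrow> (\<lambda>x. v x - w x) \<in> V"
  using add_closed[OF _ scale_closed[of w "-1"], of v] by simp

lemma ip_diff: "v \<in> V \<Longrightarrow> w \<in> V \<Longrightarrow> z \<in> V \<Longrightarrow> ip (\<lambda>x. v x - w x) z = ip v z - ip w z"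
  using ip_add[OF _ scale_closed[of w "-1"], of v z] ip_scale[of w z "-1"] by simp

lemma ip_add_right: "v \<in> V \<Longrightarrow> w \<in> V \<Longrightarrow> z \<in> V \<Longrightarrow> ip z (\<lambda>x. v x + w x) = ip z v + ip z w"
  using ip_add[of v w z] ip_sym add_closed by metis

lemma ip_scale_right: "v \<in> V \<Longrightarrow> z \<in> V \<Longrightarrow> ip z (\<lambda>x. a *\<^sub>R v x) = a * ip z v"
  using ip_scale[of v z a] ip_sym scale_closed by metis

lemma ip_diff_right: "v \<in> V \<Longrightarrow> w \<in> V \<Longrightarrow> z \<in> V \<Longrightarrow> ip z (\<lambda>x. v x - w x) = ip z v - ip z w"
  using ip_diff[of v w z] ip_sym diff_closed by metis

lemma ip_scale_add_square:
  assumes "v \<in> V" "w \<in> V"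
  shows "ip (\<lambda>x. v x + t *\<^sub>R w x) (\<lambda>x. v x + t *\<^sub>R w x) = ip v v + 2 * t * ip v w + t\<^sup>2 * ip w w"
  using assms scale_closed[OF assms(2), of t]
  by (simp add: ip_add ip_add_right add_closed ip_scale ip_scale_right ip_sym[of w v] power2_eq_square algebra_simps)

lemma Cauchy_Schwarz:
  assumes "v \<in> V" "w \<in> V"
  shows "\<bar>ip v w\<bar> \<le> nrm v * nrm w"
proof -
  have q: "0 \<le> ip v v + 2 * t * ip v w + t\<^sup>2 * ip w w" for t
    using ip_nonneg[OF add_closed[OF assms(1) scale_closed[OF assms(2), of t]]]
    by (simp add: ip_scale_add_square[OF assms])
  have "(ip v w)\<^sup>2 \<le> ip v v * ip w w"
  proof (cases "ip w w = 0")
    case True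
    have "ip v w = 0"
    proof (rule ccontr)
      assume n: "ip v w \<noteq> 0"
      \<comment> \<open>With \<open>ip w w = 0\<close> the quadratic is affine in t, and at this t
        it takes the value -1.\<close>
      show False using q[of "- (ip v v + 1) / (2 * ip v w)"] True n by (simp add: field_simps)
    qed
    then show ?thesis by (simp add: True)
  next
    case False
    then have p: "ip w w > 0" using ip_nonneg[OF assms(2)] by simp
    have "0 \<le> ip v v - (ip v w)\<^sup>2 / ip w w"
      using q[of "- ip v w / ip w w"] p by (simp add: power2_eq_square field_simps)
    then show ?thesis using p by (simp add: field_simps)
  qed
  then have "sqrt ((ip v w)\<^sup>2) \<le> sqrt (ip v v * ip w w)" by (rule real_sqrt_le_mono)
  then show ?thesis by (simp add: nrm_def real_sqrt_mult)
qed

lemma nrm_triangle: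
  assumes "v \<in> V" "w \<in> V"
  shows "nrm (\<lambda>x. v x + w x) \<le> nrm v + nrm w"
proof (rule power2_le_imp_le)
  have "(nrm (\<lambda>x. v x + w x))\<^sup>2 = (nrm v)\<^sup>2 + 2 * ip v w + (nrm w)\<^sup>2"
    using ip_scale_add_square[OF assms, of 1] assms by (simp add: nrm_sq add_closed)
  also have "\<dots> \<le> (nrm v)\<^sup>2 + 2 * (nrm v * nrm w) + (nrm w)\<^sup>2"
    using Cauchy_Schwarz[OF assms] by simp
  finally show "(nrm (\<lambda>x. v x + w x))\<^sup>2 \<le> (nrm v + nrm w)\<^sup>2" by (simp add: power2_sum)
qed (simp add: nrm_nonneg assms)

lemma nrm_scale: "v \<in> V \<Longrightarrow> nrm (\<lambda>x. a *\<^sub>R v x) = \<bar>a\<bar> * nrm v"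
  by (simp add: nrm_def ip_scale ip_scale_right scale_closed real_sqrt_mult flip: power2_eq_square mult.assoc)

lemma nrm_triangle_diff:
  assumes "v \<in> V" "w \<in> V"
  shows "nrm (\<lambda>x. v x - w x) \<le> nrm v + nrm w"
  using nrm_triangle[OF assms(1) scale_closed[OF assms(2), of "-1"]] nrm_scale[OF assms(2), of "-1"] by simp

lemma nrm_le_diff:
  assumes "v \<in> V" "w \<in> V"
  shows "nrm v \<le> nrm w + nrm (\<lambda>x. v x - w x)"
  using nrm_triangle[OF assms(2) diff_closed[OF assms]] by simp

end

section \<open>Square-integrable functions and changes on null sets\<close>

lemma L2_measurable: "f \<in> L2 S \<Longrightarrow> f \<in> borel_measurable (lebesgue_on S)"
  and L2_integrable: "f \<in> L2 S \<Longrightarrow> integrable (lebesgue_on S) (\<lambda>x. (norm (f x))\<^sup>2)"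
  by (simp_all add: L2_def)

lemma L2_bound:
  fixes h :: "'a::euclidean_space \<Rightarrow> real"
  assumes "f \<in> L2 S" "g \<in> L2 S" "h \<in> borel_measurable (lebesgue_on S)"
    and "\<And>x. x \<in> S \<Longrightarrow> norm (h x) \<le> C * ((norm (f x))\<^sup>2 + (norm (g x))\<^sup>2)"
  shows "integrable (lebesgue_on S) h"
proof (rule Bochner_Integration.integrable_bound)
  show "integrable (lebesgue_on S) (\<lambda>x. C * ((norm (f x))\<^sup>2 + (norm (g x))\<^sup>2))"
    using assms(1,2)[THEN L2_integrable] by (intro integrable_mult_right Bochner_Integration.integrable_add)
  show "AE x in lebesgue_on S. norm (h x) \<le> norm (C * ((norm (f x))\<^sup>2 + (norm (g x))\<^sup>2))"
    using assms(4) by (intro AE_I2) (smt (verit) real_norm_def space_lebesgue_on)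
qed fact

lemma L2_inner_integrable:
  assumes "f \<in> L2 S" "g \<in> L2 S"
  shows "integrable (lebesgue_on S) (\<lambda>x. f x \<bullet> g x)"
proof (rule L2_bound[OF assms, where C = 1])
  show "(\<lambda>x. f x \<bullet> g x) \<in> borel_measurable (lebesgue_on S)"
    using assms[THEN L2_measurable] by (rule borel_measurable_inner)
  show "norm (f x \<bullet> g x) \<le> 1 * ((norm (f x))\<^sup>2 + (norm (g x))\<^sup>2)" for x
    using Cauchy_Schwarz_ineq2[of "f x" "g x"] sum_squares_bound[of "norm (f x)" "norm (g x)"]
      mult_nonneg_nonneg[OF norm_ge_zero norm_ge_zero, of "f x" "g x"] by simp
qed

lemma semi_inner_L2: "semi_inner_space (L2 S) (l2_inner S :: ('a::euclidean_space \<Rightarrow> 'b::euclidean_space) \<Rightarrow> _)"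
proof
  fix v w z :: "'a \<Rightarrow> 'b" and a :: real
  assume v: "v \<in> L2 S"
  show "(\<lambda>x. a *\<^sub>R v x) \<in> L2 S"
    using v by (simp add: L2_def power_mult_distrib borel_measurable_scaleR)
  show "0 \<le> l2_inner S v v" by (simp add: l2_inner_def)
  { assume z: "z \<in> L2 S"
    show "l2_inner S (\<lambda>x. a *\<^sub>R v x) z = a * l2_inner S v z"
      by (simp add: l2_inner_def) }
  assume w: "w \<in> L2 S"
  show "l2_inner S v w = l2_inner S w v" by (simp add: l2_inner_def inner_commute)
  show "(\<lambda>x. v x + w x) \<in> L2 S"
    unfolding L2_def
  proof (intro CollectI conjI)
    show m: "(\<lambda>x. v x + w x) \<in> borel_measurable (lebesgue_on S)"
      using v w by (intro borel_measurable_add L2_measurable)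
    have "(norm (v x + w x))\<^sup>2 \<le> 2 * ((norm (v x))\<^sup>2 + (norm (w x))\<^sup>2)" for x
    proof -
      have "(norm (v x + w x))\<^sup>2 \<le> (norm (v x) + norm (w x))\<^sup>2"
        by (intro power_mono norm_triangle_ineq) auto
      then show ?thesis using sum_squares_bound[of "norm (v x)" "norm (w x)"]
        by (simp add: power2_sum)
    qed
    then show "integrable (lebesgue_on S) (\<lambda>x. (norm (v x + w x))\<^sup>2)"
      using m by (intro L2_bound[OF v w, where C = 2]) (auto intro!: borel_measurable_power)
  qed
  { assume z: "z \<in> L2 S"
    show "l2_inner S (\<lambda>x. v x + w x) z = l2_inner S v z + l2_inner S w z"
      using L2_inner_integrable[OF v z] L2_inner_integrable[OF w z]
      by (simp add: l2_inner_def inner_add_left) }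
qed

interpretation L2: semi_inner_space "L2 S" "l2_inner S :: ('a::euclidean_space \<Rightarrow> 'b::euclidean_space) \<Rightarrow> _" for S
  by (rule semi_inner_L2)

text \<open>Completeness of the measure: the preimages under f and g differ by a null set.\<close>

lemma borel_measurable_lebesgue_AE_cong:
  fixes f g :: "'a::euclidean_space \<Rightarrow> 'b::euclidean_space"
  assumes S: "S \<in> sets lebesgue" and f: "f \<in> borel_measurable (lebesgue_on S)"
    and ae: "AE x in lebesgue. x \<in> S \<longrightarrow> f x = g x"
  shows "g \<in> borel_measurable (lebesgue_on S)"
proof -
  let ?f = "\<lambda>x. if x \<in> S then f x else 0" and ?g = "\<lambda>x. if x \<in> S then g x else 0"
  have f': "?f \<in> borel_measurable lebesgue" using f S by (rule borel_measurable_if_I)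
  have "?g \<in> borel_measurable lebesgue"
  proof (rule measurableI)
    fix A :: "'b set" assume A: "A \<in> sets borel"
    show "?g -` A \<inter> space lebesgue \<in> sets lebesgue"
    proof (rule completion.in_sets_AE)
      show "?f -` A \<inter> space lebesgue \<in> sets lebesgue" by (rule measurable_sets[OF f' A])
      show "AE x in lebesgue. (x \<in> ?f -` A \<inter> space lebesgue) = (x \<in> ?g -` A \<inter> space lebesgue)"
        using ae by eventually_elim auto
    qed auto
  qed auto
  then show ?thesis by (rule borel_measurable_if_D)
qed

lemma AE_lebesgue_on_iff: "S \<in> sets lebesgue \<Longrightarrow> (AE x in lebesgue_on S. P x) \<longleftrightarrow> (AE x in lebesgue. x \<in> S \<longrightarrow> P x)"
  by (simp add: AE_restrict_space_iff)

text \<open>Serves \<open>weak_grad\<close>, an arbitrary choice that agrees with a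
  square-integrable gradient only almost everywhere.\<close>

lemma L2_AE_cong:
  fixes f g :: "'a::euclidean_space \<Rightarrow> 'b::euclidean_space"
  assumes S: "S \<in> sets lebesgue" and f: "f \<in> L2 S" and ae: "AE x in lebesgue. x \<in> S \<longrightarrow> f x = g x"
  shows "g \<in> L2 S"
proof -
  have m: "g \<in> borel_measurable (lebesgue_on S)"
    by (rule borel_measurable_lebesgue_AE_cong[OF S L2_measurable[OF f] ae])
  have "integrable (lebesgue_on S) (\<lambda>x. (norm (g x))\<^sup>2) \<longleftrightarrow> integrable (lebesgue_on S) (\<lambda>x. (norm (f x))\<^sup>2)"
  proof (rule integrable_cong_AE)
    show "AE x in lebesgue_on S. (norm (g x))\<^sup>2 = (norm (f x))\<^sup>2"
      unfolding AE_lebesgue_on_iff[OF S] using ae by eventually_elim auto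
  qed (use m L2_measurable[OF f] in auto)
  then show ?thesis using m f by (simp add: L2_def)
qed

lemma l2_inner_AE_cong:
  fixes f g :: "'a::euclidean_space \<Rightarrow> 'b::euclidean_space"
  assumes S: "S \<in> sets lebesgue" and "f \<in> L2 S" "g \<in> L2 S"
    and "AE x in lebesgue. x \<in> S \<longrightarrow> f x = f' x" "AE x in lebesgue. x \<in> S \<longrightarrow> g x = g' x"
  shows "l2_inner S f g = l2_inner S f' g'"
  unfolding l2_inner_def
proof (rule integral_cong_AE)
  show "AE x in lebesgue_on S. f x \<bullet> g x = f' x \<bullet> g' x"
    unfolding AE_lebesgue_on_iff[OF S] using assms(4,5) by eventually_elim auto
  show "(\<lambda>x. f x \<bullet> g x) \<in> borel_measurable (lebesgue_on S)"
    by (rule borel_measurable_inner[OF assms(2,3)[THEN L2_measurable]])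
  show "(\<lambda>x. f' x \<bullet> g' x) \<in> borel_measurable (lebesgue_on S)"
    by (rule borel_measurable_inner[OF L2_AE_cong[OF S assms(2,4), THEN L2_measurable]
          L2_AE_cong[OF S assms(3,5), THEN L2_measurable]])
qed

lemma l2_nrm_AE_cong:
  fixes f g :: "'a::euclidean_space \<Rightarrow> 'b::euclidean_space"
  assumes "S \<in> sets lebesgue" "f \<in> L2 S" "AE x in lebesgue. x \<in> S \<longrightarrow> f x = g x"
  shows "L2.nrm S f = L2.nrm S g"
  unfolding L2.nrm_def using l2_inner_AE_cong[OF assms(1,2,2,3,3)] by simp

lemma L2_imp_absolutely_integrable:
  fixes f :: "'a::euclidean_space \<Rightarrow> 'b::euclidean_space"
  assumes "S \<in> sets lebesgue" "f \<in> L2 S" "compact K" "K \<subseteq> S"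
  shows "f absolutely_integrable_on K"
proof -
  have K: "K \<in> sets lebesgue" using assms by (auto simp: compact_imp_closed)
  have i1: "integrable lebesgue (\<lambda>x. if x \<in> S then (norm (f x))\<^sup>2 else 0)"
    using L2_integrable[OF assms(2)]
      Lebesgue_Measure.integrable_restrict_UNIV[OF assms(1), of "\<lambda>x. (norm (f x))\<^sup>2"] by simp
  have i2: "integrable lebesgue (indicator K :: 'a \<Rightarrow> real)"
    using lmeasurable_compact[OF assms(3)]
    by (auto simp: fmeasurable_def simp del: emeasure_completion intro!: integrable_real_indicator)
  have m: "(\<lambda>x. indicator K x *\<^sub>R (if x \<in> S then f x else 0)) \<in> borel_measurable lebesgue"
    using borel_measurable_if_I[OF L2_measurable[OF assms(2)] assms(1)] K
    by (intro borel_measurable_scaleR borel_measurable_indicator)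
  have eq: "indicator K x *\<^sub>R (if x \<in> S then f x else 0) = indicator K x *\<^sub>R f x" for x
    using assms(4) by (auto simp: indicator_def)
  show ?thesis unfolding set_integrable_def
  proof (rule Bochner_Integration.integrable_bound[OF Bochner_Integration.integrable_add[OF i1 i2]])
    show "(\<lambda>x. indicator K x *\<^sub>R f x) \<in> borel_measurable lebesgue" using m unfolding eq .
    \<comment> \<open>Adding the indicator of the compact set K, which has finite measure, turns the
      square into an integrable bound for the norm itself.\<close>
    have b: "t \<le> t\<^sup>2 + 1" if "t \<ge> 0" for t :: real
      using sum_squares_bound[of t 1] that by simp
    show "AE x in lebesgue. norm (indicator K x *\<^sub>R f x) \<le> norm ((if x \<in> S then (norm (f x))\<^sup>2 else 0) + indicator K x)"
      using assms(4) b[of "norm (f _)"] by (intro AE_I2) (auto simp: indicator_def)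
  qed
qed

lemma L2_componentsI:
  fixes f :: "'a::euclidean_space \<Rightarrow> 'b::euclidean_space"
  assumes "\<And>b. b \<in> Basis \<Longrightarrow> (\<lambda>x. f x \<bullet> b) \<in> L2 S"
  shows "f \<in> L2 S"
  unfolding L2_def
proof (intro CollectI conjI)
  show "f \<in> borel_measurable (lebesgue_on S)"
    using assms by (subst borel_measurable_euclidean_space) (auto intro: L2_measurable)
  have "(norm (f x))\<^sup>2 = (\<Sum>b\<in>Basis. (norm (f x \<bullet> b))\<^sup>2)" for x
    unfolding power2_norm_eq_inner[of "f x"] by (subst euclidean_inner) (simp add: power2_eq_square)
  note eq = this
  show "integrable (lebesgue_on S) (\<lambda>x. (norm (f x))\<^sup>2)"
    unfolding eq by (intro Bochner_Integration.integrable_sum L2_integrable assms)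
qed

lemma locally_integrable_component:
  fixes f :: "'a::euclidean_space \<Rightarrow> 'b::euclidean_space"
  assumes "\<And>K. compact K \<Longrightarrow> K \<subseteq> S \<Longrightarrow> f absolutely_integrable_on K" "bounded_linear (l :: 'b \<Rightarrow> real)"
  shows "(\<lambda>x. l (f x)) locally_integrable_on S"
  unfolding locally_integrable_on_def set_integrable_def
proof (intro allI impI)
  fix K assume "compact K \<and> K \<subseteq> S"
  then have "integrable lebesgue (\<lambda>x. indicator K x *\<^sub>R f x)"
    using assms(1) by (simp add: set_integrable_def)
  from integrable_bounded_linear[OF assms(2) this]
  show "integrable lebesgue (\<lambda>x. indicator K x *\<^sub>R l (f x))"
    by (simp add: linear_scale[OF bounded_linear.linear[OF assms(2)]])
qed

section \<open>Weak gradients and the space H1\<close>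

lemma bounded_linear_entry: "bounded_linear (\<lambda>A :: real^'n^'m. A $ i $ j)"
  using bounded_linear_compose[OF bounded_linear_vec_nth[of j] bounded_linear_vec_nth[of i]] by simp

lemma has_weak_gradient_locally_integrable:
  assumes "has_weak_gradient v G S"
  shows "(\<lambda>x. v x $ i) locally_integrable_on S" "(\<lambda>x. G x $ i $ j) locally_integrable_on S"
proof -
  have 1: "v absolutely_integrable_on K" "G absolutely_integrable_on K" if "compact K" "K \<subseteq> S" for K
    using assms that by (auto simp: has_weak_gradient_def)
  show "(\<lambda>x. v x $ i) locally_integrable_on S"
    by (rule locally_integrable_component[OF 1(1) bounded_linear_vec_nth])
  show "(\<lambda>x. G x $ i $ j) locally_integrable_on S"
    by (rule locally_integrable_component[OF 1(2) bounded_linear_entry])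
qed

lemma lebesgue_on_mult_test:
  fixes f :: "'a::euclidean_space \<Rightarrow> real"
  assumes "open S" "\<psi> \<in> test_functions S"
  shows "(LINT x|lebesgue_on S. f x * \<psi> x) = (LINT x|lebesgue. f x * \<psi> x)"
  by (rule lebesgue_on_supported(1)) (use assms test_function_eq_0[OF assms(2)] in auto)

lemma has_weak_gradientD:
  assumes "has_weak_gradient v G S" "open S" "\<psi> \<in> test_functions S"
  shows "(LINT x|lebesgue. v x $ i * frechet_derivative \<psi> (at x) (axis j 1)) = - (LINT x|lebesgue. G x $ i $ j * \<psi> x)"
  using assms lebesgue_on_mult_test[OF assms(2,3), of "\<lambda>x. G x $ i $ j"]
    lebesgue_on_mult_test[OF assms(2) test_function_partial[OF assms(3) axis_Basis[of j]], of "\<lambda>x. v x $ i"]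
  by (simp add: has_weak_gradient_def)

lemma has_weak_gradientI:
  assumes "open S" 
    and "\<And>K. compact K \<Longrightarrow> K \<subseteq> S \<Longrightarrow> v absolutely_integrable_on K"
    and "\<And>K. compact K \<Longrightarrow> K \<subseteq> S \<Longrightarrow> G absolutely_integrable_on K"
    and "\<And>\<psi> i j. \<psi> \<in> test_functions S \<Longrightarrow>
      (LINT x|lebesgue. v x $ i * frechet_derivative \<psi> (at x) (axis j 1)) = - (LINT x|lebesgue. G x $ i $ j * \<psi> x)"
  shows "has_weak_gradient v G S"
  unfolding has_weak_gradient_def
proof (intro conjI ballI allI impI)
  fix \<psi> :: "real^'a \<Rightarrow> real" and i j assume \<psi>: "\<psi> \<in> test_functions S"
  show "(LINT x|lebesgue_on S. v x $ i * frechet_derivative \<psi> (at x) (axis j 1)) = - (LINT x|lebesgue_on S. G x $ i $ j * \<psi> x)"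
    using assms(4)[OF \<psi>] lebesgue_on_mult_test[OF assms(1) \<psi>, of "\<lambda>x. G x $ i $ j"]
    lebesgue_on_mult_test[OF assms(1) test_function_partial[OF \<psi> axis_Basis[of j]], of "\<lambda>x. v x $ i"]
    by simp
qed (use assms in auto)

lemma has_weak_gradient_unique:
  fixes v :: "real^'d \<Rightarrow> real^'d"
  assumes "open S" "has_weak_gradient v G S" "has_weak_gradient v H S"
  shows "AE x in lebesgue. x \<in> S \<longrightarrow> G x = H x"
proof -
  have "AE x in lebesgue. x \<in> S \<longrightarrow> G x $ i $ j - H x $ i $ j = 0" for i j
  proof (rule fundamental_lemma[OF assms(1)])
    note l = assms(2,3)[THEN has_weak_gradient_locally_integrable(2), of i j]
    show "(\<lambda>x. G x $ i $ j - H x $ i $ j) locally_integrable_on S"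
      using l unfolding locally_integrable_on_def by (auto intro: set_integral_diff(1))
    fix \<psi> :: "real^'d \<Rightarrow> real" assume \<psi>: "\<psi> \<in> test_functions S"
    show "(LINT x|lebesgue. (G x $ i $ j - H x $ i $ j) * \<psi> x) = 0"
      using has_weak_gradientD[OF assms(2,1) \<psi>, of i j] has_weak_gradientD[OF assms(3,1) \<psi>, of i j]
        l[THEN locally_integrable_mult_test[OF _ \<psi>]]
      by (simp add: left_diff_distrib)
  qed
  then have "AE x in lebesgue. \<forall>i\<in>UNIV. \<forall>j\<in>UNIV. x \<in> S \<longrightarrow> G x $ i $ j - H x $ i $ j = 0"
    by (intro AE_finite_allI) auto
  then show ?thesis by (rule eventually_mono) (auto simp: vec_eq_iff)
qed

lemma has_weak_gradient_add:
  fixes v w :: "real^'d \<Rightarrow> real^'d"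
  assumes S: "open S" and v: "has_weak_gradient v G S" and w: "has_weak_gradient w H S"
  shows "has_weak_gradient (\<lambda>x. v x + w x) (\<lambda>x. G x + H x) S"
proof (rule has_weak_gradientI[OF S])
  fix \<psi> :: "real^'d \<Rightarrow> real" and i j assume \<psi>: "\<psi> \<in> test_functions S"
  note l = has_weak_gradient_locally_integrable
  note d\<psi> = test_function_partial[OF \<psi> axis_Basis[of j]]
  show "(LINT x|lebesgue. (v x + w x) $ i * frechet_derivative \<psi> (at x) (axis j 1)) =
      - (LINT x|lebesgue. (G x + H x) $ i $ j * \<psi> x)"
    using has_weak_gradientD[OF v S \<psi>, of i j] has_weak_gradientD[OF w S \<psi>, of i j]
      locally_integrable_mult_test[OF l(1)[OF v] d\<psi>, of i] locally_integrable_mult_test[OF l(1)[OF w] d\<psi>, of i]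
      locally_integrable_mult_test[OF l(2)[OF v] \<psi>, of i j] locally_integrable_mult_test[OF l(2)[OF w] \<psi>, of i j]
    by (simp add: distrib_right)
qed (use v w in \<open>auto simp: has_weak_gradient_def intro!: set_integral_add(1)\<close>)

lemma has_weak_gradient_scale:
  fixes v :: "real^'d \<Rightarrow> real^'d"
  assumes S: "open S" and v: "has_weak_gradient v G S"
  shows "has_weak_gradient (\<lambda>x. a *\<^sub>R v x) (\<lambda>x. a *\<^sub>R G x) S"
proof (rule has_weak_gradientI[OF S])
  fix \<psi> :: "real^'d \<Rightarrow> real" and i j assume \<psi>: "\<psi> \<in> test_functions S"
  show "(LINT x|lebesgue. (a *\<^sub>R v x) $ i * frechet_derivative \<psi> (at x) (axis j 1)) =
      - (LINT x|lebesgue. (a *\<^sub>R G x) $ i $ j * \<psi> x)"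
    using has_weak_gradientD[OF v S \<psi>, of i j] by (simp add: mult.assoc)
qed (use v in \<open>auto simp: has_weak_gradient_def absolutely_integrable_scaleR_left\<close>)

lemma H1_L2: "v \<in> H1 S \<Longrightarrow> v \<in> L2 S" by (simp add: H1_def)

lemma H1_weak_grad: "v \<in> H1 S \<Longrightarrow> has_weak_gradient v (weak_grad S v) S"
  unfolding H1_def weak_grad_def using someI[of "\<lambda>G. has_weak_gradient v G S"] by blast

lemma H1_weak_grad_AE:
  assumes "open S" "has_weak_gradient v G S"
  shows "AE x in lebesgue. x \<in> S \<longrightarrow> G x = weak_grad S v x"
proof -
  have "has_weak_gradient v (weak_grad S v) S"
    unfolding weak_grad_def by (rule someI[of "\<lambda>G. has_weak_gradient v G S", OF assms(2)])
  then show ?thesis by (rule has_weak_gradient_unique[OF assms])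
qed

text \<open>The choice in \<open>weak_grad\<close> does not ask for square integrability; this is
  inherited from the witness in \<open>H1\<close> by uniqueness almost everywhere.\<close>

lemma H1_weak_grad_L2:
  assumes "open S" "v \<in> H1 S"
  shows "weak_grad S v \<in> L2 S"
proof -
  obtain G where G: "G \<in> L2 S" "has_weak_gradient v G S" using assms(2) by (auto simp: H1_def)
  have "S \<in> sets lebesgue" using assms(1) by auto
  from L2_AE_cong[OF this G(1) H1_weak_grad_AE[OF assms(1) G(2)]] show ?thesis .
qed

lemma H1I: "v \<in> L2 S \<Longrightarrow> G \<in> L2 S \<Longrightarrow> has_weak_gradient v G S \<Longrightarrow> v \<in> H1 S"
  by (auto simp: H1_def)

lemma H1_add: 
  assumes "open S" "v \<in> H1 S" "w \<in> H1 S"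
  shows "(\<lambda>x. v x + w x) \<in> H1 S"
    and "AE x in lebesgue. x \<in> S \<longrightarrow> weak_grad S v x + weak_grad S w x = weak_grad S (\<lambda>x. v x + w x) x"
proof -
  note g = has_weak_gradient_add[OF assms(1) H1_weak_grad[OF assms(2)] H1_weak_grad[OF assms(3)]]
  show "(\<lambda>x. v x + w x) \<in> H1 S"
    by (rule H1I[OF L2.add_closed[OF H1_L2 H1_L2] L2.add_closed[OF H1_weak_grad_L2 H1_weak_grad_L2] g])
      (use assms in auto)
  show "AE x in lebesgue. x \<in> S \<longrightarrow> weak_grad S v x + weak_grad S w x = weak_grad S (\<lambda>x. v x + w x) x"
    by (rule H1_weak_grad_AE[OF assms(1) g])
qed

lemma H1_scale: 
  assumes "open S" "v \<in> H1 S"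
  shows "(\<lambda>x. a *\<^sub>R v x) \<in> H1 S"
    and "AE x in lebesgue. x \<in> S \<longrightarrow> a *\<^sub>R weak_grad S v x = weak_grad S (\<lambda>x. a *\<^sub>R v x) x"
proof -
  note g = has_weak_gradient_scale[OF assms(1) H1_weak_grad[OF assms(2)]]
  show "(\<lambda>x. a *\<^sub>R v x) \<in> H1 S"
    by (rule H1I[OF L2.scale_closed[OF H1_L2] L2.scale_closed[OF H1_weak_grad_L2] g])
      (use assms in auto)
  show "AE x in lebesgue. x \<in> S \<longrightarrow> a *\<^sub>R weak_grad S v x = weak_grad S (\<lambda>x. a *\<^sub>R v x) x"
    by (rule H1_weak_grad_AE[OF assms(1) g])
qed

text \<open>\<open>weak_grad\<close> is linear only up to null sets, so additivity and homogeneity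
  of the inner product go through \<open>l2_inner_AE_cong\<close>.\<close>

lemma semi_inner_H1:
  fixes S :: "(real^'d) set"
  assumes S: "open S"
  shows "semi_inner_space (H1 S) (h1_inner S)"
proof
  have Ss: "S \<in> sets lebesgue" using S by auto
  have refl: "AE x in lebesgue. x \<in> S \<longrightarrow> f x = f x" for f :: "real^'d \<Rightarrow> real^'d^'d" by simp
  fix v w z :: "real^'d \<Rightarrow> real^'d" and a :: real
  assume v: "v \<in> H1 S"
  note gv = H1_weak_grad_L2[OF S v]
  show "(\<lambda>x. a *\<^sub>R v x) \<in> H1 S" by (rule H1_scale(1)[OF S v])
  show "0 \<le> h1_inner S v v"
    using L2.ip_nonneg[OF gv] L2.ip_nonneg[OF H1_L2[OF v]] by (simp add: h1_inner_def)
  { assume z: "z \<in> H1 S"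
    have "l2_inner S (weak_grad S (\<lambda>x. a *\<^sub>R v x)) (weak_grad S z) = l2_inner S (\<lambda>x. a *\<^sub>R weak_grad S v x) (weak_grad S z)"
      by (rule l2_inner_AE_cong[OF Ss L2.scale_closed[OF gv] H1_weak_grad_L2[OF S z] H1_scale(2)[OF S v] refl, symmetric])
    then show "h1_inner S (\<lambda>x. a *\<^sub>R v x) z = a * h1_inner S v z"
      using L2.ip_scale[OF gv H1_weak_grad_L2[OF S z], of a] L2.ip_scale[OF H1_L2[OF v] H1_L2[OF z], of a]
      by (simp add: h1_inner_def distrib_left) }
  assume w: "w \<in> H1 S"
  note gw = H1_weak_grad_L2[OF S w]
  show "(\<lambda>x. v x + w x) \<in> H1 S" by (rule H1_add(1)[OF S v w])
  show "h1_inner S v w = h1_inner S w v"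
    using L2.ip_sym[OF gv gw] L2.ip_sym[OF H1_L2[OF v] H1_L2[OF w]] by (simp add: h1_inner_def)
  { assume z: "z \<in> H1 S"
    have "l2_inner S (weak_grad S (\<lambda>x. v x + w x)) (weak_grad S z) = l2_inner S (\<lambda>x. weak_grad S v x + weak_grad S w x) (weak_grad S z)"
      by (rule l2_inner_AE_cong[OF Ss L2.add_closed[OF gv gw] H1_weak_grad_L2[OF S z] H1_add(2)[OF S v w] refl, symmetric])
    then show "h1_inner S (\<lambda>x. v x + w x) z = h1_inner S v z + h1_inner S w z"
      using L2.ip_add[OF gv gw H1_weak_grad_L2[OF S z]] L2.ip_add[OF H1_L2[OF v] H1_L2[OF w] H1_L2[OF z]]
      by (simp add: h1_inner_def) }
qed

lemma h1_norm_sq: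
  assumes "open S" "v \<in> H1 S"
  shows "(h1_norm S v)\<^sup>2 = (L2.nrm S (weak_grad S v))\<^sup>2 + (L2.nrm S v)\<^sup>2"
  using semi_inner_space.ip_nonneg[OF semi_inner_H1[OF assms(1)] assms(2)]
    L2.nrm_sq[OF H1_weak_grad_L2[OF assms]] L2.nrm_sq[OF H1_L2[OF assms(2)]]
  by (simp add: h1_norm_def h1_inner_def)

lemma
  assumes "open S" "v \<in> H1 S"
  shows nrm_weak_grad_le: "L2.nrm S (weak_grad S v) \<le> h1_norm S v"
    and nrm_le_h1_norm: "L2.nrm S v \<le> h1_norm S v"
proof -
  have n: "0 \<le> h1_norm S v"
    using semi_inner_space.ip_nonneg[OF semi_inner_H1[OF assms(1)] assms(2)] by (simp add: h1_norm_def)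
  show "L2.nrm S (weak_grad S v) \<le> h1_norm S v" "L2.nrm S v \<le> h1_norm S v"
    by (rule power2_le_imp_le[OF _ n], simp add: h1_norm_sq[OF assms])+
qed

text \<open>The classical Jacobian in the index convention of \<open>has_weak_gradient\<close>: rows
  for components, columns for directions.\<close>

definition gradient_matrix :: "(real^'d \<Rightarrow> real^'d) \<Rightarrow> real^'d \<Rightarrow> real^'d^'d" where
  "gradient_matrix \<phi> x = (\<chi> i j. frechet_derivative \<phi> (at x) (axis j 1) $ i)"

lemma test_function_component: "\<phi> \<in> test_functions S \<Longrightarrow> (\<lambda>x. \<phi> x $ i) \<in> test_functions S"
  by (rule test_function_linear_image[OF bounded_linear_vec_nth])

lemma gradient_matrix_entry:
  assumes "\<phi> \<in> test_functions S"
  shows "gradient_matrix \<phi> x $ i $ j = frechet_derivative (\<lambda>x. \<phi> x $ i) (at x) (axis j 1)"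
proof -
  have "((\<lambda>x. \<phi> x $ i) has_derivative (\<lambda>h. frechet_derivative \<phi> (at x) h $ i)) (at x)"
    by (rule bounded_linear.has_derivative[OF bounded_linear_vec_nth
          has_derivative_frechet[OF test_function_differentiable[OF assms]]])
  from frechet_derivative_eqI[OF this] show ?thesis by (simp add: gradient_matrix_def)
qed

lemma test_function_L2:
  fixes \<phi> :: "'a::euclidean_space \<Rightarrow> 'b::euclidean_space"
  assumes "open S" "\<phi> \<in> test_functions S"
  shows "\<phi> \<in> L2 S"
proof (rule L2_componentsI)
  fix b :: 'b
  have t: "(\<lambda>x. \<phi> x \<bullet> b) \<in> test_functions S"
    by (rule test_function_linear_image[OF bounded_linear_inner_left assms(2)])
  have S: "S \<in> sets lebesgue" using assms(1) by auto
  have "integrable lebesgue (\<lambda>x. (\<phi> x \<bullet> b) * (\<phi> x \<bullet> b))"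
    by (rule integrable_mult_test[OF test_function_integrable[OF t] t])
  then have "integrable (lebesgue_on S) (\<lambda>x. (\<phi> x \<bullet> b) * (\<phi> x \<bullet> b))"
    using test_function_eq_0[OF t] by (subst lebesgue_on_supported(2)[OF S]) auto
  moreover have "(\<lambda>x. \<phi> x \<bullet> b) \<in> borel_measurable (lebesgue_on S)"
    using test_function_borel[OF t] by (rule measurable_restrict_space1)
  ultimately show "(\<lambda>x. \<phi> x \<bullet> b) \<in> L2 S" by (simp add: L2_def power2_eq_square)
qed

lemma gradient_matrix_L2:
  assumes "open S" "\<phi> \<in> test_functions S"
  shows "gradient_matrix \<phi> \<in> L2 S"
proof (rule L2_componentsI)
  fix b :: "real^'a^'a" assume "b \<in> Basis"
  then obtain i j where b: "b = axis i (axis j 1)" by (auto simp: Basis_vec_def)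
  have "(\<lambda>x. frechet_derivative (\<lambda>x. \<phi> x $ i) (at x) (axis j 1)) \<in> L2 S"
    by (rule test_function_L2[OF assms(1) test_function_partial[OF test_function_component[OF assms(2)] axis_Basis]])
  then show "(\<lambda>x. gradient_matrix \<phi> x \<bullet> b) \<in> L2 S"
    by (simp add: b inner_axis gradient_matrix_entry[OF assms(2)])
qed

lemma test_function_weak_gradient:
  fixes \<phi> :: "real^'d \<Rightarrow> real^'d"
  assumes S: "open S" and \<phi>: "\<phi> \<in> test_functions S"
  shows "has_weak_gradient \<phi> (gradient_matrix \<phi>) S"
proof (rule has_weak_gradientI[OF S])
  have Ss: "S \<in> sets lebesgue" using S by auto
  show "\<phi> absolutely_integrable_on K" "gradient_matrix \<phi> absolutely_integrable_on K" if "compact K" "K \<subseteq> S" for K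
    using L2_imp_absolutely_integrable[OF Ss _ that] test_function_L2[OF S \<phi>] gradient_matrix_L2[OF S \<phi>] by blast+
  fix \<psi> :: "real^'d \<Rightarrow> real" and i j assume \<psi>: "\<psi> \<in> test_functions S"
  show "(LINT x|lebesgue. \<phi> x $ i * frechet_derivative \<psi> (at x) (axis j 1)) = - (LINT x|lebesgue. gradient_matrix \<phi> x $ i $ j * \<psi> x)"
    using test_function_parts[OF test_function_component[OF \<phi>] \<psi> axis_Basis]
    by (simp add: gradient_matrix_entry[OF \<phi>])
qed

lemma test_function_H1:
  assumes "open S" "\<phi> \<in> test_functions S"
  shows "\<phi> \<in> H1 S"
  by (rule H1I[OF test_function_L2 gradient_matrix_L2 test_function_weak_gradient]) (rule assms)+

section \<open>Symmetric gradients and Korn's inequality\<close>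

lemma inner_matrix: "(A :: real^'n^'m) \<bullet> C = (\<Sum>i\<in>UNIV. \<Sum>j\<in>UNIV. A $ i $ j * C $ i $ j)"
  by (simp add: inner_vec_def)

lemma inner_transpose: "transpose (A :: real^'n^'n) \<bullet> transpose C = A \<bullet> C"
  unfolding inner_matrix by (subst sum.swap) (simp add: transpose_def)

lemma norm_transpose: "norm (transpose (A :: real^'n^'n)) = norm A"
  by (simp add: norm_eq_sqrt_inner inner_transpose)

lemma transpose_L2:
  fixes A :: "'a::euclidean_space \<Rightarrow> real^'c^'c"
  assumes "A \<in> L2 S"
  shows "(\<lambda>x. transpose (A x)) \<in> L2 S"
proof -
  have "linear (transpose :: real^'c^'c \<Rightarrow> real^'c^'c)"
    by (rule linearI) (auto simp: transpose_def vec_eq_iff)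
  then have "continuous_on UNIV (transpose :: real^'c^'c \<Rightarrow> real^'c^'c)"
    using linear_continuous_on linear_linear by blast
  then have "(\<lambda>x. transpose (A x)) \<in> borel_measurable (lebesgue_on S)"
    by (rule borel_measurable_continuous_on[OF _ L2_measurable[OF assms]])
  then show ?thesis using assms by (simp add: L2_def norm_transpose)
qed

text \<open>The symmetrisation in \<open>weak_grad_sym\<close>, detached from the weak gradient so
  that it also applies to Jacobians of test functions and to differences.\<close>

definition sym_part :: "('a \<Rightarrow> real^'n^'n) \<Rightarrow> 'a \<Rightarrow> real^'n^'n" where
  "sym_part A x = (1/2) *\<^sub>R (A x + transpose (A x))"

lemma sym_part_L2: "A \<in> L2 S \<Longrightarrow> sym_part A \<in> L2 S"
  unfolding sym_part_def[abs_def] by (intro L2.scale_closed L2.add_closed transpose_L2)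

text \<open>Transposition is an isometry for the Frobenius product, so the square reduces to the
  full norm and one mixed term. Korn's inequality is then a question of the sign of the mixed
  term.\<close>

lemma l2_inner_sym_part:
  assumes "A \<in> L2 S"
  shows "2 * l2_inner S (sym_part A) (sym_part A) = l2_inner S A A + l2_inner S A (\<lambda>x. transpose (A x))"
proof -
  note t = transpose_L2[OF assms]
  have "2 * (sym_part A x \<bullet> sym_part A x) = A x \<bullet> A x + A x \<bullet> transpose (A x)" for x
    by (simp add: sym_part_def inner_add_left inner_add_right inner_transpose
        inner_commute[of "transpose (A x)"] field_simps)
  then have "2 * l2_inner S (sym_part A) (sym_part A) = (LINT x|lebesgue_on S. A x \<bullet> A x + A x \<bullet> transpose (A x))"
    unfolding l2_inner_def by (simp flip: integral_mult_right_zero)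
  also have "\<dots> = l2_inner S A A + l2_inner S A (\<lambda>x. transpose (A x))"
    unfolding l2_inner_def by (rule Bochner_Integration.integral_add[OF L2_inner_integrable[OF assms assms] L2_inner_integrable[OF assms t]])
  finally show ?thesis .
qed

lemma nrm_sym_part_le:
  assumes "A \<in> L2 S"
  shows "L2.nrm S (sym_part A) \<le> L2.nrm S A"
proof -
  have "L2.nrm S (\<lambda>x. transpose (A x)) = L2.nrm S A"
    by (simp add: L2.nrm_def l2_inner_def inner_transpose)
  then have "L2.nrm S (\<lambda>x. A x + transpose (A x)) \<le> 2 * L2.nrm S A"
    using L2.nrm_triangle[OF assms transpose_L2[OF assms]] by simp
  moreover have "L2.nrm S (sym_part A) = \<bar>1/2\<bar> * L2.nrm S (\<lambda>x. A x + transpose (A x))"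
    unfolding sym_part_def[abs_def] by (rule L2.nrm_scale[OF L2.add_closed[OF assms transpose_L2[OF assms]]])
  ultimately show ?thesis by simp
qed

text \<open>Moving both derivatives across turns the mixed term of \<open>sym_part\<close> into the square of the divergence.\<close>

lemma Korn_test_function:
  fixes \<phi> :: "real^'d \<Rightarrow> real^'d"
  assumes S: "open S" and \<phi>: "\<phi> \<in> test_functions S"
  shows "(L2.nrm S (gradient_matrix \<phi>))\<^sup>2 \<le> 2 * (L2.nrm S (sym_part (gradient_matrix \<phi>)))\<^sup>2"
proof -
  define d where "d i j x = frechet_derivative (\<lambda>x. \<phi> x $ i) (at x) (axis j 1)" for i j :: 'd and x
  note c = test_function_component[OF \<phi>]
  have Ss: "S \<in> sets lebesgue" using S by auto
  have dt: "d i j \<in> test_functions S" for i j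
    unfolding d_def[abs_def] by (rule test_function_partial[OF c axis_Basis])
  have int: "integrable lebesgue (\<lambda>x. d i j x * d k l x)" for i j k l
    by (rule integrable_mult_test[OF test_function_integrable[OF dt] dt])
  have "l2_inner S (gradient_matrix \<phi>) (\<lambda>x. transpose (gradient_matrix \<phi> x)) = (LINT x|lebesgue_on S. (\<Sum>i\<in>UNIV. \<Sum>j\<in>UNIV. d i j x * d j i x))"
    unfolding l2_inner_def inner_matrix by (simp add: transpose_def gradient_matrix_entry[OF \<phi>] d_def)
  also have "\<dots> = (LINT x|lebesgue. (\<Sum>i\<in>UNIV. \<Sum>j\<in>UNIV. d i j x * d j i x))"
    using test_function_eq_0[OF dt] by (intro lebesgue_on_supported(1)[OF Ss]) simp
  also have "\<dots> = (\<Sum>i\<in>UNIV. \<Sum>j\<in>UNIV. LINT x|lebesgue. d i j x * d j i x)"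
    using int by (simp add: Bochner_Integration.integral_sum)
  also have "\<dots> = (\<Sum>i\<in>UNIV. \<Sum>j\<in>UNIV. LINT x|lebesgue. d i i x * d j j x)"
    unfolding d_def by (intro sum.cong refl test_function_mixed[OF c c axis_Basis axis_Basis])
  also have "\<dots> = (LINT x|lebesgue. (\<Sum>i\<in>UNIV. \<Sum>j\<in>UNIV. d i i x * d j j x))"
    using int by (simp add: Bochner_Integration.integral_sum)
  also have "\<dots> = (LINT x|lebesgue. (\<Sum>i\<in>UNIV. d i i x)\<^sup>2)"
    by (simp add: power2_eq_square sum_product)
  also have "\<dots> \<ge> 0" by simp
  finally have "0 \<le> l2_inner S (gradient_matrix \<phi>) (\<lambda>x. transpose (gradient_matrix \<phi> x))" .
  \<comment> \<open>Dropping the nonnegative mixed term in \<open>l2_inner_sym_part\<close> leaves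
    the constant 2.\<close>
  then show ?thesis
    using l2_inner_sym_part[OF gradient_matrix_L2[OF S \<phi>]]
      L2.nrm_sq[OF gradient_matrix_L2[OF S \<phi>]] L2.nrm_sq[OF sym_part_L2[OF gradient_matrix_L2[OF S \<phi>]]] by simp
qed

text \<open>Restates closeness in \<open>h1_norm\<close> with the classical Jacobian of \<phi>,
  which represents the weak gradient of \<phi> only almost everywhere.\<close>

lemma H10_approx:
  fixes u :: "real^'d \<Rightarrow> real^'d"
  assumes S: "open S" and u: "u \<in> H10 S" and e: "e > 0"
  obtains \<phi> where "\<phi> \<in> test_functions S" "L2.nrm S (\<lambda>x. u x - \<phi> x) \<le> e"
    "L2.nrm S (\<lambda>x. weak_grad S u x - gradient_matrix \<phi> x) \<le> e"
proof -
  obtain \<phi> where \<phi>: "\<phi> \<in> test_functions S" "h1_norm S (\<lambda>x. u x - \<phi> x) < e"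
    using u e by (auto simp: H10_def)
  have uH: "u \<in> H1 S" using u by (simp add: H10_def)
  have d: "(\<lambda>x. u x - \<phi> x) \<in> H1 S"
    by (rule semi_inner_space.diff_closed[OF semi_inner_H1[OF S] uH test_function_H1[OF S \<phi>(1)]])
  have Ss: "S \<in> sets lebesgue" using S by auto
  have "has_weak_gradient (\<lambda>x. u x + (-1) *\<^sub>R \<phi> x) (\<lambda>x. weak_grad S u x + (-1) *\<^sub>R gradient_matrix \<phi> x) S"
    by (rule has_weak_gradient_add[OF S H1_weak_grad[OF uH] has_weak_gradient_scale[OF S test_function_weak_gradient[OF S \<phi>(1)]]])
  then have "AE x in lebesgue. x \<in> S \<longrightarrow> weak_grad S u x - gradient_matrix \<phi> x = weak_grad S (\<lambda>x. u x - \<phi> x) x"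
    using H1_weak_grad_AE[OF S] by fastforce
  then have "L2.nrm S (\<lambda>x. weak_grad S u x - gradient_matrix \<phi> x) = L2.nrm S (weak_grad S (\<lambda>x. u x - \<phi> x))"
    by (rule l2_nrm_AE_cong[OF Ss L2.diff_closed[OF H1_weak_grad_L2[OF S uH] gradient_matrix_L2[OF S \<phi>(1)]]])
  then have "L2.nrm S (\<lambda>x. weak_grad S u x - gradient_matrix \<phi> x) \<le> e"
    using nrm_weak_grad_le[OF S d] \<phi>(2) by simp
  moreover have "L2.nrm S (\<lambda>x. u x - \<phi> x) \<le> e" using nrm_le_h1_norm[OF S d] \<phi>(2) by simp
  ultimately show thesis using that \<phi>(1) by blast
qed

text \<open>Both norms are continuous in the H1 norm, so the inequality passes from test functions
  to their closure; an arbitrary error e is carried along and removed at the end.\<close>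

lemma Korn_H10:
  fixes u :: "real^'d \<Rightarrow> real^'d"
  assumes S: "open S" and u: "u \<in> H10 S"
  shows "(L2.nrm S (weak_grad S u))\<^sup>2 \<le> 2 * (L2.nrm S (weak_grad_sym S u))\<^sup>2"
proof -
  have uH: "u \<in> H1 S" using u by (simp add: H10_def)
  let ?g = "weak_grad S u"
  note g = H1_weak_grad_L2[OF S uH]
  have sym: "weak_grad_sym S u = sym_part ?g" by (simp add: weak_grad_sym_def sym_part_def fun_eq_iff)
  have s0: "0 \<le> L2.nrm S (sym_part ?g)" by (rule L2.nrm_nonneg[OF sym_part_L2[OF g]])
  have "L2.nrm S ?g \<le> sqrt 2 * L2.nrm S (sym_part ?g) + e" if "e > 0" for e
  proof -
    \<comment> \<open>Approximation costs \<open>sqrt 2\<close> times \<epsilon> in the symmetric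
      gradient and another \<epsilon> in the full one.\<close>
    define \<epsilon> where "\<epsilon> = e / (1 + sqrt 2)"
    have p: "1 + sqrt 2 > 0" by (simp add: add_pos_nonneg)
    then have "\<epsilon> > 0" using that by (simp add: \<epsilon>_def)
    then obtain \<phi> where \<phi>: "\<phi> \<in> test_functions S" "L2.nrm S (\<lambda>x. ?g x - gradient_matrix \<phi> x) \<le> \<epsilon>"
      using H10_approx[OF S u] by blast
    note J = gradient_matrix_L2[OF S \<phi>(1)]
    note dJ = L2.diff_closed[OF g J]
    have "(\<lambda>x. sym_part (gradient_matrix \<phi>) x - sym_part ?g x) = (\<lambda>x. (-1) *\<^sub>R sym_part (\<lambda>x. ?g x - gradient_matrix \<phi> x) x)"
      by (auto simp: sym_part_def fun_eq_iff transpose_def vec_eq_iff algebra_simps)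
    then have "L2.nrm S (\<lambda>x. sym_part (gradient_matrix \<phi>) x - sym_part ?g x) = \<bar>-1\<bar> * L2.nrm S (sym_part (\<lambda>x. ?g x - gradient_matrix \<phi> x))"
      using L2.nrm_scale[OF sym_part_L2[OF dJ], of "-1"] by simp
    also have "\<dots> \<le> \<epsilon>" using nrm_sym_part_le[OF dJ] \<phi>(2) by simp
    finally have 1: "L2.nrm S (sym_part (gradient_matrix \<phi>)) \<le> L2.nrm S (sym_part ?g) + \<epsilon>"
      using L2.nrm_le_diff[OF sym_part_L2[OF J] sym_part_L2[OF g]] by simp
    have "L2.nrm S (gradient_matrix \<phi>) \<le> sqrt 2 * L2.nrm S (sym_part (gradient_matrix \<phi>))"
      using real_sqrt_le_mono[OF Korn_test_function[OF S \<phi>(1)]] L2.nrm_nonneg[OF J] L2.nrm_nonneg[OF sym_part_L2[OF J]]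
      by (simp add: real_sqrt_mult)
    also have "\<dots> \<le> sqrt 2 * (L2.nrm S (sym_part ?g) + \<epsilon>)" using 1 by (intro mult_left_mono) auto
    finally have "L2.nrm S ?g \<le> sqrt 2 * (L2.nrm S (sym_part ?g) + \<epsilon>) + \<epsilon>"
      using L2.nrm_le_diff[OF g J] \<phi>(2) by simp
    also have "\<dots> = sqrt 2 * L2.nrm S (sym_part ?g) + e"
    proof -
      have "\<epsilon> * (1 + sqrt 2) = e" using p by (simp add: \<epsilon>_def)
      then show ?thesis by (simp add: algebra_simps)
    qed
    finally show ?thesis .
  qed
  then have "L2.nrm S ?g \<le> sqrt 2 * L2.nrm S (sym_part ?g)" by (rule field_le_epsilon)
  then have "(L2.nrm S ?g)\<^sup>2 \<le> (sqrt 2 * L2.nrm S (sym_part ?g))\<^sup>2"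
    using L2.nrm_nonneg[OF g] by (intro power_mono)
  then show ?thesis by (simp add: sym power_mult_distrib)
qed

section \<open>Composition with Sobolev functions\<close>

lemma abs_entry_le_norm: "\<bar>(A :: real^'n^'m) $ i $ j\<bar> \<le> norm A"
  using component_le_norm_cart[of "A $ i" j] Finite_Cartesian_Product.norm_nth_le[of A i] by linarith

text \<open>A crude constant: one factor \<open>CARD('d)\<close> from the sum in each entry, two
  more from summing the moduli of all entries.\<close>

lemma norm_matrix_mult_le:
  "norm ((A :: real^'d^'d) ** (C :: real^'d^'d)) \<le> real CARD('d) ^ 3 * norm A * norm C"
proof -
  have e: "\<bar>(A ** C) $ i $ j\<bar> \<le> real CARD('d) * (norm A * norm C)" for i j
  proof -
    have "\<bar>(A ** C) $ i $ j\<bar> \<le> (\<Sum>k\<in>UNIV. \<bar>A $ i $ k * C $ k $ j\<bar>)"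
      by (simp add: matrix_matrix_mult_def sum_abs)
    also have "\<dots> \<le> (\<Sum>k\<in>(UNIV :: 'd set). norm A * norm C)"
      unfolding abs_mult by (intro sum_mono mult_mono abs_entry_le_norm) auto
    finally show ?thesis by simp
  qed
  have "norm (A ** C) \<le> (\<Sum>i\<in>UNIV. norm ((A ** C) $ i))"
    unfolding norm_vec_def by (rule L2_set_le_sum) auto
  also have "\<dots> \<le> (\<Sum>i\<in>UNIV. \<Sum>j\<in>UNIV. \<bar>(A ** C) $ i $ j\<bar>)"
    by (intro sum_mono norm_le_l1_cart)
  also have "\<dots> \<le> (\<Sum>i\<in>(UNIV :: 'd set). \<Sum>j\<in>(UNIV :: 'd set). real CARD('d) * (norm A * norm C))"
    by (rule sum_mono, rule sum_mono, rule e)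
  finally show ?thesis by (simp add: power3_eq_cube mult_ac)
qed

lemma L2_mult_Linf:
  fixes A G :: "real^'d \<Rightarrow> real^'d^'d"
  assumes S: "S \<in> sets lebesgue" and A: "A \<in> L2 S" and G: "G \<in> borel_measurable (lebesgue_on S)"
    and b: "AE x in lebesgue. x \<in> S \<longrightarrow> norm (G x) \<le> M" and M: "M \<ge> 0"
  shows "(\<lambda>x. A x ** G x) \<in> L2 S"
    and "L2.nrm S (\<lambda>x. A x ** G x) \<le> real CARD('d) ^ 3 * M * L2.nrm S A"
proof -
  let ?K = "real CARD('d) ^ 3 * M"
  have entry: "(\<lambda>x. F x $ i $ j) \<in> borel_measurable (lebesgue_on S)"
    if "F \<in> borel_measurable (lebesgue_on S)" for F :: "real^'d \<Rightarrow> real^'d^'d" and i j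
    by (rule borel_measurable_continuous_on[OF _ that]) (intro continuous_intros)
  have m: "(\<lambda>x. A x ** G x) \<in> borel_measurable (lebesgue_on S)"
  proof (subst borel_measurable_euclidean_space, intro ballI)
    fix b :: "real^'d^'d" assume "b \<in> Basis"
    then obtain i j where b: "b = axis i (axis j 1)" by (auto simp: Basis_vec_def)
    have "(\<lambda>x. \<Sum>k\<in>UNIV. A x $ i $ k * G x $ k $ j) \<in> borel_measurable (lebesgue_on S)"
      by (intro borel_measurable_sum borel_measurable_times entry L2_measurable A G)
    then show "(\<lambda>x. (A x ** G x) \<bullet> b) \<in> borel_measurable (lebesgue_on S)"
      by (simp add: b inner_axis matrix_matrix_mult_def)
  qed
  have ae: "AE x in lebesgue_on S. (norm (A x ** G x))\<^sup>2 \<le> ?K\<^sup>2 * (norm (A x))\<^sup>2"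
    unfolding AE_lebesgue_on_iff[OF S] using b
  proof eventually_elim
    case (elim x)
    show ?case
    proof
      assume "x \<in> S"
      have "norm (A x ** G x) \<le> real CARD('d) ^ 3 * norm (A x) * norm (G x)" by (rule norm_matrix_mult_le)
      also have "\<dots> \<le> real CARD('d) ^ 3 * norm (A x) * M" using elim \<open>x \<in> S\<close> by (intro mult_left_mono) auto
      finally have "(norm (A x ** G x))\<^sup>2 \<le> (?K * norm (A x))\<^sup>2" by (intro power_mono) (auto simp: mult_ac)
      then show "(norm (A x ** G x))\<^sup>2 \<le> ?K\<^sup>2 * (norm (A x))\<^sup>2" by (simp only: power_mult_distrib)
    qed
  qed
  have i: "integrable (lebesgue_on S) (\<lambda>x. ?K\<^sup>2 * (norm (A x))\<^sup>2)"
    using L2_integrable[OF A] by (rule integrable_mult_right)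
  have i2: "integrable (lebesgue_on S) (\<lambda>x. (norm (A x ** G x))\<^sup>2)"
  proof (rule Bochner_Integration.integrable_bound[OF i])
    show "(\<lambda>x. (norm (A x ** G x))\<^sup>2) \<in> borel_measurable (lebesgue_on S)"
      by (intro borel_measurable_power measurable_compose[OF m borel_measurable_norm])
    show "AE x in lebesgue_on S. norm ((norm (A x ** G x))\<^sup>2) \<le> norm (?K\<^sup>2 * (norm (A x))\<^sup>2)"
      using ae by eventually_elim simp
  qed
  show L: "(\<lambda>x. A x ** G x) \<in> L2 S" using m i2 by (simp add: L2_def)
  have "l2_inner S (\<lambda>x. A x ** G x) (\<lambda>x. A x ** G x) \<le> ?K\<^sup>2 * l2_inner S A A"
    unfolding l2_inner_def using integral_mono_AE[OF i2 i ae] by (simp add: power2_norm_eq_inner)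
  then have "(L2.nrm S (\<lambda>x. A x ** G x))\<^sup>2 \<le> (?K * L2.nrm S A)\<^sup>2"
    by (simp add: L2.nrm_sq[OF L] L2.nrm_sq[OF A] power_mult_distrib)
  then show "L2.nrm S (\<lambda>x. A x ** G x) \<le> ?K * L2.nrm S A"
    by (rule power2_le_imp_le) (use M L2.nrm_nonneg[OF A] in simp)
qed

text \<open>\<open>nn_integral_comp_le\<close> applied to the squared norm of q; the square root of
  the measure factor bounds the norm of composition.\<close>

lemma (in expanding_map) L2_comp:
  fixes q :: "'a \<Rightarrow> 'b::euclidean_space"
  assumes \<Omega>: "open \<Omega>" "X ` B \<subseteq> \<Omega>" and q: "q \<in> L2 \<Omega>"
  shows "(\<lambda>x. q (X x)) \<in> L2 B"
    and "L2.nrm B (\<lambda>x. q (X x)) \<le> sqrt ((2 * L) ^ DIM('a)) * L2.nrm \<Omega> q"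
proof -
  let ?c = "(2 * L) ^ DIM('a)"
  have \<Omega>s: "\<Omega> \<in> sets lebesgue" using \<Omega>(1) by auto
  \<comment> \<open>The values of q outside \<Omega> are arbitrary; the extension by 0 is measurable
    on the whole space and agrees with q on the image of X.\<close>
  define q' where "q' y = (if y \<in> \<Omega> then q y else 0)" for y
  have q': "q' \<in> borel_measurable lebesgue"
    unfolding q'_def[abs_def] by (rule borel_measurable_if_I[OF L2_measurable[OF q] \<Omega>s])
  have eq: "q' (X x) = q (X x)" if "x \<in> B" for x using that \<Omega>(2) by (auto simp: q'_def)
  have m: "(\<lambda>x. q (X x)) \<in> borel_measurable (lebesgue_on B)"
    using measurable_compose[OF X_lebesgue q'] measurable_lebesgue_cong[of B "\<lambda>x. q' (X x)" "\<lambda>x. q (X x)" borel] eq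
    by blast
  have sq: "(norm (q' y))\<^sup>2 = (if y \<in> \<Omega> then (norm (q y))\<^sup>2 else 0)" for y by (simp add: q'_def)
  have i: "integrable lebesgue (\<lambda>y. (norm (q' y))\<^sup>2)"
    unfolding sq using L2_integrable[OF q] Lebesgue_Measure.integrable_restrict_UNIV[OF \<Omega>s, of "\<lambda>y. (norm (q y))\<^sup>2"] by simp
  have I: "(LINT y|lebesgue. (norm (q' y))\<^sup>2) = l2_inner \<Omega> q q"
    unfolding sq l2_inner_def using Lebesgue_Measure.integral_restrict_UNIV[OF \<Omega>s, of "\<lambda>y. (norm (q y))\<^sup>2"]
    by (simp add: power2_norm_eq_inner)
  have "(\<integral>\<^sup>+x. ennreal ((norm (q (X x)))\<^sup>2) \<partial>lebesgue_on B) = (\<integral>\<^sup>+x. ennreal ((norm (q' (X x)))\<^sup>2) \<partial>lebesgue_on B)"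
    by (intro nn_integral_cong) (simp add: eq)
  also have "\<dots> \<le> ennreal ?c * (\<integral>\<^sup>+y. ennreal ((norm (q' y))\<^sup>2) \<partial>lebesgue)"
    by (rule nn_integral_comp_le) (use i in auto)
  also have "(\<integral>\<^sup>+y. ennreal ((norm (q' y))\<^sup>2) \<partial>lebesgue) = ennreal (l2_inner \<Omega> q q)"
    using nn_integral_eq_integral[OF i] I by simp
  finally have le: "(\<integral>\<^sup>+x. ennreal ((norm (q (X x)))\<^sup>2) \<partial>lebesgue_on B) \<le> ennreal (?c * l2_inner \<Omega> q q)"
    using L L2.ip_nonneg[OF q] by (simp add: ennreal_mult)
  have int: "integrable (lebesgue_on B) (\<lambda>x. (norm (q (X x)))\<^sup>2)"
  proof (rule integrableI_nonneg)
    show "(\<lambda>x. (norm (q (X x)))\<^sup>2) \<in> borel_measurable (lebesgue_on B)"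
      by (intro borel_measurable_power measurable_compose[OF m borel_measurable_norm])
    show "(\<integral>\<^sup>+x. ennreal ((norm (q (X x)))\<^sup>2) \<partial>lebesgue_on B) < \<infinity>"
      using le by (simp add: order_le_less_trans)
  qed simp
  show L2: "(\<lambda>x. q (X x)) \<in> L2 B" using m int by (simp add: L2_def)
  have "ennreal (l2_inner B (\<lambda>x. q (X x)) (\<lambda>x. q (X x))) \<le> ennreal (?c * l2_inner \<Omega> q q)"
    using le nn_integral_eq_integral[OF int] by (simp add: l2_inner_def power2_norm_eq_inner)
  then have "l2_inner B (\<lambda>x. q (X x)) (\<lambda>x. q (X x)) \<le> ?c * l2_inner \<Omega> q q"
    using L L2.ip_nonneg[OF q] by (subst (asm) ennreal_le_iff) auto
  from real_sqrt_le_mono[OF this]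
  show "L2.nrm B (\<lambda>x. q (X x)) \<le> sqrt ?c * L2.nrm \<Omega> q"
    by (simp add: L2.nrm_def real_sqrt_mult)
qed

lemma bounded_linear_axis: "bounded_linear (\<lambda>c :: 'b::euclidean_space. axis i c :: 'b^'n)"
  by (simp add: linear_conv_bounded_linear[symmetric] linear_iff axis_def vec_eq_iff)

text \<open>For test functions the weak gradient of the composite is known from the chain rule. The
  weak equation is continuous in u and its gradient with respect to the L2 norms, and elements of
  H10 are limits of test functions, so the equation holds for u as well.\<close>

lemma H1_comp:
  fixes X :: "real^'d \<Rightarrow> real^'d"
  assumes B: "open B" "bounded B" and \<Omega>: "open \<Omega>" "X ` B \<subseteq> \<Omega>"
    and X: "X \<in> W1inf B" and ex: "expanding_map B X L"
  obtains C where "C \<ge> 0" "\<And>u. u \<in> H10 \<Omega> \<Longrightarrow> (\<lambda>x. u (X x)) \<in> H1 B"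
    "\<And>u. u \<in> H10 \<Omega> \<Longrightarrow> h1_norm B (\<lambda>x. u (X x)) \<le> C * h1_norm \<Omega> u"
proof -
  interpret expanding_map B X L by (rule ex)
  obtain R G M0 where XG: "AE x in lebesgue_on B. norm (X x) \<le> R" "G \<in> borel_measurable (lebesgue_on B)"
    "AE x in lebesgue_on B. norm (G x) \<le> M0" and wG: "has_weak_gradient X G B"
    using X unfolding W1inf_def Linf_def by blast
  define M where "M = max M0 0"
  have M: "M \<ge> 0" by (simp add: M_def)
  have XR: "AE x in lebesgue. x \<in> B \<longrightarrow> norm (X x) \<le> R" using XG(1) by (simp add: AE_lebesgue_on_iff[OF B_sets])
  have GM: "AE x in lebesgue. x \<in> B \<longrightarrow> norm (G x) \<le> M"
    using XG(3) unfolding AE_lebesgue_on_iff[OF B_sets] by eventually_elim (auto simp: M_def)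
  define K where "K = sqrt ((2 * L) ^ DIM(real^'d))"
  define K2 where "K2 = real CARD('d) ^ 3 * M"
  have K: "K \<ge> 0" "K2 \<ge> 0" using L M by (simp_all add: K_def K2_def)
  \<comment> \<open>If A is the gradient of u, then \<open>H A\<close> is the gradient that the
    chain rule predicts for the composite.\<close>
  define H where "H A x = A (X x) ** G x" for A :: "real^'d \<Rightarrow> real^'d^'d" and x
  have HL: "H A \<in> L2 B" "L2.nrm B (H A) \<le> K2 * (K * L2.nrm \<Omega> A)" if "A \<in> L2 \<Omega>" for A
  proof -
    note c = L2_comp[OF \<Omega> that]
    show "H A \<in> L2 B" unfolding H_def[abs_def] by (rule L2_mult_Linf(1)[OF B_sets c(1) XG(2) GM M])
    have "L2.nrm B (H A) \<le> K2 * L2.nrm B (\<lambda>x. A (X x))"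
      unfolding H_def[abs_def] K2_def by (rule L2_mult_Linf(2)[OF B_sets c(1) XG(2) GM M])
    also have "\<dots> \<le> K2 * (K * L2.nrm \<Omega> A)" using c(2) K by (intro mult_left_mono) (auto simp: K_def)
    finally show "L2.nrm B (H A) \<le> K2 * (K * L2.nrm \<Omega> A)" .
  qed
  have main: "(\<lambda>x. u (X x)) \<in> H1 B" "h1_norm B (\<lambda>x. u (X x)) \<le> (K * (K2 + 1)) * h1_norm \<Omega> u"
    if u: "u \<in> H10 \<Omega>" for u
  proof -
    have uH: "u \<in> H1 \<Omega>" using u by (simp add: H10_def)
    let ?w = "\<lambda>x. u (X x)"
    let ?g = "weak_grad \<Omega> u"
    note g = H1_weak_grad_L2[OF \<Omega>(1) uH]
    note w = L2_comp[OF \<Omega> H1_L2[OF uH]]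
    note Hg = HL[OF g]
    have weak: "has_weak_gradient ?w (H ?g) B"
    proof (rule has_weak_gradientI[OF B(1)])
      show "?w absolutely_integrable_on K" "H ?g absolutely_integrable_on K" if "compact K" "K \<subseteq> B" for K
        using L2_imp_absolutely_integrable[OF B_sets _ that] w(1) Hg(1) by blast+
      fix \<psi> :: "real^'d \<Rightarrow> real" and i j assume \<psi>: "\<psi> \<in> test_functions B"
      note d\<psi> = test_function_partial[OF \<psi> axis_Basis[of j]]
      \<comment> \<open>Placing the scalar weights at index i, respectively at entry (i, j), turns
        the two sides of the weak equation into L2 pairings, to which Cauchy-Schwarz
        applies.\<close>
      define P where "P x = (axis i (frechet_derivative \<psi> (at x) (axis j 1)) :: real^'d)" for x
      define Q where "Q x = (axis i (axis j (\<psi> x)) :: real^'d^'d)" for x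
      have P: "P \<in> L2 B"
        unfolding P_def[abs_def] by (rule test_function_L2[OF B(1) test_function_linear_image[OF bounded_linear_axis d\<psi>]])
      have Q: "Q \<in> L2 B" unfolding Q_def[abs_def]
        by (rule test_function_L2[OF B(1) test_function_linear_image[OF bounded_linear_axis
                test_function_linear_image[OF bounded_linear_axis \<psi>]]])
      have vP: "l2_inner B v P = (LINT x|lebesgue_on B. v x $ i * frechet_derivative \<psi> (at x) (axis j 1))" for v
        by (simp add: l2_inner_def P_def inner_axis)
      have AQ: "l2_inner B A Q = (LINT x|lebesgue_on B. A x $ i $ j * \<psi> x)" for A
        by (simp add: l2_inner_def Q_def inner_axis)
      have test: "l2_inner B (\<lambda>x. \<phi> (X x)) P + l2_inner B (H (gradient_matrix \<phi>)) Q = 0" if \<phi>: "\<phi> \<in> test_functions \<Omega>" for \<phi>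
      proof -
        have "H (gradient_matrix \<phi>) x $ i $ j = (\<Sum>k\<in>UNIV. frechet_derivative (\<lambda>x. \<phi> x $ i) (at (X x)) (axis k 1) * G x $ k $ j)" for x
          by (simp add: H_def matrix_matrix_mult_def gradient_matrix_entry[OF \<phi>])
        moreover have "(LINT x|lebesgue_on B. X x $ k * frechet_derivative \<psi> (at x) (axis j 1)) =
            - (LINT x|lebesgue_on B. G x $ k $ j * \<psi> x)" if "\<psi> \<in> test_functions B" for \<psi> k
          using wG that by (simp add: has_weak_gradient_def)
        note weak_chain_rule[OF B X_borel XR XG(2) GM this test_function_component[OF \<phi>, of i] \<psi>]
        ultimately show ?thesis by (simp add: vP AQ)
      qed
      define s where "s = l2_inner B ?w P + l2_inner B (H ?g) Q"
      have "\<bar>s\<bar> \<le> 0 + e" if e: "e > 0" for e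
      proof -
        \<comment> \<open>The defect s of the weak equation is at most \<open>D - 1\<close> times
          the approximation error e / D; the summand 1 keeps D positive.\<close>
        define D where "D = K * L2.nrm B P + K2 * K * L2.nrm B Q + 1"
        have D: "D > 0" using K L2.nrm_nonneg[OF P] L2.nrm_nonneg[OF Q] by (simp add: D_def add_nonneg_pos)
        then have "e / D > 0" using e by simp
        then obtain \<phi> where \<phi>: "\<phi> \<in> test_functions \<Omega>" "L2.nrm \<Omega> (\<lambda>x. u x - \<phi> x) \<le> e / D"
          "L2.nrm \<Omega> (\<lambda>x. ?g x - gradient_matrix \<phi> x) \<le> e / D"
          using H10_approx[OF \<Omega>(1) u] by blast
        note \<phi>L = test_function_L2[OF \<Omega>(1) \<phi>(1)] and J = gradient_matrix_L2[OF \<Omega>(1) \<phi>(1)]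
        note d1 = L2_comp[OF \<Omega> L2.diff_closed[OF H1_L2[OF uH] \<phi>L]]
        note d2 = HL[OF L2.diff_closed[OF g J]]
        have Hd: "H (\<lambda>x. ?g x - gradient_matrix \<phi> x) = (\<lambda>x. H ?g x - H (gradient_matrix \<phi>) x)"
          by (auto simp: H_def fun_eq_iff vec_eq_iff matrix_matrix_mult_def left_diff_distrib sum_subtractf)
        have s_eq: "s = l2_inner B (\<lambda>x. u (X x) - \<phi> (X x)) P + l2_inner B (H (\<lambda>x. ?g x - gradient_matrix \<phi> x)) Q"
          using test[OF \<phi>(1)] L2.ip_diff[OF w(1) L2_comp(1)[OF \<Omega> \<phi>L] P] L2.ip_diff[OF Hg(1) HL(1)[OF J] Q]
          by (simp add: s_def Hd)
        have "\<bar>s\<bar> \<le> L2.nrm B (\<lambda>x. u (X x) - \<phi> (X x)) * L2.nrm B P + L2.nrm B (H (\<lambda>x. ?g x - gradient_matrix \<phi> x)) * L2.nrm B Q"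
          using s_eq L2.Cauchy_Schwarz[OF d1(1) P] L2.Cauchy_Schwarz[OF d2(1) Q] by linarith
        also have "\<dots> \<le> (K * (e / D)) * L2.nrm B P + (K2 * (K * (e / D))) * L2.nrm B Q"
        proof (intro add_mono mult_right_mono)
          show "L2.nrm B (\<lambda>x. u (X x) - \<phi> (X x)) \<le> K * (e / D)"
            by (rule order_trans[OF d1(2)[folded K_def]]) (rule mult_left_mono[OF \<phi>(2) K(1)])
          show "L2.nrm B (H (\<lambda>x. ?g x - gradient_matrix \<phi> x)) \<le> K2 * (K * (e / D))"
            by (rule order_trans[OF d2(2)]) (intro mult_left_mono \<phi>(3) K)
        qed (rule L2.nrm_nonneg[OF P] L2.nrm_nonneg[OF Q])+
        also have "\<dots> = e * ((D - 1) / D)" by (simp add: D_def algebra_simps add_divide_distrib)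
        also have "\<dots> \<le> e * 1" using D e by (intro mult_left_mono) auto
        finally show ?thesis by simp
      qed
      then have "\<bar>s\<bar> \<le> 0" by (rule field_le_epsilon)
      then have "(LINT x|lebesgue_on B. ?w x $ i * frechet_derivative \<psi> (at x) (axis j 1)) = - (LINT x|lebesgue_on B. H ?g x $ i $ j * \<psi> x)"
        by (simp add: s_def vP AQ)
      then show "(LINT x|lebesgue. ?w x $ i * frechet_derivative \<psi> (at x) (axis j 1)) = - (LINT x|lebesgue. H ?g x $ i $ j * \<psi> x)"
        using lebesgue_on_mult_test[OF B(1) \<psi>, of "\<lambda>x. H ?g x $ i $ j"] lebesgue_on_mult_test[OF B(1) d\<psi>, of "\<lambda>x. ?w x $ i"]
        by simp
    qed
    show wH: "?w \<in> H1 B" by (rule H1I[OF w(1) Hg(1) weak])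
    have "L2.nrm B (weak_grad B ?w) = L2.nrm B (H ?g)"
      by (rule l2_nrm_AE_cong[OF B_sets Hg(1) H1_weak_grad_AE[OF B(1) weak], symmetric])
    also have "\<dots> \<le> K2 * (K * h1_norm \<Omega> u)"
      by (rule order_trans[OF Hg(2)]) (intro mult_left_mono nrm_weak_grad_le[OF \<Omega>(1) uH] K)
    finally have 1: "L2.nrm B (weak_grad B ?w) \<le> K2 * (K * h1_norm \<Omega> u)" .
    have 2: "L2.nrm B ?w \<le> K * h1_norm \<Omega> u"
      by (rule order_trans[OF w(2)[folded K_def]]) (intro mult_left_mono nrm_le_h1_norm[OF \<Omega>(1) uH] K)
    have n0: "0 \<le> L2.nrm B (weak_grad B ?w)" "0 \<le> L2.nrm B ?w"
      using L2.nrm_nonneg[OF H1_weak_grad_L2[OF B(1) wH]] L2.nrm_nonneg[OF w(1)] by auto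
    have "(h1_norm B ?w)\<^sup>2 \<le> (L2.nrm B (weak_grad B ?w) + L2.nrm B ?w)\<^sup>2"
      using n0 by (simp add: h1_norm_sq[OF B(1) wH] power2_sum)
    then have "h1_norm B ?w \<le> L2.nrm B (weak_grad B ?w) + L2.nrm B ?w"
      by (rule power2_le_imp_le) (use n0 in simp)
    then show "h1_norm B ?w \<le> (K * (K2 + 1)) * h1_norm \<Omega> u" using 1 2 by (simp add: algebra_simps)
  qed
  show thesis by (rule that[of "K * (K2 + 1)"]) (use K main in auto)
qed

section \<open>The inf-sup condition\<close>

lemma h1_norm_nrm: "open S \<Longrightarrow> semi_inner_space.nrm (h1_inner S) v = h1_norm S v"
  unfolding semi_inner_space.nrm_def[OF semi_inner_H1] h1_norm_def ..

lemma H1_L2_inner_le: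
  assumes "open S" "v \<in> H1 S" "w \<in> H1 S"
  shows "\<bar>l2_inner S v w\<bar> \<le> h1_norm S v * h1_norm S w"
    "\<bar>l2_inner S (weak_grad S v) (weak_grad S w)\<bar> \<le> h1_norm S v * h1_norm S w"
proof -
  note v = nrm_le_h1_norm[OF assms(1,2)] nrm_weak_grad_le[OF assms(1,2)]
    L2.nrm_nonneg[OF H1_L2[OF assms(2)]] L2.nrm_nonneg[OF H1_weak_grad_L2[OF assms(1,2)]]
  note w = nrm_le_h1_norm[OF assms(1,3)] nrm_weak_grad_le[OF assms(1,3)]
    L2.nrm_nonneg[OF H1_L2[OF assms(3)]] L2.nrm_nonneg[OF H1_weak_grad_L2[OF assms(1,3)]]
  show "\<bar>l2_inner S v w\<bar> \<le> h1_norm S v * h1_norm S w"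
    by (rule order_trans[OF L2.Cauchy_Schwarz[OF H1_L2[OF assms(2)] H1_L2[OF assms(3)]]])
      (use v w in \<open>intro mult_mono, auto\<close>)
  show "\<bar>l2_inner S (weak_grad S v) (weak_grad S w)\<bar> \<le> h1_norm S v * h1_norm S w"
    by (rule order_trans[OF L2.Cauchy_Schwarz[OF H1_weak_grad_L2[OF assms(1,2)] H1_weak_grad_L2[OF assms(1,3)]]])
      (use v w in \<open>intro mult_mono, auto\<close>)
qed

text \<open>Korn's constant 2 is paid for by halving \<nu>.\<close>

lemma a_fluid_coercive:
  fixes u :: "real^'d \<Rightarrow> real^'d"
  assumes "open \<Omega>" "u \<in> H10 \<Omega>" "\<alpha> > 0" "\<nu> > 0"
  shows "min \<alpha> (\<nu> / 2) * (h1_norm \<Omega> u)\<^sup>2 \<le> a_fluid \<alpha> \<nu> \<Omega> u u"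
proof -
  have u: "u \<in> H1 \<Omega>" using assms(2) by (simp add: H10_def)
  have s: "weak_grad_sym \<Omega> u \<in> L2 \<Omega>"
    using sym_part_L2[OF H1_weak_grad_L2[OF assms(1) u]] by (simp add: weak_grad_sym_def sym_part_def[abs_def])
  have "min \<alpha> (\<nu> / 2) * (h1_norm \<Omega> u)\<^sup>2 =
      min \<alpha> (\<nu> / 2) * (L2.nrm \<Omega> (weak_grad \<Omega> u))\<^sup>2 + min \<alpha> (\<nu> / 2) * (L2.nrm \<Omega> u)\<^sup>2"
    by (simp add: h1_norm_sq[OF assms(1) u] distrib_left)
  also have "\<dots> \<le> \<nu> / 2 * (2 * (L2.nrm \<Omega> (weak_grad_sym \<Omega> u))\<^sup>2) + \<alpha> * (L2.nrm \<Omega> u)\<^sup>2"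
    using assms(3,4) by (intro add_mono mult_mono Korn_H10[OF assms(1,2)]) auto
  finally show ?thesis
    by (simp add: a_fluid_def L2.nrm_sq[OF s] L2.nrm_sq[OF H1_L2[OF u]])
qed

text \<open>Collects what the test element asks of the multipliers, so that both choices are covered
  at once. \<open>comb\<close> provides l + a \<mu> with the triangle inequality in both directions,
  whether elements of \<Lambda> are functionals or functions; \<open>repr\<close> asks for half of
  the square, so that a supremum not known to be attained suffices; \<open>riesz\<close> turns Z
  into a multiplier that is no larger than Z.\<close>

lemma inf_sup_of_multiplier_space:
  fixes \<Omega> B :: "(real^'d) set" and X :: "real^'d \<Rightarrow> real^'d" and \<Lambda> :: "'l set" and N :: "'l \<Rightarrow> real"
    and c :: "'l \<Rightarrow> (real^'d \<Rightarrow> real^'d) \<Rightarrow> real"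
  assumes \<Omega>: "open \<Omega>" and B: "open B" and pos: "\<alpha> > 0" "\<nu> > 0" "\<gamma> > 0" "\<beta> \<ge> 0"
    and C: "C \<ge> 0" and comp: "\<And>u. u \<in> H10 \<Omega> \<Longrightarrow> (\<lambda>x. u (X x)) \<in> H1 B"
      "\<And>u. u \<in> H10 \<Omega> \<Longrightarrow> h1_norm B (\<lambda>x. u (X x)) \<le> C * h1_norm \<Omega> u"
    and N0: "\<And>l. l \<in> \<Lambda> \<Longrightarrow> 0 \<le> N l"
    and c_add: "\<And>l Y Z. l \<in> \<Lambda> \<Longrightarrow> Y \<in> H1 B \<Longrightarrow> Z \<in> H1 B \<Longrightarrow> c l (\<lambda>x. Y x + Z x) = c l Y + c l Z"
    and c_scale: "\<And>l Y a. l \<in> \<Lambda> \<Longrightarrow> Y \<in> H1 B \<Longrightarrow> c l (\<lambda>x. a *\<^sub>R Y x) = a * c l Y"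
    and comb: "\<And>l \<mu> a. l \<in> \<Lambda> \<Longrightarrow> \<mu> \<in> \<Lambda> \<Longrightarrow> \<exists>k\<in>\<Lambda>. (\<forall>Y\<in>H1 B. c k Y = c l Y + a * c \<mu> Y) \<and>
        N k \<le> N l + \<bar>a\<bar> * N \<mu> \<and> N l \<le> N k + \<bar>a\<bar> * N \<mu>"
    and repr: "\<And>l. l \<in> \<Lambda> \<Longrightarrow> \<exists>Y\<in>H1 B. h1_norm B Y \<le> N l \<and> (N l)\<^sup>2 / 2 \<le> c l Y"
    and riesz: "\<And>Z. Z \<in> H1 B \<Longrightarrow> \<exists>\<mu>\<in>\<Lambda>. N \<mu> \<le> h1_norm B Z \<and> c \<mu> Z = (h1_norm B Z)\<^sup>2"
  shows "\<exists>\<kappa>>0. ereal \<kappa> \<le> inf_sup (K_space \<Omega> B \<Lambda>) (V_norm \<Omega> B N) (A_form \<alpha> \<nu> \<beta> \<gamma> \<Omega> B X c)"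
proof -
  interpret H: semi_inner_space "H1 B" "h1_inner B" by (rule semi_inner_H1[OF B])
  note Hn = h1_norm_nrm[OF B]
  define k0 where "k0 = min \<alpha> (\<nu> / 2)"
  define m where "m = \<beta> + \<gamma>"
  \<comment> \<open>Chosen so that \<open>\<eta> * C\<^sup>2 \<le> k0 / 2\<close>: recovering the
    solid component then costs at most half of the fluid coercivity.\<close>
  define \<eta> where "\<eta> = k0 / (2 * (C\<^sup>2 + 1))"
  \<comment> \<open>The first bound gives \<open>\<delta> * m\<^sup>2 \<le> \<eta> / 4\<close>,
    which absorbs the mixed solid term; the second gives
    \<open>\<eta> * \<delta> \<le> 1 / 2\<close>, which keeps the norm of the test element
    nonzero.\<close>
  define \<delta> where "\<delta> = min (\<eta> / (4 * (m\<^sup>2 + 1))) (1 / (2 * \<eta>))"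
  \<comment> \<open>The coefficients left for the three squared norms after all absorptions.\<close>
  define \<kappa>1 where "\<kappa>1 = min (k0 / 2) (min (\<eta> / 4) (\<delta> / 4))"
  \<comment> \<open>The components of the test element are bounded by 1, by 1 + \<delta> and by 1 +
    \<eta> (1 + C) times the norm of U.\<close>
  define C2 where "C2 = sqrt (1 + (1 + \<delta>)\<^sup>2 + (1 + \<eta> * (1 + C))\<^sup>2)"
  have k0: "k0 > 0" using pos by (simp add: k0_def)
  have C1: "C\<^sup>2 + 1 > 0" "m\<^sup>2 + 1 > 0" by (simp_all add: add_nonneg_pos)
  have \<eta>: "\<eta> > 0" using k0 C1 by (simp add: \<eta>_def)
  have \<delta>: "\<delta> > 0" using \<eta> C1 by (simp add: \<delta>_def)
  have m: "m \<ge> 0" using pos by (simp add: m_def)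
  have \<kappa>1: "\<kappa>1 > 0" using k0 \<eta> \<delta> by (simp add: \<kappa>1_def)
  have \<eta>C: "\<eta> * C\<^sup>2 \<le> k0 / 2"
  proof -
    have "\<eta> * C\<^sup>2 \<le> \<eta> * (C\<^sup>2 + 1)" using \<eta> by (intro mult_left_mono) auto
    also have "\<dots> = k0 / 2" using C1 by (simp add: \<eta>_def divide_simps)
    finally show ?thesis .
  qed
  have \<delta>m: "\<delta> * m\<^sup>2 \<le> \<eta> / 4"
  proof -
    have "\<delta> * m\<^sup>2 \<le> \<delta> * (m\<^sup>2 + 1)" using \<delta> by (intro mult_left_mono) auto
    also have "\<dots> \<le> \<eta> / (4 * (m\<^sup>2 + 1)) * (m\<^sup>2 + 1)"
      using C1 by (intro mult_right_mono) (auto simp: \<delta>_def)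
    also have "\<dots> = \<eta> / 4" using C1 by (simp add: divide_simps)
    finally show ?thesis .
  qed
  have \<eta>\<delta>: "\<eta> * \<delta> \<le> 1 / 2"
  proof -
    have "\<eta> * \<delta> \<le> \<eta> * (1 / (2 * \<eta>))" using \<eta> by (intro mult_left_mono) (auto simp: \<delta>_def)
    then show ?thesis using \<eta> by simp
  qed
  have C2: "C2 > 0" unfolding C2_def by (simp add: add_pos_nonneg)
  have key: "\<exists>V\<in>{V \<in> K_space \<Omega> B \<Lambda>. V_norm \<Omega> B N V \<noteq> 0}.
      \<kappa>1 / C2 \<le> A_form \<alpha> \<nu> \<beta> \<gamma> \<Omega> B X c U V / (V_norm \<Omega> B N U * V_norm \<Omega> B N V)"
    if U: "U \<in> K_space \<Omega> B \<Lambda>" "V_norm \<Omega> B N U \<noteq> 0" for U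
  proof -
    obtain u x l where Ueq: "U = (u, x, l)" by (cases U) auto
    have u: "u \<in> H10 \<Omega>" and x: "x \<in> H1 B" and l: "l \<in> \<Lambda>" 
      and div: "\<forall>q\<in>L2_zero_mean \<Omega>. l2_inner \<Omega> (weak_div \<Omega> u) q = 0"
      using U(1) by (auto simp: Ueq K_space_def V_space_def)
    have uH: "u \<in> H1 \<Omega>" using u by (simp add: H10_def)
    define w where "w s = u (X s)" for s
    have w: "w \<in> H1 B" using comp(1)[OF u] by (simp add: w_def[abs_def])
    define z where "z s = w s - x s" for s
    have z: "z \<in> H1 B" unfolding z_def[abs_def] by (rule H.diff_closed[OF w x])
    obtain y where y: "y \<in> H1 B" "h1_norm B y \<le> N l" "(N l)\<^sup>2 / 2 \<le> c l y" using repr[OF l] by blast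
    obtain \<mu> where \<mu>: "\<mu> \<in> \<Lambda>" "N \<mu> \<le> h1_norm B z" "c \<mu> z = (h1_norm B z)\<^sup>2" using riesz[OF z] by blast
    obtain k where k: "k \<in> \<Lambda>" "\<And>Y. Y \<in> H1 B \<Longrightarrow> c k Y = c l Y - \<eta> * c \<mu> Y"
      "N k \<le> N l + \<eta> * N \<mu>" "N l \<le> N k + \<eta> * N \<mu>"
      using comb[OF l \<mu>(1), of "- \<eta>"] \<eta> by auto
    define y' where "y' s = x s - \<delta> *\<^sub>R y s" for s
    have dy: "(\<lambda>s. \<delta> *\<^sub>R y s) \<in> H1 B" by (rule H.scale_closed[OF y(1)])
    have y': "y' \<in> H1 B" unfolding y'_def[abs_def] by (rule H.diff_closed[OF x dy])
    define V where "V = (u, y', k)"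
    have VK: "V \<in> K_space \<Omega> B \<Lambda>" using u y' k(1) div by (auto simp: V_def K_space_def V_space_def)
    define a where "a = h1_norm \<Omega> u"
    define b where "b = h1_norm B x"
    define n where "n = N l"
    define t where "t = h1_norm B z"
    define S where "S = V_norm \<Omega> B N U"
    define T where "T = V_norm \<Omega> B N V"
    have nonneg: "0 \<le> a" "0 \<le> b" "0 \<le> n" "0 \<le> t"
      using semi_inner_space.ip_nonneg[OF semi_inner_H1[OF \<Omega>] uH] H.nrm_nonneg[OF x] H.nrm_nonneg[OF z] N0[OF l]
      by (simp_all add: a_def b_def n_def t_def Hn h1_norm_def)
    have S: "S\<^sup>2 = a\<^sup>2 + b\<^sup>2 + n\<^sup>2" "S \<ge> 0" by (simp_all add: S_def Ueq V_norm_def a_def b_def n_def)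
    have T: "T\<^sup>2 = a\<^sup>2 + (h1_norm B y')\<^sup>2 + (N k)\<^sup>2" "T \<ge> 0" by (simp_all add: T_def V_def V_norm_def a_def)
    have Sp: "S > 0" using U(2) S(2) by (simp add: S_def)
    have wC: "h1_norm B w \<le> C * a" using comp(2)[OF u] by (simp add: w_def[abs_def] a_def)
    \<comment> \<open>The norms of x and z control each other up to the norm of w, which is at most
      C a.\<close>
    have bt: "b \<le> t + C * a"
    proof -
      have "h1_norm B x \<le> h1_norm B w + h1_norm B (\<lambda>s. x s - w s)" using H.nrm_le_diff[OF x w] by (simp add: Hn)
      moreover have "h1_norm B (\<lambda>s. x s - w s) = t"
        using H.nrm_scale[OF z, of "-1"] by (simp add: Hn t_def z_def)
      ultimately show ?thesis using wC by (simp add: b_def)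
    qed
    have tb: "t \<le> C * a + b"
      using H.nrm_triangle_diff[OF w x] wC by (simp add: Hn t_def z_def[abs_def] b_def)
    have yb: "h1_norm B y' \<le> b + \<delta> * n" "b \<le> h1_norm B y' + \<delta> * n"
    proof -
      have sc: "h1_norm B (\<lambda>s. \<delta> *\<^sub>R y s) \<le> \<delta> * n"
        using H.nrm_scale[OF y(1), of \<delta>] y(2) \<delta> by (simp add: Hn n_def)
      show "h1_norm B y' \<le> b + \<delta> * n"
        using H.nrm_triangle_diff[OF x dy] sc by (simp add: Hn y'_def[abs_def] b_def)
      have "(\<lambda>s. y' s + \<delta> *\<^sub>R y s) = x" by (simp add: y'_def)
      then show "b \<le> h1_norm B y' + \<delta> * n"
        using H.nrm_triangle[OF y' dy] sc by (simp add: Hn b_def)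
    qed
    have "\<eta> * N \<mu> \<le> \<eta> * t" using \<mu>(2) \<eta> by (intro mult_left_mono) (auto simp: t_def)
    then have nk: "N k \<le> n + \<eta> * t" "n \<le> N k + \<eta> * t"
      using k(3,4) unfolding n_def by linarith+
    have Ny: "0 \<le> h1_norm B y'" "0 \<le> N k" using H.nrm_nonneg[OF y'] N0[OF k(1)] by (simp_all add: Hn)
    \<comment> \<open>If the norm of V vanished, then a = 0, \<open>b \<le> \<delta> * n\<close> and
      \<open>n \<le> \<eta> * b\<close>; as \<eta> \<delta> is at most 1/2, this loop forces n = b =
      0 and contradicts the choice of U.\<close>
    have Tn: "T \<noteq> 0"
    proof
      assume "T = 0"
      then have "a\<^sup>2 + (h1_norm B y')\<^sup>2 + (N k)\<^sup>2 = 0" using T by simp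
      then have z0: "a = 0" "h1_norm B y' = 0" "N k = 0" by (auto simp: add_nonneg_eq_0_iff)
      have "\<eta> * t \<le> \<eta> * b" using tb z0(1) \<eta> by (intro mult_left_mono) auto
      then have "b \<le> \<delta> * n" "n \<le> \<eta> * b" using yb(2) z0 nk(2) by auto
      then have "n \<le> \<eta> * (\<delta> * n)"
        using \<eta> by (intro order_trans[OF \<open>n \<le> \<eta> * b\<close> mult_left_mono]) auto
      also have "\<dots> \<le> 1 / 2 * n" using mult_right_mono[OF \<eta>\<delta> nonneg(3)] by (simp add: mult.assoc)
      finally have "n = 0" using nonneg by simp
      then have "b = 0" using \<open>b \<le> \<delta> * n\<close> nonneg by simp
      then show False using \<open>n = 0\<close> z0 S Sp by simp
    qed
    then have Tp: "T > 0" using T(2) by simp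
    have sS: "a \<le> S" "b \<le> S" "n \<le> S"
      using S nonneg by (auto intro!: power2_le_imp_le[OF _ S(2)])
    have TS: "T \<le> C2 * S"
    proof -
      have "\<delta> * n \<le> \<delta> * S" using sS(3) \<delta> by (intro mult_left_mono) auto
      then have h1: "h1_norm B y' \<le> (1 + \<delta>) * S"
        using yb(1) sS by (simp add: algebra_simps)
      have "t \<le> (1 + C) * S"
        using tb sS mult_left_mono[OF sS(1) C] by (simp add: algebra_simps)
      then have "\<eta> * t \<le> \<eta> * ((1 + C) * S)" using \<eta> by (intro mult_left_mono) auto
      then have h2: "N k \<le> (1 + \<eta> * (1 + C)) * S"
        using nk(1) sS by (simp add: algebra_simps)
      have "T\<^sup>2 \<le> S\<^sup>2 + ((1 + \<delta>) * S)\<^sup>2 + ((1 + \<eta> * (1 + C)) * S)\<^sup>2"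
        unfolding T(1) using nonneg Ny by (intro add_mono power_mono sS h1 h2)
      also have "\<dots> = (C2 * S)\<^sup>2"
        unfolding C2_def power_mult_distrib by (simp add: add_nonneg_nonneg algebra_simps)
      finally show ?thesis by (rule power2_le_imp_le) (use C2 S in simp)
    qed
    have solid: "a_solid \<beta> \<gamma> B x y' \<ge> - \<delta> * m * b * n"
    proof -
      \<comment> \<open>Linearity is available for \<open>h1_inner\<close> and
        \<open>l2_inner\<close>, whereas \<open>weak_grad\<close> itself is linear only almost
        everywhere; hence the rewriting.\<close>
      have eq: "a_solid \<beta> \<gamma> B x v = \<gamma> * h1_inner B x v + (\<beta> - \<gamma>) * l2_inner B x v" for v
        by (simp add: a_solid_def h1_inner_def algebra_simps)
      have "a_solid \<beta> \<gamma> B x y' = a_solid \<beta> \<gamma> B x x - \<delta> * a_solid \<beta> \<gamma> B x y"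
        unfolding eq y'_def[abs_def] H.ip_diff_right[OF x dy x] L2.ip_diff_right[OF H1_L2[OF x] H1_L2[OF dy] H1_L2[OF x]]
          H.ip_scale_right[OF y(1) x] L2.ip_scale_right[OF H1_L2[OF y(1)] H1_L2[OF x]]
        by (simp add: algebra_simps)
      \<comment> \<open>For \<beta> = 0 this square controls gradients only. It is bounded below by
        0, and the control of x is drawn from t.\<close>
      moreover have "a_solid \<beta> \<gamma> B x x \<ge> 0"
        using pos L2.ip_nonneg[OF H1_L2[OF x]] L2.ip_nonneg[OF H1_weak_grad_L2[OF B x]] by (simp add: a_solid_def)
      moreover have "a_solid \<beta> \<gamma> B x y \<le> m * (b * n)"
      proof -
        have "a_solid \<beta> \<gamma> B x y \<le> \<beta> * (b * h1_norm B y) + \<gamma> * (b * h1_norm B y)"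
          unfolding a_solid_def using H1_L2_inner_le[OF B x y(1)] pos
          by (intro add_mono mult_left_mono) (auto simp: b_def)
        also have "\<dots> = m * (b * h1_norm B y)" by (simp add: m_def algebra_simps)
        also have "\<dots> \<le> m * (b * n)" using y(2) m nonneg by (intro mult_left_mono) (auto simp: n_def)
        finally show ?thesis .
      qed
      then have "\<delta> * a_solid \<beta> \<gamma> B x y \<le> \<delta> * (m * (b * n))" using \<delta> by (intro mult_left_mono) auto
      ultimately show ?thesis by (simp add: mult.assoc)
    qed
    have fluid: "k0 * a\<^sup>2 \<le> a_fluid \<alpha> \<nu> \<Omega> u u"
      unfolding k0_def a_def by (rule a_fluid_coercive[OF \<Omega> u pos(1,2)])
    have c1: "c l (\<lambda>s. u (X s) - y' s) = c l z + \<delta> * c l y"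
    proof -
      have "(\<lambda>s. u (X s) - y' s) = (\<lambda>s. z s + \<delta> *\<^sub>R y s)" by (simp add: z_def w_def y'_def fun_eq_iff)
      then show ?thesis by (simp add: c_add[OF l z dy] c_scale[OF l y(1)])
    qed
    have c2: "c k (\<lambda>s. u (X s) - x s) = c l z - \<eta> * t\<^sup>2"
      using k(2)[OF z] \<mu>(3) by (simp add: t_def z_def[abs_def] w_def)
    \<comment> \<open>The pairings \<open>c l z\<close> from \<open>c1\<close> and \<open>c2\<close>
      enter with opposite signs and cancel, leaving the terms with \<delta> and \<eta>.\<close>
    have A: "A_form \<alpha> \<nu> \<beta> \<gamma> \<Omega> B X c U V = a_fluid \<alpha> \<nu> \<Omega> u u + a_solid \<beta> \<gamma> B x y' + \<delta> * c l y + \<eta> * t\<^sup>2"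
      by (simp add: A_form_def Ueq V_def c1 c2)
    have "\<delta> * (n\<^sup>2 / 2) \<le> \<delta> * c l y" using y(3) \<delta> by (intro mult_left_mono) (auto simp: n_def)
    then have "k0 * a\<^sup>2 - \<delta> * m * b * n + \<delta> * (n\<^sup>2 / 2) + \<eta> * t\<^sup>2 \<le> A_form \<alpha> \<nu> \<beta> \<gamma> \<Omega> B X c U V"
      unfolding A using fluid solid by linarith
    \<comment> \<open>Squaring \<open>b \<le> t + C * a\<close> gives
      \<open>b\<^sup>2 \<le> 2 * t\<^sup>2 + 2 * (C * a)\<^sup>2\<close>, so t controls b at the
      expense of half of the fluid term.\<close>
    moreover have "\<eta> * t\<^sup>2 \<ge> \<eta> / 2 * b\<^sup>2 - k0 / 2 * a\<^sup>2"
    proof -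
      have "b\<^sup>2 \<le> (t + C * a)\<^sup>2" using bt nonneg by (intro power_mono)
      also have "\<dots> \<le> 2 * t\<^sup>2 + 2 * (C * a)\<^sup>2"
        using sum_squares_bound[of t "C * a"] by (simp add: power2_sum)
      finally have "\<eta> / 2 * b\<^sup>2 \<le> \<eta> / 2 * (2 * t\<^sup>2 + 2 * (C * a)\<^sup>2)" using \<eta> by (intro mult_left_mono) auto
      also have "\<dots> = \<eta> * t\<^sup>2 + \<eta> * C\<^sup>2 * a\<^sup>2" by (simp add: power_mult_distrib algebra_simps)
      also have "\<dots> \<le> \<eta> * t\<^sup>2 + k0 / 2 * a\<^sup>2" using \<eta>C by (intro add_left_mono mult_right_mono) auto
      finally show ?thesis by simp
    qed
    \<comment> \<open>Young's inequality, weighted so that half of the available coefficients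
      \<delta> / 2 of the squared n and \<eta> / 2 of the squared b is consumed.\<close>
    moreover have "\<delta> * m * b * n \<le> \<delta> / 4 * n\<^sup>2 + \<eta> / 4 * b\<^sup>2"
    proof -
      have "m * b * n \<le> n\<^sup>2 / 4 + m\<^sup>2 * b\<^sup>2"
        using sum_squares_bound[of "m * b" "n / 2"] by (simp add: power_mult_distrib power_divide)
      then have "\<delta> * (m * b * n) \<le> \<delta> * (n\<^sup>2 / 4 + m\<^sup>2 * b\<^sup>2)" using \<delta> by (intro mult_left_mono) auto
      also have "\<dots> = \<delta> / 4 * n\<^sup>2 + \<delta> * m\<^sup>2 * b\<^sup>2" by (simp add: algebra_simps)
      also have "\<dots> \<le> \<delta> / 4 * n\<^sup>2 + \<eta> / 4 * b\<^sup>2" using \<delta>m by (intro add_left_mono mult_right_mono) auto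
      finally show ?thesis by (simp add: mult.assoc)
    qed
    ultimately have "k0 / 2 * a\<^sup>2 + \<eta> / 4 * b\<^sup>2 + \<delta> / 4 * n\<^sup>2 \<le> A_form \<alpha> \<nu> \<beta> \<gamma> \<Omega> B X c U V"
      by (simp add: algebra_simps)
    moreover have "\<kappa>1 * S\<^sup>2 \<le> k0 / 2 * a\<^sup>2 + \<eta> / 4 * b\<^sup>2 + \<delta> / 4 * n\<^sup>2"
      unfolding S(1) distrib_left by (intro add_mono mult_right_mono) (auto simp: \<kappa>1_def)
    ultimately have AS: "\<kappa>1 * S\<^sup>2 \<le> A_form \<alpha> \<nu> \<beta> \<gamma> \<Omega> B X c U V" by linarith
    have "\<kappa>1 / C2 * (S * T) \<le> \<kappa>1 / C2 * (S * (C2 * S))"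
      using TS \<kappa>1 C2 S(2) by (intro mult_left_mono) auto
    also have "\<dots> = \<kappa>1 * S\<^sup>2" using C2 by (simp add: power2_eq_square)
    finally have "\<kappa>1 / C2 * (S * T) \<le> A_form \<alpha> \<nu> \<beta> \<gamma> \<Omega> B X c U V" using AS by linarith
    then have "\<kappa>1 / C2 \<le> A_form \<alpha> \<nu> \<beta> \<gamma> \<Omega> B X c U V / (S * T)"
      using Sp Tp by (simp add: pos_le_divide_eq)
    then show ?thesis using VK Tn by (intro bexI[of _ V]) (auto simp: S_def T_def)
  qed
  have "ereal (\<kappa>1 / C2) \<le> inf_sup (K_space \<Omega> B \<Lambda>) (V_norm \<Omega> B N) (A_form \<alpha> \<nu> \<beta> \<gamma> \<Omega> B X c)"
    unfolding inf_sup_def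
  proof (rule INF_greatest)
    fix U assume U: "U \<in> {U \<in> K_space \<Omega> B \<Lambda>. V_norm \<Omega> B N U \<noteq> 0}"
    obtain V where V: "V \<in> {V \<in> K_space \<Omega> B \<Lambda>. V_norm \<Omega> B N V \<noteq> 0}"
      "\<kappa>1 / C2 \<le> A_form \<alpha> \<nu> \<beta> \<gamma> \<Omega> B X c U V / (V_norm \<Omega> B N U * V_norm \<Omega> B N V)"
      using key[of U] U by blast
    show "ereal (\<kappa>1 / C2) \<le> (SUP V\<in>{V \<in> K_space \<Omega> B \<Lambda>. V_norm \<Omega> B N V \<noteq> 0}.
        ereal (A_form \<alpha> \<nu> \<beta> \<gamma> \<Omega> B X c U V / (V_norm \<Omega> B N U * V_norm \<Omega> B N V)))"
      by (rule SUP_upper2[OF V(1)]) (use V(2) in simp)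
  qed
  moreover have "\<kappa>1 / C2 > 0" using \<kappa>1 C2 by simp
  ultimately show ?thesis by blast
qed

text \<open>Makes the supremum in \<open>h1_dual_norm\<close> range over a nonempty set. If all
  functions of the approximating sequence had norm 0, their limit, the indicator of a nonempty open
  set, would vanish almost everywhere.\<close>

lemma H1_nontrivial:
  fixes B :: "(real^'d) set"
  assumes "open B" "B \<noteq> {}"
  obtains Y where "Y \<in> H1 B" "h1_norm B Y \<noteq> 0"
proof -
  obtain x0 where x0: "{x0} \<subseteq> B" using assms(2) by blast
  obtain W and \<psi> :: "nat \<Rightarrow> real^'d \<Rightarrow> real" where W: "open W" "{x0} \<subseteq> W" "W \<subseteq> B"
    and \<psi>: "\<And>n. \<psi> n \<in> test_functions B" "\<And>x. (\<lambda>n. \<psi> n x) \<longlonglongrightarrow> indicator W x"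
    using smooth_approx_indicator[OF compact_sing assms(1) x0] by metis
  have Bs: "B \<in> sets lebesgue" using assms(1) by auto
  \<comment> \<open>Any coordinate serves; \<open>undefined\<close> is just some index.\<close>
  define Y where "Y n x = (axis undefined (\<psi> n x) :: real^'d)" for n x
  have t: "Y n \<in> test_functions B" for n
    unfolding Y_def[abs_def] by (rule test_function_linear_image[OF bounded_linear_axis \<psi>(1)])
  have "\<exists>n. h1_norm B (Y n) \<noteq> 0"
  proof (rule ccontr)
    assume "\<nexists>n. h1_norm B (Y n) \<noteq> 0"
    then have z: "h1_norm B (Y n) = 0" for n by blast
    have "AE x in lebesgue. x \<in> B \<longrightarrow> \<psi> n x = 0" for n
    proof -
      have "l2_inner B (Y n) (Y n) = 0"
        using nrm_le_h1_norm[OF assms(1) test_function_H1[OF assms(1) t], of n] z[of n]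
          L2.nrm_nonneg[OF test_function_L2[OF assms(1) t], of n]
          L2.nrm_sq[OF test_function_L2[OF assms(1) t], of n] by simp
      then have "AE x in lebesgue_on B. Y n x \<bullet> Y n x = 0"
        using L2_inner_integrable[OF test_function_L2[OF assms(1) t] test_function_L2[OF assms(1) t], of n n]
        unfolding l2_inner_def by (subst (asm) integral_nonneg_eq_0_iff_AE) auto
      then show ?thesis unfolding AE_lebesgue_on_iff[OF Bs]
        by eventually_elim (auto simp: Y_def)
    qed
    then have "AE x in lebesgue. \<forall>n. x \<in> B \<longrightarrow> \<psi> n x = 0" unfolding AE_all_countable by blast
    then have "AE x in lebesgue. x \<notin> W"
    proof eventually_elim
      case (elim x)
      show ?case
      proof
        assume x: "x \<in> W"
        then have "\<psi> n x = 0" for n using elim W(3) by blast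
        then show False using \<psi>(2)[of x] x LIMSEQ_unique[OF \<psi>(2)[of x], of 0] by simp
      qed
    qed
    then have "negligible W"
      using W(1) by (simp add: negligible_iff_null_sets completion.null_sets_iff_AE)
    then show False using open_not_negligible[OF W(1)] W(2) by blast
  qed
  then show thesis using that test_function_H1[OF assms(1) t] by blast
qed

section \<open>The dual of H1, its norm, and combinations of multipliers\<close>

context
  fixes B :: "(real^'d) set"
  assumes B: "open B" "B \<noteq> {}"
begin

interpretation H: semi_inner_space "H1 B" "h1_inner B" by (rule semi_inner_H1[OF B(1)])

lemma H1_dualD:
  assumes "\<mu> \<in> H1_dual B"
  shows "Y \<in> H1 B \<Longrightarrow> Z \<in> H1 B \<Longrightarrow> \<mu> (\<lambda>x. Y x + Z x) = \<mu> Y + \<mu> Z"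
    and "Y \<in> H1 B \<Longrightarrow> \<mu> (\<lambda>x. a *\<^sub>R Y x) = a * \<mu> Y"
    and "\<exists>C. \<forall>Y\<in>H1 B. \<bar>\<mu> Y\<bar> \<le> C * h1_norm B Y"
  using assms unfolding H1_dual_def by blast+

lemma h1_norm_nonneg: "Y \<in> H1 B \<Longrightarrow> 0 \<le> h1_norm B Y"
  using H.nrm_nonneg by (simp add: h1_norm_nrm[OF B(1)])

text \<open>A real supremum is meaningful only for a set that is bounded above; the boundedness of
  \<mu> secures this before the dual norm is used.\<close>

lemma dual_quotients_bdd:
  assumes "\<mu> \<in> H1_dual B"
  shows "bdd_above ((\<lambda>Y. \<mu> Y / h1_norm B Y) ` {Y \<in> H1 B. h1_norm B Y \<noteq> 0})"
proof -
  obtain C where C: "\<forall>Y\<in>H1 B. \<bar>\<mu> Y\<bar> \<le> C * h1_norm B Y" using H1_dualD(3)[OF assms] by blast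
  show ?thesis
  proof (rule bdd_aboveI2)
    fix Y assume "Y \<in> {Y \<in> H1 B. h1_norm B Y \<noteq> 0}"
    then have Y: "Y \<in> H1 B" "h1_norm B Y > 0" using h1_norm_nonneg[of Y] by auto
    then show "\<mu> Y / h1_norm B Y \<le> C" using C by (auto simp: pos_divide_le_eq abs_le_iff)
  qed
qed

lemma h1_dual_norm_least:
  assumes "\<And>Y. Y \<in> H1 B \<Longrightarrow> \<mu> Y \<le> K * h1_norm B Y"
  shows "h1_dual_norm B \<mu> \<le> K"
  unfolding h1_dual_norm_def
proof (rule cSUP_least)
  show "{Y \<in> H1 B. h1_norm B Y \<noteq> 0} \<noteq> {}" using H1_nontrivial[OF B] by blast
  fix Y assume "Y \<in> {Y \<in> H1 B. h1_norm B Y \<noteq> 0}"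
  then have Y: "Y \<in> H1 B" "h1_norm B Y > 0" using h1_norm_nonneg[of Y] by auto
  then show "\<mu> Y / h1_norm B Y \<le> K" using assms by (simp add: pos_divide_le_eq)
qed

lemma dual_pairing_le:
  assumes \<mu>: "\<mu> \<in> H1_dual B" and Y: "Y \<in> H1 B"
  shows "\<bar>\<mu> Y\<bar> \<le> h1_dual_norm B \<mu> * h1_norm B Y"
proof (cases "h1_norm B Y = 0")
  \<comment> \<open>The dual norm leaves out elements of norm 0; on these the boundedness of \<mu>
    forces the value 0.\<close>
  case True
  then show ?thesis using H1_dualD(3)[OF \<mu>] Y by auto
next
  case False
  then have p: "h1_norm B Y > 0" using h1_norm_nonneg[OF Y] by simp
  have le: "\<mu> Z \<le> h1_dual_norm B \<mu> * h1_norm B Z" if "Z \<in> H1 B" "h1_norm B Z > 0" for Z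
  proof -
    have "\<mu> Z / h1_norm B Z \<le> h1_dual_norm B \<mu>"
      unfolding h1_dual_norm_def by (rule cSUP_upper[OF _ dual_quotients_bdd[OF \<mu>]]) (use that in simp)
    then show ?thesis using that by (simp add: pos_divide_le_eq)
  qed
  \<comment> \<open>The supremum is one-sided; testing with -Y as well bounds the modulus.\<close>
  have "h1_norm B (\<lambda>x. (-1) *\<^sub>R Y x) = h1_norm B Y"
    using H.nrm_scale[OF Y, of "-1"] by (simp add: h1_norm_nrm[OF B(1)])
  then have "\<mu> (\<lambda>x. (-1) *\<^sub>R Y x) \<le> h1_dual_norm B \<mu> * h1_norm B Y"
    using le[OF H.scale_closed[OF Y, of "-1"]] p by simp
  then show ?thesis using le[OF Y p] H1_dualD(2)[OF \<mu> Y, of "-1"] by (simp add: abs_le_iff)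
qed

lemma h1_dual_norm_nonneg:
  assumes "\<mu> \<in> H1_dual B"
  shows "0 \<le> h1_dual_norm B \<mu>"
proof -
  obtain Y where Y: "Y \<in> H1 B" "h1_norm B Y \<noteq> 0" using H1_nontrivial[OF B] by blast
  then have p: "h1_norm B Y > 0" using h1_norm_nonneg[OF Y(1)] by simp
  have "0 \<le> h1_dual_norm B \<mu> * h1_norm B Y" using dual_pairing_le[OF assms Y(1)] by linarith
  then show ?thesis using p by (simp add: zero_le_mult_iff)
qed

lemma H1_dual_combination:
  assumes l: "l \<in> H1_dual B" and \<mu>: "\<mu> \<in> H1_dual B"
  shows "\<exists>k\<in>H1_dual B. (\<forall>Y\<in>H1 B. k Y = l Y + a * \<mu> Y) \<and>
      h1_dual_norm B k \<le> h1_dual_norm B l + \<bar>a\<bar> * h1_dual_norm B \<mu> \<and>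
      h1_dual_norm B l \<le> h1_dual_norm B k + \<bar>a\<bar> * h1_dual_norm B \<mu>"
proof -
  define k where "k Y = l Y + a * \<mu> Y" for Y
  have le: "\<bar>k Y\<bar> \<le> (h1_dual_norm B l + \<bar>a\<bar> * h1_dual_norm B \<mu>) * h1_norm B Y" if "Y \<in> H1 B" for Y
  proof -
    have "\<bar>a * \<mu> Y\<bar> \<le> \<bar>a\<bar> * (h1_dual_norm B \<mu> * h1_norm B Y)"
      unfolding abs_mult by (intro mult_left_mono dual_pairing_le[OF \<mu> that]) simp
    then show ?thesis using dual_pairing_le[OF l that] by (simp add: k_def distrib_right mult.assoc)
  qed
  have k: "k \<in> H1_dual B"
    unfolding H1_dual_def
  proof (intro CollectI conjI ballI allI exI)
    show "k (\<lambda>x. Y x + Z x) = k Y + k Z" if "Y \<in> H1 B" "Z \<in> H1 B" for Y Z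
      using H1_dualD(1)[OF l that] H1_dualD(1)[OF \<mu> that] by (simp add: k_def algebra_simps)
    show "k (\<lambda>x. b *\<^sub>R Y x) = b * k Y" if "Y \<in> H1 B" for Y b
      using H1_dualD(2)[OF l that, of b] H1_dualD(2)[OF \<mu> that, of b] by (simp add: k_def algebra_simps)
    show "\<bar>k Y\<bar> \<le> (h1_dual_norm B l + \<bar>a\<bar> * h1_dual_norm B \<mu>) * h1_norm B Y" if "Y \<in> H1 B" for Y
      by (rule le[OF that])
  qed
  have "h1_dual_norm B k \<le> h1_dual_norm B l + \<bar>a\<bar> * h1_dual_norm B \<mu>"
    by (rule h1_dual_norm_least) (use le in \<open>auto simp: abs_le_iff\<close>)
  moreover have "h1_dual_norm B l \<le> h1_dual_norm B k + \<bar>a\<bar> * h1_dual_norm B \<mu>"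
  proof (rule h1_dual_norm_least)
    fix Y assume Y: "Y \<in> H1 B"
    have "\<bar>a * \<mu> Y\<bar> \<le> \<bar>a\<bar> * (h1_dual_norm B \<mu> * h1_norm B Y)"
      unfolding abs_mult by (intro mult_left_mono dual_pairing_le[OF \<mu> Y]) simp
    then show "l Y \<le> (h1_dual_norm B k + \<bar>a\<bar> * h1_dual_norm B \<mu>) * h1_norm B Y"
      using dual_pairing_le[OF k Y] by (simp add: k_def distrib_right mult.assoc)
  qed
  ultimately show ?thesis using k by (intro bexI[of _ k]) (simp_all add: k_def)
qed

text \<open>Unless the norm is 0, some quotient exceeds half of the supremum; rescaling its Y to the
  norm of l turns the quotient into the required value.\<close>

lemma H1_dual_almost_attained:
  assumes l: "l \<in> H1_dual B"
  shows "\<exists>Y\<in>H1 B. h1_norm B Y \<le> h1_dual_norm B l \<and> (h1_dual_norm B l)\<^sup>2 / 2 \<le> l Y"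
proof -
  define n where "n = h1_dual_norm B l"
  have n: "n \<ge> 0" unfolding n_def by (rule h1_dual_norm_nonneg[OF l])
  \<comment> \<open>For n = 0 no quotient need exceed n / 2; then any Y of nonzero norm will do,
    since it is rescaled by 0 afterwards.\<close>
  have "\<exists>Y\<in>H1 B. h1_norm B Y \<noteq> 0 \<and> (n = 0 \<or> n / 2 < l Y / h1_norm B Y)"
  proof (cases "n = 0")
    case True
    then show ?thesis using H1_nontrivial[OF B] by metis
  next
    case False
    then have "n / 2 < h1_dual_norm B l" using n by (simp add: n_def)
    then have "\<exists>Y\<in>{Y \<in> H1 B. h1_norm B Y \<noteq> 0}. n / 2 < l Y / h1_norm B Y"
      unfolding h1_dual_norm_def
      by (subst (asm) less_cSUP_iff) (use H1_nontrivial[OF B] dual_quotients_bdd[OF l] in blast)+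
    then show ?thesis by blast
  qed
  then obtain Y where Y: "Y \<in> H1 B" "h1_norm B Y \<noteq> 0" "n = 0 \<or> n / 2 < l Y / h1_norm B Y" by blast
  have p: "h1_norm B Y > 0" using Y h1_norm_nonneg[OF Y(1)] by simp
  define Z where "Z x = (n / h1_norm B Y) *\<^sub>R Y x" for x
  have Z: "Z \<in> H1 B" unfolding Z_def[abs_def] by (rule H.scale_closed[OF Y(1)])
  have "h1_norm B Z = n"
    using H.nrm_scale[OF Y(1), of "n / h1_norm B Y"] p n by (simp add: h1_norm_nrm[OF B(1)] Z_def[abs_def])
  moreover have "l Z = n * (l Y / h1_norm B Y)"
    using H1_dualD(2)[OF l Y(1), of "n / h1_norm B Y"] by (simp add: Z_def[abs_def])
  moreover have "n * (n / 2) \<le> n * (l Y / h1_norm B Y)"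
  proof (cases "n = 0")
    case False
    then have "n / 2 \<le> l Y / h1_norm B Y" using Y(3) by simp
    then show ?thesis using n by (rule mult_left_mono)
  qed simp
  ultimately show ?thesis using Z by (intro bexI[of _ Z]) (simp_all add: n_def power2_eq_square)
qed

text \<open>The elementary half of the Riesz representation: Z acts by \<open>h1_inner B Z\<close>,
  and Cauchy-Schwarz bounds the dual norm.\<close>

lemma H1_dual_riesz:
  assumes Z: "Z \<in> H1 B"
  shows "\<exists>\<mu>\<in>H1_dual B. h1_dual_norm B \<mu> \<le> h1_norm B Z \<and> \<mu> Z = (h1_norm B Z)\<^sup>2"
proof (intro bexI[of _ "h1_inner B Z"] conjI)
  have cs: "\<bar>h1_inner B Z Y\<bar> \<le> h1_norm B Z * h1_norm B Y" if "Y \<in> H1 B" for Y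
    using H.Cauchy_Schwarz[OF Z that] by (simp add: h1_norm_nrm[OF B(1)])
  show "h1_dual_norm B (h1_inner B Z) \<le> h1_norm B Z"
    by (rule h1_dual_norm_least) (use cs in \<open>auto simp: abs_le_iff\<close>)
  show "h1_inner B Z Z = (h1_norm B Z)\<^sup>2"
    using H.nrm_sq[OF Z] by (simp add: h1_norm_nrm[OF B(1)])
  show "h1_inner B Z \<in> H1_dual B"
    unfolding H1_dual_def using cs H.ip_add_right[OF _ _ Z] H.ip_scale_right[OF _ Z] by blast
qed

lemma H1_combination:
  assumes l: "l \<in> H1 B" and \<mu>: "\<mu> \<in> H1 B"
  shows "\<exists>k\<in>H1 B. (\<forall>Y\<in>H1 B. h1_inner B k Y = h1_inner B l Y + a * h1_inner B \<mu> Y) \<and>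
      h1_norm B k \<le> h1_norm B l + \<bar>a\<bar> * h1_norm B \<mu> \<and> h1_norm B l \<le> h1_norm B k + \<bar>a\<bar> * h1_norm B \<mu>"
proof -
  define k where "k x = l x + a *\<^sub>R \<mu> x" for x
  have a\<mu>: "(\<lambda>x. a *\<^sub>R \<mu> x) \<in> H1 B" by (rule H.scale_closed[OF \<mu>])
  have k: "k \<in> H1 B" unfolding k_def[abs_def] by (rule H.add_closed[OF l a\<mu>])
  have "h1_inner B k Y = h1_inner B l Y + a * h1_inner B \<mu> Y" if "Y \<in> H1 B" for Y
    unfolding k_def[abs_def] using H.ip_add[OF l a\<mu> that] H.ip_scale[OF \<mu> that] by simp
  moreover have "h1_norm B k \<le> h1_norm B l + \<bar>a\<bar> * h1_norm B \<mu>"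
    unfolding k_def[abs_def] using H.nrm_triangle[OF l a\<mu>] H.nrm_scale[OF \<mu>] by (simp add: h1_norm_nrm[OF B(1)])
  moreover have "h1_norm B l \<le> h1_norm B k + \<bar>a\<bar> * h1_norm B \<mu>"
    using H.nrm_triangle_diff[OF k a\<mu>] H.nrm_scale[OF \<mu>] by (simp add: h1_norm_nrm[OF B(1)] k_def)
  ultimately show ?thesis using k by blast
qed

end

section \<open>The two choices of multipliers\<close>

theorem proposition6:
  fixes \<Omega> B :: "(real^'d) set"
    and Xbar :: "real^'d \<Rightarrow> real^'d"
    and \<alpha> \<nu> \<beta> \<gamma> :: real
  assumes "CARD('d) = 2 \<or> CARD('d) = 3"
    and "bounded_lipschitz_domain \<Omega>"
    and "bounded_lipschitz_domain B"
    and "Xbar \<in> W1inf B"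
    and "inj_on Xbar B"
    and "\<exists>L. L-lipschitz_on (Xbar ` B) (inv_into B Xbar)"
    and "closure (Xbar ` B) \<subseteq> \<Omega>"
    and "\<alpha> > 0" and "\<nu> > 0" and "\<gamma> > 0" and "\<beta> \<ge> 0"
  shows "(\<exists>\<kappa>\<^sub>0>0.
            inf_sup (K_space \<Omega> B (H1_dual B)) (V_norm \<Omega> B (h1_dual_norm B))
              (A_form \<alpha> \<nu> \<beta> \<gamma> \<Omega> B Xbar c_dual) \<ge> ereal \<kappa>\<^sub>0) \<and>
         (\<exists>\<kappa>\<^sub>0>0.
            inf_sup (K_space \<Omega> B (H1 B)) (V_norm \<Omega> B (h1_norm B))
              (A_form \<alpha> \<nu> \<beta> \<gamma> \<Omega> B Xbar (h1_inner B)) \<ge> ereal \<kappa>\<^sub>0)"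
proof -
  have \<Omega>: "open \<Omega>" and B: "open B" "bounded B" "B \<noteq> {}"
    using assms(2,3) by (auto simp: bounded_lipschitz_domain_def)
  have img: "Xbar ` B \<subseteq> \<Omega>" using assms(7) closure_subset by blast
  obtain L where L: "L-lipschitz_on (Xbar ` B) (inv_into B Xbar)" using assms(6) by blast
  then have L0: "L \<ge> 0" by (rule lipschitz_on_nonneg)
  \<comment> \<open>The locale asks for a positive constant, while a Lipschitz constant is only
    known to be nonnegative; hence L + 1.\<close>
  have "expanding_map B Xbar (L + 1)"
  proof
    show "Xbar \<in> borel_measurable (lebesgue_on B)" using assms(4) by (simp add: W1inf_def Linf_def)
    fix x y assume xy: "x \<in> B" "y \<in> B"
    have "dist x y \<le> L * dist (Xbar x) (Xbar y)"
      using lipschitz_onD[OF L, of "Xbar x" "Xbar y"] xy assms(5) by simp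
    then show "dist x y \<le> (L + 1) * dist (Xbar x) (Xbar y)"
      using zero_le_dist[of "Xbar x" "Xbar y"] unfolding distrib_right mult_1 by linarith
  qed (use B L0 in auto)
  from H1_comp[OF B(1,2) \<Omega> img assms(4) this] obtain C where C: "C \<ge> 0"
    "\<And>u. u \<in> H10 \<Omega> \<Longrightarrow> (\<lambda>x. u (Xbar x)) \<in> H1 B"
    "\<And>u. u \<in> H10 \<Omega> \<Longrightarrow> h1_norm B (\<lambda>x. u (Xbar x)) \<le> C * h1_norm \<Omega> u" by metis
  interpret H: semi_inner_space "H1 B" "h1_inner B" by (rule semi_inner_H1[OF B(1)])
  note common = \<Omega> B(1) assms(8,9,10,11) C
  have sq: "h1_inner B Y Y = (h1_norm B Y)\<^sup>2" if "Y \<in> H1 B" for Y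
    using H.nrm_sq[OF that] by (simp add: h1_norm_nrm[OF B(1)])
  have n0: "0 \<le> h1_norm B Y" if "Y \<in> H1 B" for Y by (rule h1_norm_nonneg[OF B(1,3) that])
  show ?thesis
  proof
    show "\<exists>\<kappa>\<^sub>0>0. inf_sup (K_space \<Omega> B (H1_dual B)) (V_norm \<Omega> B (h1_dual_norm B))
              (A_form \<alpha> \<nu> \<beta> \<gamma> \<Omega> B Xbar c_dual) \<ge> ereal \<kappa>\<^sub>0"
    proof (rule inf_sup_of_multiplier_space[where C = C and N = "h1_dual_norm B" and c = c_dual])
      show "c_dual l (\<lambda>x. Y x + Z x) = c_dual l Y + c_dual l Z" if "l \<in> H1_dual B" "Y \<in> H1 B" "Z \<in> H1 B" for l Y Z
        unfolding c_dual_def by (rule H1_dualD(1)[OF B(1,3) that])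
      show "c_dual l (\<lambda>x. a *\<^sub>R Y x) = a * c_dual l Y" if "l \<in> H1_dual B" "Y \<in> H1 B" for l Y a
        unfolding c_dual_def by (rule H1_dualD(2)[OF B(1,3) that])
      show "\<exists>k\<in>H1_dual B. (\<forall>Y\<in>H1 B. c_dual k Y = c_dual l Y + a * c_dual \<mu> Y) \<and>
          h1_dual_norm B k \<le> h1_dual_norm B l + \<bar>a\<bar> * h1_dual_norm B \<mu> \<and>
          h1_dual_norm B l \<le> h1_dual_norm B k + \<bar>a\<bar> * h1_dual_norm B \<mu>"
        if "l \<in> H1_dual B" "\<mu> \<in> H1_dual B" for l \<mu> a
        unfolding c_dual_def by (rule H1_dual_combination[OF B(1,3) that])
      show "\<exists>Y\<in>H1 B. h1_norm B Y \<le> h1_dual_norm B l \<and> (h1_dual_norm B l)\<^sup>2 / 2 \<le> c_dual l Y"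
        if "l \<in> H1_dual B" for l
        unfolding c_dual_def by (rule H1_dual_almost_attained[OF B(1,3) that])
      show "\<exists>\<mu>\<in>H1_dual B. h1_dual_norm B \<mu> \<le> h1_norm B Z \<and> c_dual \<mu> Z = (h1_norm B Z)\<^sup>2"
        if "Z \<in> H1 B" for Z
        unfolding c_dual_def by (rule H1_dual_riesz[OF B(1,3) that])
    qed (use common h1_dual_norm_nonneg[OF B(1,3)] in auto)
    show "\<exists>\<kappa>\<^sub>0>0. inf_sup (K_space \<Omega> B (H1 B)) (V_norm \<Omega> B (h1_norm B))
              (A_form \<alpha> \<nu> \<beta> \<gamma> \<Omega> B Xbar (h1_inner B)) \<ge> ereal \<kappa>\<^sub>0"
    proof (rule inf_sup_of_multiplier_space[where C = C and N = "h1_norm B" and c = "h1_inner B"])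
      show "h1_inner B l (\<lambda>x. Y x + Z x) = h1_inner B l Y + h1_inner B l Z" if "l \<in> H1 B" "Y \<in> H1 B" "Z \<in> H1 B" for l Y Z
        by (rule H.ip_add_right[OF that(2,3,1)])
      show "h1_inner B l (\<lambda>x. a *\<^sub>R Y x) = a * h1_inner B l Y" if "l \<in> H1 B" "Y \<in> H1 B" for l Y a
        by (rule H.ip_scale_right[OF that(2,1)])
      show "\<exists>k\<in>H1 B. (\<forall>Y\<in>H1 B. h1_inner B k Y = h1_inner B l Y + a * h1_inner B \<mu> Y) \<and>
          h1_norm B k \<le> h1_norm B l + \<bar>a\<bar> * h1_norm B \<mu> \<and> h1_norm B l \<le> h1_norm B k + \<bar>a\<bar> * h1_norm B \<mu>"
        if "l \<in> H1 B" "\<mu> \<in> H1 B" for l \<mu> a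
        by (rule H1_combination[OF B(1,3) that])
      \<comment> \<open>Under choice (ii) the multiplier represents itself, and the pairing is the
        full square of its norm.\<close>
      show "\<exists>Y\<in>H1 B. h1_norm B Y \<le> h1_norm B l \<and> (h1_norm B l)\<^sup>2 / 2 \<le> h1_inner B l Y" if "l \<in> H1 B" for l
        using that sq[OF that] by (intro bexI[of _ l]) simp_all
      show "\<exists>\<mu>\<in>H1 B. h1_norm B \<mu> \<le> h1_norm B Z \<and> h1_inner B \<mu> Z = (h1_norm B Z)\<^sup>2" if "Z \<in> H1 B" for Z
        using that sq[OF that] by (intro bexI[of _ Z]) simp_all
    qed (use common n0 in auto)
  qed
qed

end
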